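(* Let $(E,X,\pi,\mathcal{N})$ be a bundle of locally convex algebras such that for every $x\in X$ the fiber $\pi^{-1}(x)$ is isomorphic as a locally convex algebra to, and is identified with, $\mathcal{F}_d/\overline{I_x}$ for some graded ideal $I_x\subset\mathcal{P}_d$. Suppose that for each $i=1,\dots,d$ the section $S_i:X\to E$, $x\mapsto s_i+\overline{I_x}$, is continuous. Suppose also that for some $r\in(0,1)$ the map $\sigma_r:E\to\mathbb{R}_{\geq0}$, defined on each fiber by $\pi^{-1}(x)\ni e\mapsto\|e\|_r$, is continuous. Then the map $\phi:X\to\mathcal{M}$ defined by $\phi(x)=p_{I_x}$ is continuous.
   Context: Fix a natural number $d\geq 1$; $e_1,\dots,e_d$ is the standard orthonormal basis of $\mathbb{C}^d$. The full Fock space $\mathcal{F}(\mathbb{C}^d)$ is the Hilbert direct sum of $(\mathbb{C}^d)^{\otimes k}$, $k\geq0$. The creation operators $s_j$ are the isometries $e_{i_1}\otimes\cdots\otimes e_{i_k}\mapsto e_j\otimes e_{i_1}\otimes\cdots\otimes e_{i_k}$. $\mathcal{P}_d\subset\mathcal{B}(\mathcal{F}(\mathbb{C}^d))$ is the unital algebra generated by $s_1,\dots,s_d$ (a free algebra on these generators), graded by $\mathcal{P}_d^k=\operatorname{span}\{s_{i_1}\cdots s_{i_k}\}$. Graded ideals are two-sided ideals of the form $I=\bigoplus_{k\geq1}I^k\subset\mathcal{P}_d$ with $I^k\subset\mathcal{P}_d^k$. Let $Ev:\mathcal{P}_d\to\mathcal{F}(\mathbb{C}^d)$ be the linear map $s_{i_1}\cdots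 s_{i_k}\mapsto e_{i_1}\otimes\cdots\otimes e_{i_k}$; $p_I\in\mathcal{B}(\mathcal{F}(\mathbb{C}^d))$ is the orthogonal projection onto $Ev(I)^\perp$. $\mathcal{M}$ is the set of all such $p_I$ ($I$ a graded ideal), with the topology induced from the strong operator topology. Let $\mathbb{F}_d^+$ be the free unital semigroup on $g_1,\dots,g_d$; for $\alpha=g_{i_1}\cdots g_{i_k}$ put $|\alpha|=k$, $z_\alpha=z_{i_1}\cdots z_{i_k}$ (noncommuting formal variables) and $T_\alpha=T_{i_1}\cdots T_{i_k}$. For a formal free series $F=\sum_\alpha a_\alpha z_\alpha$ put $F_k(T_1,\dots,T_d)=\sum_{|\alpha|=k}a_\alpha T_\alpha$. Let $H$ be an infinite-dimensional Hilbert space and, for $x>0$, $[\mathcal{B}(H)^d]_x=\{(T_1,\dots,T_d)\in\mathcal{B}(H)^d:\|T_1T_1^*+\cdots+T_dT_d^*\|<x^2\}$. $\mathcal{F}_d=\mathcal{F}_d^1$ is the algebra of all formal free series $F$ with $\sum_{k\geq0}\|F_k(T_1,\dots,T_d)\|<\infty$ for all $(T_1,\dots,T_d)\in[\mathcal{B}(H)^d]_1$, with multiplication of formal free series and the topology given by the norms $\|F\|_x=\sup_{(T_1,\dots,T_d)\in[\mathcal{B}(H)^d]_x}\|\sum_{k\geq0}F_k(T_1,\dots,T_d)\|$, $0<x<1$. $\mathcal{P}_d$ is identified with a dense subalgebra of $\mathcal{F}_d$ by $s_i\mapsto z_i$; $\overline{I}$ denotes the closure of $I$ in $\mathcal{F}_d$,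 $\mathcal{F}_d/\overline{I}$ has the quotient topology, and for $e\in\mathcal{F}_d/\overline{I}$, $\|e\|_r$ denotes the quotient seminorm $\inf\{\|F\|_r:F\in\mathcal{F}_d,\ F+\overline{I}=e\}$. A bundle of locally convex algebras is a quadruple $(E,X,\pi,\mathcal{N})$ where $E,X$ are topological spaces, $\pi:E\to X$ is a continuous open surjection, each fiber $\pi^{-1}(x)$ carries the structure of an algebra, and $\mathcal{N}$ is a directed family of functions $\sigma:E\to\mathbb{R}_{\geq0}$ restricting to a seminorm on each fiber (directed: for all $\sigma_1,\sigma_2\in\mathcal{N}$ there are $\sigma\in\mathcal{N}$, $C>0$ with $\sigma_1\le C\sigma$ and $\sigma_2\le C\sigma$ on $E$), such that: (A1) $E\times_XE\to E$, $(e_1,e_2)\mapsto e_1+e_2$ is continuous; (A2) $E\times\mathbb{C}\to E$, $(e,\lambda)\mapsto\lambda e$ is continuous; (A3) $E\times_XE\to E$, $(e_1,e_2)\mapsto e_1e_2$ is continuous; (A4) for each $x\in X$, the sets $\{e\in E:\pi(e)\in U,\ \sigma(e)<\varepsilon\}$, with $U$ an open neighborhood of $x$, $\sigma\in\mathcal{N}$, $\varepsilon>0$, form a local base at the zero vector $0_x$ of $\pi^{-1}(x)$; (A5) every $\sigma\in\mathcal{N}$ is continuous on $E$. Each fiber carries the topology induced from $E$, which coincides with the one defined by the restrictions of the seminorms in $\mathcal{N}$. *)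

theory Defs
  imports "HOL-Analysis.Analysis"
begin

section \<open>Complex Hilbert spaces and operators on them\<close>

class complex_vector = real_vector +
  fixes scaleC :: "complex \<Rightarrow> 'a \<Rightarrow> 'a" (infixr "*\<^sub>C" 75)
  assumes scaleC_add_right: "c *\<^sub>C (x + y) = c *\<^sub>C x + c *\<^sub>C y"
    and scaleC_add_left: "(b + c) *\<^sub>C x = b *\<^sub>C x + c *\<^sub>C x"
    and scaleC_scaleC: "b *\<^sub>C c *\<^sub>C x = (b * c) *\<^sub>C x"
    and scaleC_of_real: "complex_of_real r *\<^sub>C x = r *\<^sub>R x"

class complex_normed_vector = complex_vector + real_normed_vector +
  assumes norm_scaleC: "norm (c *\<^sub>C x) = cmod c * norm x"

text \<open>\<^term>\<open>cinner\<close> is antilinear in its first argument.  Norm, metric and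
  topology are those of \<^class>\<open>real_inner\<close>, for the real part of \<^term>\<open>cinner\<close>.\<close>

class complex_hilbert = complex_normed_vector + real_inner + banach +
  fixes cinner :: "'a \<Rightarrow> 'a \<Rightarrow> complex"
  assumes cinner_commute: "cinner x y = cnj (cinner y x)"
    and cinner_add_right: "cinner x (y + z) = cinner x y + cinner x z"
    and cinner_scaleC_right: "cinner x (c *\<^sub>C y) = c * cinner x y"
    and inner_eq_Re_cinner: "inner x y = Re (cinner x y)"

global_interpretation complex_vector: vector_space "scaleC :: complex \<Rightarrow> 'a \<Rightarrow> 'a :: complex_vector"
  defines csubspace = complex_vector.subspace
    and cspan = complex_vector.span
    and crepresentation = complex_vector.representation
proof
  show "1 *\<^sub>C x = x" for x :: 'a
    using scaleC_of_real [of 1 x] by simp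
qed (simp_all add: scaleC_add_right scaleC_add_left scaleC_scaleC)

definition infinite_dimensional :: "'h::complex_vector itself \<Rightarrow> bool" where
  "infinite_dimensional H \<longleftrightarrow> \<not> (\<exists>B::'h set. finite B \<and> cspan B = UNIV)"

instantiation blinfun :: (real_normed_vector, complex_normed_vector) complex_vector
begin

lift_definition scaleC_blinfun :: "complex \<Rightarrow> ('a \<Rightarrow>\<^sub>L 'b) \<Rightarrow> ('a \<Rightarrow>\<^sub>L 'b)"
  is "\<lambda>c f x. c *\<^sub>C f x"
proof -
  fix c :: complex and f :: "'a \<Rightarrow> 'b"
  assume f: "bounded_linear f"
  have "c *\<^sub>C (r *\<^sub>R y) = r *\<^sub>R (c *\<^sub>C y)" for r and y :: 'b
    by (metis scaleC_of_real scaleC_scaleC mult.commute)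
  moreover obtain K where "\<And>x. norm (f x) \<le> norm x * K"
    using bounded_linear.bounded [OF f] by blast
  then have "norm (c *\<^sub>C f x) \<le> norm x * (cmod c * K)" for x
    using mult_left_mono [of "norm (f x)" "norm x * K" "cmod c"]
    by (simp add: norm_scaleC mult.left_commute)
  ultimately show "bounded_linear (\<lambda>x. c *\<^sub>C f x)"
    using f by (intro bounded_linear_intro [where K = "cmod c * K"])
      (auto simp: linear_simps scaleC_add_right)
qed

instance
  by standard (transfer; simp add: fun_eq_iff scaleC_add_right scaleC_add_left scaleC_scaleC scaleC_of_real)+

end

text \<open>The elements of \<open>\<B>(H)\<close>; the type of operators only imposes real linearity.\<close>

definition complex_linear :: "('h::complex_normed_vector \<Rightarrow>\<^sub>L 'h) \<Rightarrow> bool" where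
  "complex_linear T \<longleftrightarrow> (\<forall>c x. T (c *\<^sub>C x) = c *\<^sub>C T x)"

definition hilbert_adjoint :: "('h::complex_hilbert \<Rightarrow>\<^sub>L 'h) \<Rightarrow> ('h \<Rightarrow>\<^sub>L 'h)" where
  "hilbert_adjoint T = (THE S :: 'h \<Rightarrow>\<^sub>L 'h. \<forall>x y. cinner (T x) y = cinner x (S y))"

definition orthogonal_compl :: "'h::complex_hilbert set \<Rightarrow> 'h set" where
  "orthogonal_compl S = {x. \<forall>y\<in>S. cinner y x = 0}"

definition orthogonal_proj :: "'h::complex_hilbert set \<Rightarrow> ('h \<Rightarrow>\<^sub>L 'h)" where
  "orthogonal_proj V = (THE P :: 'h \<Rightarrow>\<^sub>L 'h. \<forall>x. P x \<in> V \<and> x - P x \<in> orthogonal_compl V)"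

definition op_word :: "('d \<Rightarrow> 'h::real_normed_vector \<Rightarrow>\<^sub>L 'h) \<Rightarrow> 'd list \<Rightarrow> ('h \<Rightarrow>\<^sub>L 'h)" where
  "op_word T \<alpha> = foldr (\<lambda>i A. T i o\<^sub>L A) \<alpha> id_blinfun"


section \<open>The Hilbert space of square summable families\<close>

typedef 'i l2 = "{f :: 'i \<Rightarrow> complex. (\<lambda>i. (cmod (f i))\<^sup>2) summable_on UNIV}"
  morphisms l2_apply Abs_l2
  by (rule exI [of _ "\<lambda>_. 0"]) simp

setup_lifting type_definition_l2

lemma l2_add_summable:
  fixes f g :: "'i \<Rightarrow> complex"
  assumes "(\<lambda>i. (cmod (f i))\<^sup>2) summable_on UNIV" "(\<lambda>i. (cmod (g i))\<^sup>2) summable_on UNIV"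
  shows "(\<lambda>i. (cmod (f i + g i))\<^sup>2) summable_on UNIV"
proof (rule summable_on_comparison_test)
  show "(\<lambda>i. 2 * (cmod (f i))\<^sup>2 + 2 * (cmod (g i))\<^sup>2) summable_on UNIV"
    by (intro summable_on_add summable_on_cmult_right assms)
  show "(cmod (f i + g i))\<^sup>2 \<le> 2 * (cmod (f i))\<^sup>2 + 2 * (cmod (g i))\<^sup>2" for i
  proof -
    have "(cmod (f i + g i))\<^sup>2 \<le> (cmod (f i) + cmod (g i))\<^sup>2"
      by (intro power_mono norm_triangle_ineq) simp
    also have "\<dots> \<le> 2 * (cmod (f i))\<^sup>2 + 2 * (cmod (g i))\<^sup>2"
      using zero_le_power2 [of "cmod (f i) - cmod (g i)"]
      by (simp add: power2_eq_square algebra_simps)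
    finally show ?thesis .
  qed
qed auto

lemma l2_scale_summable:
  fixes f :: "'i \<Rightarrow> complex"
  assumes "(\<lambda>i. (cmod (f i))\<^sup>2) summable_on UNIV"
  shows "(\<lambda>i. (cmod (c * f i))\<^sup>2) summable_on UNIV"
  by (simp add: norm_mult power_mult_distrib summable_on_cmult_right assms)

instantiation l2 :: (type) complex_vector
begin

lift_definition zero_l2 :: "'a l2" is "\<lambda>_. 0" by simp
lift_definition plus_l2 :: "'a l2 \<Rightarrow> 'a l2 \<Rightarrow> 'a l2" is "\<lambda>f g i. f i + g i"
  by (rule l2_add_summable)
lift_definition uminus_l2 :: "'a l2 \<Rightarrow> 'a l2" is "\<lambda>f i. - f i" by simp
lift_definition minus_l2 :: "'a l2 \<Rightarrow> 'a l2 \<Rightarrow> 'a l2" is "\<lambda>f g i. f i - g i"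
  using l2_add_summable [of _ "\<lambda>i. - _ i"] by simp
lift_definition scaleC_l2 :: "complex \<Rightarrow> 'a l2 \<Rightarrow> 'a l2" is "\<lambda>c f i. c * f i"
  by (rule l2_scale_summable)
lift_definition scaleR_l2 :: "real \<Rightarrow> 'a l2 \<Rightarrow> 'a l2" is "\<lambda>r f i. complex_of_real r * f i"
  by (rule l2_scale_summable)

instance
  by standard (transfer; simp add: fun_eq_iff algebra_simps)+

end

lemma l2_summable: "(\<lambda>i. (cmod (l2_apply f i))\<^sup>2) summable_on UNIV"
  using l2_apply [of f] by simp

lemma l2_mult_summable: "(\<lambda>i. cnj (l2_apply f i) * l2_apply g i) summable_on UNIV"
proof -
  have "(\<lambda>i. norm (cnj (l2_apply f i) * l2_apply g i)) summable_on UNIV"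
  proof (rule summable_on_comparison_test)
    show "(\<lambda>i. (cmod (l2_apply f i))\<^sup>2 + (cmod (l2_apply g i))\<^sup>2) summable_on UNIV"
      by (intro summable_on_add l2_summable)
    show "norm (cnj (l2_apply f i) * l2_apply g i)
      \<le> (cmod (l2_apply f i))\<^sup>2 + (cmod (l2_apply g i))\<^sup>2" for i
    proof -
      have "2 * (cmod (l2_apply f i) * cmod (l2_apply g i))
          \<le> (cmod (l2_apply f i))\<^sup>2 + (cmod (l2_apply g i))\<^sup>2"
        using sum_squares_bound [of "cmod (l2_apply f i)" "cmod (l2_apply g i)"] by simp
      moreover have "0 \<le> cmod (l2_apply f i) * cmod (l2_apply g i)" by simp
      ultimately show ?thesis unfolding norm_mult complex_mod_cnj by linarith
    qed
  qed auto
  then show ?thesis by (rule abs_summable_summable)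
qed

definition l2_cinner :: "'a l2 \<Rightarrow> 'a l2 \<Rightarrow> complex" where
  "l2_cinner f g = (\<Sum>\<^sub>\<infinity>i. cnj (l2_apply f i) * l2_apply g i)"

lemma Re_l2_cinner_self: "Re (l2_cinner f f) = (\<Sum>\<^sub>\<infinity>i. (cmod (l2_apply f i))\<^sup>2)"
proof -
  have "Re (cnj z * z) = (cmod z)\<^sup>2" for z
    unfolding cmod_power2 by (simp add: power2_eq_square)
  then show ?thesis
    by (simp only: l2_cinner_def infsum_Re [OF l2_mult_summable, symmetric])
qed

lemma l2_cinner_commute: "l2_cinner f g = cnj (l2_cinner g f)"
  unfolding l2_cinner_def by (simp flip: infsum_cnj add: mult.commute)

lemma l2_cinner_add_right: "l2_cinner f (g + h) = l2_cinner f g + l2_cinner f h"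
  unfolding l2_cinner_def
  by (simp add: plus_l2.rep_eq distrib_left infsum_add l2_mult_summable)

lemma l2_cinner_scaleC_right: "l2_cinner f (c *\<^sub>C g) = c * l2_cinner f g"
proof -
  have "l2_cinner f (c *\<^sub>C g) = (\<Sum>\<^sub>\<infinity>i. c * (cnj (l2_apply f i) * l2_apply g i))"
    unfolding l2_cinner_def by (simp add: scaleC_l2.rep_eq mult.left_commute)
  also have "\<dots> = c * l2_cinner f g"
    unfolding l2_cinner_def by (rule infsum_cmult_right') 
  finally show ?thesis .
qed

instantiation l2 :: (type) real_inner
begin

definition inner_l2 :: "'a l2 \<Rightarrow> 'a l2 \<Rightarrow> real" where
  "inner_l2 f g = Re (l2_cinner f g)"
definition norm_l2 :: "'a l2 \<Rightarrow> real" where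
  "norm_l2 f = sqrt (inner f f)"
definition sgn_l2 :: "'a l2 \<Rightarrow> 'a l2" where
  "sgn_l2 f = f /\<^sub>R norm f"
definition dist_l2 :: "'a l2 \<Rightarrow> 'a l2 \<Rightarrow> real" where
  "dist_l2 f g = norm (f - g)"
definition uniformity_l2 :: "('a l2 \<times> 'a l2) filter" where
  "uniformity_l2 = (INF e\<in>{0<..}. principal {(x, y). dist x y < e})"
definition open_l2 :: "'a l2 set \<Rightarrow> bool" where
  "open_l2 U = (\<forall>x\<in>U. \<forall>\<^sub>F (x', y) in uniformity. x' = x \<longrightarrow> y \<in> U)"

instance
proof
  fix f g h :: "'a l2" and r :: real and U :: "'a l2 set"
  show "inner f g = inner g f"
    unfolding inner_l2_def by (subst l2_cinner_commute) simp
  then have comm: "inner f g = inner g f" for f g :: "'a l2"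
    unfolding inner_l2_def by (subst l2_cinner_commute) simp
  have "inner h (f + g) = inner h f + inner h g"
    by (simp add: inner_l2_def l2_cinner_add_right)
  then show "inner (f + g) h = inner f h + inner g h"
    by (simp add: comm)
  have "inner g (r *\<^sub>R f) = r * inner g f"
    by (simp add: inner_l2_def l2_cinner_scaleC_right flip: scaleC_of_real)
  then show "inner (r *\<^sub>R f) g = r * inner f g"
    by (simp add: comm)
  show "0 \<le> inner f f"
    by (simp add: inner_l2_def Re_l2_cinner_self infsum_nonneg)
  show "inner f f = 0 \<longleftrightarrow> f = 0"
  proof
    assume "inner f f = 0"
    then have "(\<Sum>\<^sub>\<infinity>i. (cmod (l2_apply f i))\<^sup>2) = 0"
      by (simp add: inner_l2_def Re_l2_cinner_self)
    then have "(cmod (l2_apply f i))\<^sup>2 = 0" for i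
      using nonneg_infsum_le_0D [of "\<lambda>i. (cmod (l2_apply f i))\<^sup>2" UNIV i] l2_summable [of f] by simp
    then show "f = 0"
      by (simp add: l2_apply_inject [symmetric] zero_l2.rep_eq fun_eq_iff)
  next
    assume "f = 0"
    then show "inner f f = 0"
      by (simp add: inner_l2_def l2_cinner_def zero_l2.rep_eq)
  qed
qed (simp_all add: norm_l2_def sgn_l2_def dist_l2_def uniformity_l2_def open_l2_def)

end

lemma norm_l2_squared: "(norm f)\<^sup>2 = (\<Sum>\<^sub>\<infinity>i. (cmod (l2_apply f i))\<^sup>2)"
  by (simp add: power2_norm_eq_inner inner_l2_def Re_l2_cinner_self)

lemma l2_finite_sum_le: "finite A \<Longrightarrow> (\<Sum>i\<in>A. (cmod (l2_apply f i))\<^sup>2) \<le> (norm f)\<^sup>2"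
  unfolding norm_l2_squared by (rule finite_sum_le_infsum) (auto simp: l2_summable)

lemma l2_apply_le_norm: "cmod (l2_apply f i) \<le> norm f"
  using l2_finite_sum_le [of "{i}" f] by (simp add: power2_le_iff_abs_le)

lemma norm_l2_le:
  assumes "\<And>A. finite A \<Longrightarrow> (\<Sum>i\<in>A. (cmod (l2_apply f i))\<^sup>2) \<le> b\<^sup>2" "0 \<le> b"
  shows "norm f \<le> b"
proof -
  have "(norm f)\<^sup>2 \<le> b\<^sup>2"
    unfolding norm_l2_squared by (rule infsum_le_finite_sums) (auto simp: l2_summable assms)
  then show ?thesis using assms(2) by (rule power2_le_imp_le)
qed

instance l2 :: (type) banach
proof
  fix X :: "nat \<Rightarrow> 'a l2"
  assume X: "Cauchy X"
  have "Cauchy (\<lambda>n. l2_apply (X n) i)" for i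
  proof (rule CauchyI)
    fix e :: real assume "0 < e"
    then obtain M where "\<And>m n. m \<ge> M \<Longrightarrow> n \<ge> M \<Longrightarrow> norm (X m - X n) < e"
      using CauchyD [OF X] by blast
    moreover have "norm (l2_apply (X m) i - l2_apply (X n) i) \<le> norm (X m - X n)" for m n
      using l2_apply_le_norm [of "X m - X n" i] by (simp add: minus_l2.rep_eq)
    ultimately show "\<exists>M. \<forall>m\<ge>M. \<forall>n\<ge>M. norm (l2_apply (X m) i - l2_apply (X n) i) < e"
      by (meson le_less_trans)
  qed
  then have "\<forall>i. \<exists>l. (\<lambda>n. l2_apply (X n) i) \<longlonglongrightarrow> l"
    by (simp add: Cauchy_convergent_iff convergent_def)
  from choice [OF this] obtain L where L: "\<And>i. (\<lambda>n. l2_apply (X n) i) \<longlonglongrightarrow> L i"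
    by blast
  have tail: "\<exists>M. \<forall>n\<ge>M. \<forall>A. finite A \<longrightarrow> (\<Sum>i\<in>A. (cmod (L i - l2_apply (X n) i))\<^sup>2) \<le> e\<^sup>2"
    if e: "0 < e" for e
  proof -
    obtain M where M: "\<And>m n. m \<ge> M \<Longrightarrow> n \<ge> M \<Longrightarrow> norm (X m - X n) < e"
      using CauchyD [OF X e] by blast
    have "(\<Sum>i\<in>A. (cmod (L i - l2_apply (X n) i))\<^sup>2) \<le> e\<^sup>2" if "n \<ge> M" "finite A" for n A
    proof (rule LIMSEQ_le_const2)
      show "(\<lambda>m. \<Sum>i\<in>A. (cmod (l2_apply (X m) i - l2_apply (X n) i))\<^sup>2)
          \<longlonglongrightarrow> (\<Sum>i\<in>A. (cmod (L i - l2_apply (X n) i))\<^sup>2)"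
        by (intro tendsto_intros L)
      have "(\<Sum>i\<in>A. (cmod (l2_apply (X m) i - l2_apply (X n) i))\<^sup>2) \<le> e\<^sup>2" if "m \<ge> M" for m
      proof -
        have "(\<Sum>i\<in>A. (cmod (l2_apply (X m) i - l2_apply (X n) i))\<^sup>2) \<le> (norm (X m - X n))\<^sup>2"
          using l2_finite_sum_le [OF \<open>finite A\<close>, of "X m - X n"] by (simp add: minus_l2.rep_eq)
        also have "\<dots> \<le> e\<^sup>2"
          using M [OF that \<open>n \<ge> M\<close>] by (intro power_mono) auto
        finally show ?thesis .
      qed
      then show "\<exists>N. \<forall>m\<ge>N. (\<Sum>i\<in>A. (cmod (l2_apply (X m) i - l2_apply (X n) i))\<^sup>2) \<le> e\<^sup>2"
        by blast
    qed
    then show ?thesis by blast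
  qed
  obtain M where M: "\<And>A. finite A \<Longrightarrow> (\<Sum>i\<in>A. (cmod (L i - l2_apply (X M) i))\<^sup>2) \<le> 1"
    using tail [of 1] by auto
  have "(\<lambda>i. (cmod (L i - l2_apply (X M) i))\<^sup>2) summable_on UNIV"
    by (rule nonneg_bdd_above_summable_on) (auto intro!: bdd_aboveI [where M = 1] M)
  then have "(\<lambda>i. (cmod (L i))\<^sup>2) summable_on UNIV"
    using l2_add_summable [OF _ l2_summable [of "X M"], of "\<lambda>i. L i - l2_apply (X M) i"] by simp
  then have Labs: "l2_apply (Abs_l2 L) = L"
    by (simp add: Abs_l2_inverse)
  have "X \<longlonglongrightarrow> Abs_l2 L"
  proof (rule LIMSEQ_I)
    fix r :: real assume "0 < r"
    then obtain M where M: "\<And>n A. n \<ge> M \<Longrightarrow> finite A \<Longrightarrow> (\<Sum>i\<in>A. (cmod (L i - l2_apply (X n) i))\<^sup>2) \<le> (r/2)\<^sup>2"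
      using tail [of "r/2"] by auto
    have "norm (Abs_l2 L - X n) \<le> r/2" if "n \<ge> M" for n
      using \<open>0 < r\<close> M [OF that] by (intro norm_l2_le) (auto simp: minus_l2.rep_eq Labs)
    then have "norm (X n - Abs_l2 L) < r" if "n \<ge> M" for n
      using that \<open>0 < r\<close> by (subst norm_minus_commute) (smt (verit) field_sum_of_halves)
    then show "\<exists>M. \<forall>n\<ge>M. norm (X n - Abs_l2 L) < r" by blast
  qed
  then show "convergent X" by (rule convergentI)
qed

instantiation l2 :: (type) complex_hilbert
begin

definition cinner_l2 :: "'a l2 \<Rightarrow> 'a l2 \<Rightarrow> complex" where
  "cinner_l2 = l2_cinner"

instance
proof
  fix c :: complex and f :: "'a l2"
  have "(norm (c *\<^sub>C f))\<^sup>2 = (cmod c * norm f)\<^sup>2"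
    by (simp add: norm_l2_squared scaleC_l2.rep_eq norm_mult power_mult_distrib infsum_cmult_right')
  then show "norm (c *\<^sub>C f) = cmod c * norm f"
    by (rule power2_eq_imp_eq) simp_all
next
  fix f g :: "'a l2"
  show "cinner f g = cnj (cinner g f)"
    unfolding cinner_l2_def by (rule l2_cinner_commute)
qed (simp_all add: cinner_l2_def inner_l2_def l2_cinner_add_right l2_cinner_scaleC_right)

end

lift_definition l2_basis :: "'i \<Rightarrow> 'i l2" is "\<lambda>j i. if i = j then 1 else 0"
proof -
  fix j :: 'i
  have "(\<lambda>i. (cmod (if i = j then 1 else 0))\<^sup>2) summable_on {j}" by simp
  then show "(\<lambda>i. (cmod (if i = j then 1 else 0))\<^sup>2) summable_on UNIV"
    by (subst summable_on_cong_neutral [where T = "{j}"]) auto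
qed


section \<open>The full Fock space and the creation operators\<close>

text \<open>The finite type \<^typ>\<open>'d\<close> indexes the standard basis of \<open>\<complex>\<^sup>d\<close>, and a list
  \<open>[i\<^sub>1, \<dots>, i\<^sub>k]\<close> stands both for the word \<open>g\<^bsub>i\<^sub>1\<^esub> \<cdots> g\<^bsub>i\<^sub>k\<^esub>\<close> and for the basis vector
  \<open>e\<^bsub>i\<^sub>1\<^esub> \<otimes> \<cdots> \<otimes> e\<^bsub>i\<^sub>k\<^esub>\<close>.  The lists of length \<open>k\<close> are an orthonormal basis of the
  \<open>k\<close>-th tensor power, so that the Hilbert direct sum of the tensor powers is the space of
  square summable families indexed by lists.\<close>

type_synonym 'd fock = "'d list l2"

lift_definition create :: "'d \<Rightarrow> 'd fock \<Rightarrow> 'd fock"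
  is "\<lambda>j f \<alpha>. case \<alpha> of [] \<Rightarrow> 0 | i # \<beta> \<Rightarrow> if i = j then f \<beta> else 0"
proof -
  fix j :: 'd and f :: "'d list \<Rightarrow> complex"
  assume "(\<lambda>\<alpha>. (cmod (f \<alpha>))\<^sup>2) summable_on UNIV"
  moreover have "(\<lambda>\<alpha>. (cmod (case \<alpha> of [] \<Rightarrow> 0 | i # \<beta> \<Rightarrow> if i = j then f \<beta> else 0))\<^sup>2)
      summable_on UNIV \<longleftrightarrow>
    (\<lambda>\<alpha>. (cmod (case \<alpha> of [] \<Rightarrow> 0 | i # \<beta> \<Rightarrow> if i = j then f \<beta> else 0))\<^sup>2)
      summable_on range ((#) j)"
    by (rule summable_on_cong_neutral) (auto split: list.splits)
  ultimately show "(\<lambda>\<alpha>. (cmod (case \<alpha> of [] \<Rightarrow> 0 | i # \<beta> \<Rightarrow> if i = j then f \<beta> else 0))\<^sup>2)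
      summable_on UNIV"
    by (simp add: summable_on_reindex o_def)
qed

lemma norm_create: "norm (create j f) = norm f"
proof -
  have "(norm (create j f))\<^sup>2 = (\<Sum>\<^sub>\<infinity>\<alpha>\<in>range ((#) j). (cmod (l2_apply (create j f) \<alpha>))\<^sup>2)"
    unfolding norm_l2_squared
    by (rule infsum_cong_neutral) (auto simp: create.rep_eq split: list.splits)
  also have "\<dots> = (norm f)\<^sup>2"
    by (simp add: norm_l2_squared infsum_reindex o_def create.rep_eq)
  finally show ?thesis by (rule power2_eq_imp_eq) simp_all
qed

lift_definition creation :: "'d \<Rightarrow> 'd fock \<Rightarrow>\<^sub>L 'd fock" is create
proof (rule bounded_linear_intro [where K = 1])
  fix j :: 'd and f g :: "'d fock" and r :: real
  show "create j (f + g) = create j f + create j g"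
    by transfer (auto split: list.splits)
  show "create j (r *\<^sub>R f) = r *\<^sub>R create j f"
    by transfer (auto split: list.splits)
  show "norm (create j f) \<le> norm f * 1"
    by (simp add: norm_create)
qed

lemma creation_basis: "creation j (l2_basis \<alpha>) = l2_basis (j # \<alpha>)"
  unfolding creation.rep_eq by transfer (auto simp: fun_eq_iff split: list.splits)

lemma op_word_creation_basis: "op_word creation \<alpha> (l2_basis \<beta>) = l2_basis (\<alpha> @ \<beta>)"
  by (induction \<alpha>) (simp_all add: op_word_def creation_basis)


section \<open>The algebra of noncommutative polynomials and its graded ideals\<close>

definition unital_subalgebra :: "('h::complex_normed_vector \<Rightarrow>\<^sub>L 'h) set \<Rightarrow> bool" where
  "unital_subalgebra A \<longleftrightarrow>
    csubspace A \<and> id_blinfun \<in> A \<and> (\<forall>a\<in>A. \<forall>b\<in>A. a o\<^sub>L b \<in> A)"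

definition poly_alg :: "('d fock \<Rightarrow>\<^sub>L 'd fock) set" where
  "poly_alg = unital_subalgebra hull (range creation)"

definition poly_deg :: "nat \<Rightarrow> ('d fock \<Rightarrow>\<^sub>L 'd fock) set" where
  "poly_deg k = cspan {op_word creation \<alpha> |\<alpha>. length \<alpha> = k}"

definition two_sided_ideal :: "('d fock \<Rightarrow>\<^sub>L 'd fock) set \<Rightarrow> bool" where
  "two_sided_ideal I \<longleftrightarrow> I \<subseteq> poly_alg \<and> csubspace I \<and>
    (\<forall>a\<in>poly_alg. \<forall>b\<in>I. a o\<^sub>L b \<in> I \<and> b o\<^sub>L a \<in> I)"

definition graded_ideal :: "('d fock \<Rightarrow>\<^sub>L 'd fock) set \<Rightarrow> bool" where
  "graded_ideal I \<longleftrightarrow> two_sided_ideal I \<and>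
    (\<exists>J. (\<forall>k\<ge>1. csubspace (J k) \<and> J k \<subseteq> poly_deg k) \<and>
         I = {\<Sum>k=1..n. a k |n a. \<forall>k\<in>{1..n}. a k \<in> J k})"


section \<open>Free power series\<close>

type_synonym 'd free_series = "'d list \<Rightarrow> complex"

definition series_add :: "'d free_series \<Rightarrow> 'd free_series \<Rightarrow> 'd free_series" where
  "series_add F G = (\<lambda>\<alpha>. F \<alpha> + G \<alpha>)"

definition series_diff :: "'d free_series \<Rightarrow> 'd free_series \<Rightarrow> 'd free_series" where
  "series_diff F G = (\<lambda>\<alpha>. F \<alpha> - G \<alpha>)"

definition series_smult :: "complex \<Rightarrow> 'd free_series \<Rightarrow> 'd free_series" where
  "series_smult c F = (\<lambda>\<alpha>. c * F \<alpha>)"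

definition series_mult :: "'d free_series \<Rightarrow> 'd free_series \<Rightarrow> 'd free_series" where
  "series_mult F G = (\<lambda>\<alpha>. \<Sum>(\<beta>, \<gamma>) | \<beta> @ \<gamma> = \<alpha>. F \<beta> * G \<gamma>)"

text \<open>The coefficients of an element of \<^const>\<open>poly_alg\<close> with respect to its basis of
  words in the creation operators; as a formal series, this is the image of the element under
  \<open>s\<^sub>i \<mapsto> z\<^sub>i\<close>.\<close>

definition to_series :: "('d fock \<Rightarrow>\<^sub>L 'd fock) \<Rightarrow> 'd free_series" where
  "to_series A = (\<lambda>\<alpha>. crepresentation (range (op_word creation)) A (op_word creation \<alpha>))"

definition Ev :: "('d fock \<Rightarrow>\<^sub>L 'd fock) \<Rightarrow> 'd fock" where
  "Ev A = (\<Sum>\<alpha> | to_series A \<alpha> \<noteq> 0. to_series A \<alpha> *\<^sub>C l2_basis \<alpha>)"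

lemma inj_op_word_creation: "inj (op_word creation)"
proof (rule injI)
  fix \<alpha> \<beta> :: "'a list"
  assume "op_word creation \<alpha> = op_word creation \<beta>"
  then have "l2_basis \<alpha> = l2_basis \<beta>"
    by (metis op_word_creation_basis append_Nil2)
  then have "l2_apply (l2_basis \<alpha>) \<alpha> = l2_apply (l2_basis \<beta>) \<alpha>" by simp
  then show "\<alpha> = \<beta>" by (simp add: l2_basis.rep_eq split: if_splits)
qed

lemma l2_apply_sum: "l2_apply (sum f A) i = (\<Sum>a\<in>A. l2_apply (f a) i)"
  by (induction A rule: infinite_finite_induct) (simp_all add: zero_l2.rep_eq plus_l2.rep_eq)

lemma independent_op_word_creation: "\<not> complex_vector.dependent (range (op_word creation))"
proof
  assume "complex_vector.dependent (range (op_word creation :: 'a list \<Rightarrow> _))"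
  then obtain S u where S: "finite S" "S \<subseteq> range (op_word (creation :: 'a \<Rightarrow> _))"
      and sum0: "(\<Sum>A\<in>S. u A *\<^sub>C A) = 0" and ne: "\<exists>A\<in>S. u A \<noteq> 0"
    unfolding complex_vector.dependent_explicit by blast
  define W where "W = op_word (creation :: 'a \<Rightarrow> _) -` S"
  have SW: "S = op_word creation ` W" and W: "finite W"
    using S by (auto simp: W_def intro: finite_vimageI inj_op_word_creation)
  have "u (op_word creation \<beta>) = 0" if "\<beta> \<in> W" for \<beta>
  proof -
    have "(\<Sum>\<alpha>\<in>W. u (op_word creation \<alpha>) *\<^sub>C op_word creation \<alpha>) = 0"
      using sum0 inj_on_subset [OF inj_op_word_creation]
      unfolding SW by (subst (asm) sum.reindex) auto
    then have "(\<Sum>\<alpha>\<in>W. u (op_word creation \<alpha>) *\<^sub>C l2_basis \<alpha>) = 0"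
      by (drule_tac arg_cong [where f = "\<lambda>A. blinfun_apply A (l2_basis [])"])
        (simp add: blinfun.sum_left scaleC_blinfun.rep_eq op_word_creation_basis)
    then have "(\<Sum>\<alpha>\<in>W. u (op_word creation \<alpha>) * (if \<beta> = \<alpha> then 1 else 0)) = 0"
      by (drule_tac arg_cong [where f = "\<lambda>f. l2_apply f \<beta>"])
        (simp add: l2_apply_sum scaleC_l2.rep_eq l2_basis.rep_eq zero_l2.rep_eq)
    then show ?thesis
      using W that by (simp add: if_distrib cong: if_cong)
  qed
  with ne SW show False by auto
qed

lemma to_series_word: "to_series (op_word creation \<alpha>) = (\<lambda>\<beta>. if \<beta> = \<alpha> then 1 else 0)"
  by (auto simp: to_series_def fun_eq_iff inj_eq [OF inj_op_word_creation]
      complex_vector.representation_basis [OF independent_op_word_creation])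

lemma Ev_word: "Ev (op_word creation \<alpha>) = l2_basis \<alpha>"
proof -
  have "{\<beta>. to_series (op_word creation \<alpha>) \<beta> \<noteq> 0} = {\<alpha>}"
    by (auto simp: to_series_word)
  then show ?thesis
    by (simp add: Ev_def to_series_word complex_vector.scale_one)
qed

definition ideal_proj :: "('d fock \<Rightarrow>\<^sub>L 'd fock) set \<Rightarrow> ('d fock \<Rightarrow>\<^sub>L 'd fock)" where
  "ideal_proj I = orthogonal_proj (orthogonal_compl (Ev ` I))"

definition proj_space :: "('d fock \<Rightarrow>\<^sub>L 'd fock) set" where
  "proj_space = {ideal_proj I |I. graded_ideal I}"

definition proj_topology :: "('d fock \<Rightarrow>\<^sub>L 'd fock) topology" where
  "proj_topology = subtopology strong_operator_topology proj_space"


section \<open>The algebra of free holomorphic functions on the unit row ball\<close>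

definition hom_part ::
    "nat \<Rightarrow> 'd::finite free_series \<Rightarrow> ('d \<Rightarrow> 'h::complex_normed_vector \<Rightarrow>\<^sub>L 'h) \<Rightarrow> ('h \<Rightarrow>\<^sub>L 'h)" where
  "hom_part k F T = (\<Sum>\<alpha> | length \<alpha> = k. F \<alpha> *\<^sub>C op_word T \<alpha>)"

definition row_ball :: "real \<Rightarrow> ('d::finite \<Rightarrow> 'h::complex_hilbert \<Rightarrow>\<^sub>L 'h) set" where
  "row_ball x = {T. (\<forall>i. complex_linear (T i)) \<and>
    norm (\<Sum>i\<in>UNIV. T i o\<^sub>L hilbert_adjoint (T i)) < x\<^sup>2}"

definition free_hol :: "'h::complex_hilbert itself \<Rightarrow> 'd::finite free_series set" where
  "free_hol H = {F. \<forall>T \<in> (row_ball 1 :: ('d \<Rightarrow> 'h \<Rightarrow>\<^sub>L 'h) set). summable (\<lambda>k. norm (hom_part k F T))}"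

definition free_norm :: "'h::complex_hilbert itself \<Rightarrow> real \<Rightarrow> 'd::finite free_series \<Rightarrow> real" where
  "free_norm H x F = (SUP T \<in> (row_ball x :: ('d \<Rightarrow> 'h \<Rightarrow>\<^sub>L 'h) set). norm (\<Sum>k. hom_part k F T))"

definition free_hol_topology :: "'h::complex_hilbert itself \<Rightarrow> 'd::finite free_series topology" where
  "free_hol_topology H = topology_generated_by
    {{G \<in> free_hol H. free_norm H x (series_diff G F) < \<epsilon>} |F x \<epsilon>.
      F \<in> free_hol H \<and> 0 < x \<and> x < 1 \<and> 0 < \<epsilon>}"

definition ideal_closure ::
    "'h::complex_hilbert itself \<Rightarrow> ('d::finite fock \<Rightarrow>\<^sub>L 'd fock) set \<Rightarrow> 'd free_series set" where
  "ideal_closure H I = free_hol_topology H closure_of (to_series ` I)"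


subsection \<open>Quotients\<close>

definition series_coset :: "'d free_series set \<Rightarrow> 'd free_series \<Rightarrow> 'd free_series set" where
  "series_coset J F = series_add F ` J"

definition quot_add :: "'d free_series set \<Rightarrow> 'd free_series set \<Rightarrow> 'd free_series set \<Rightarrow> 'd free_series set" where
  "quot_add J A B = (\<Union>F\<in>A. \<Union>G\<in>B. series_coset J (series_add F G))"

definition quot_smult :: "'d free_series set \<Rightarrow> complex \<Rightarrow> 'd free_series set \<Rightarrow> 'd free_series set" where
  "quot_smult J c A = (\<Union>F\<in>A. series_coset J (series_smult c F))"

definition quot_mult :: "'d free_series set \<Rightarrow> 'd free_series set \<Rightarrow> 'd free_series set \<Rightarrow> 'd free_series set" where
  "quot_mult J A B = (\<Union>F\<in>A. \<Union>G\<in>B. series_coset J (series_mult F G))"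

definition quotient_topology :: "'a topology \<Rightarrow> ('a \<Rightarrow> 'b) \<Rightarrow> 'b topology" where
  "quotient_topology T q =
    topology (\<lambda>U. U \<subseteq> q ` topspace T \<and> openin T {x \<in> topspace T. q x \<in> U})"

lemma openin_quotient_topology:
  "openin (quotient_topology T q) U \<longleftrightarrow>
    U \<subseteq> q ` topspace T \<and> openin T {x \<in> topspace T. q x \<in> U}"
proof -
  have "istopology (\<lambda>U. U \<subseteq> q ` topspace T \<and> openin T {x \<in> topspace T. q x \<in> U})"
    unfolding istopology_def
  proof (intro conjI allI impI)
    fix S V
    assume S: "S \<subseteq> q ` topspace T \<and> openin T {x \<in> topspace T. q x \<in> S}"
      and V: "V \<subseteq> q ` topspace T \<and> openin T {x \<in> topspace T. q x \<in> V}"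
    show "S \<inter> V \<subseteq> q ` topspace T" using S by blast
    have "{x \<in> topspace T. q x \<in> S \<inter> V} = {x \<in> topspace T. q x \<in> S} \<inter> {x \<in> topspace T. q x \<in> V}"
      by blast
    then show "openin T {x \<in> topspace T. q x \<in> S \<inter> V}" using S V by auto
  next
    fix K
    assume K: "\<forall>S\<in>K. S \<subseteq> q ` topspace T \<and> openin T {x \<in> topspace T. q x \<in> S}"
    then show "\<Union>K \<subseteq> q ` topspace T" by blast
    have "{x \<in> topspace T. q x \<in> \<Union>K} = (\<Union>S\<in>K. {x \<in> topspace T. q x \<in> S})" by blast
    then show "openin T {x \<in> topspace T. q x \<in> \<Union>K}" using K by auto
  qed
  then show ?thesis by (simp add: quotient_topology_def topology_inverse')
qed

definition free_quot_topology ::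
    "'h::complex_hilbert itself \<Rightarrow> 'd::finite free_series set \<Rightarrow> 'd free_series set topology" where
  "free_quot_topology H J = quotient_topology (free_hol_topology H) (series_coset J)"

definition quot_seminorm ::
    "'h::complex_hilbert itself \<Rightarrow> 'd::finite free_series set \<Rightarrow> real \<Rightarrow> 'd free_series set \<Rightarrow> real" where
  "quot_seminorm H J r A = (INF F \<in> {F \<in> free_hol H. series_coset J F = A}. free_norm H r F)"


section \<open>Bundles of locally convex algebras\<close>

text \<open>Complex associative algebras, not required to be unital or commutative, on a carrier set.\<close>

locale complex_algebra_on =
  fixes A :: "'e set" and add :: "'e \<Rightarrow> 'e \<Rightarrow> 'e" and zero :: 'e
    and scal :: "complex \<Rightarrow> 'e \<Rightarrow> 'e" and mul :: "'e \<Rightarrow> 'e \<Rightarrow> 'e"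
  assumes zero_closed: "zero \<in> A"
    and add_closed: "\<lbrakk>a \<in> A; b \<in> A\<rbrakk> \<Longrightarrow> add a b \<in> A"
    and smult_closed: "a \<in> A \<Longrightarrow> scal k a \<in> A"
    and mult_closed: "\<lbrakk>a \<in> A; b \<in> A\<rbrakk> \<Longrightarrow> mul a b \<in> A"
    and add_assoc: "\<lbrakk>a \<in> A; b \<in> A; c \<in> A\<rbrakk> \<Longrightarrow> add (add a b) c = add a (add b c)"
    and add_commute: "\<lbrakk>a \<in> A; b \<in> A\<rbrakk> \<Longrightarrow> add a b = add b a"
    and add_zero: "a \<in> A \<Longrightarrow> add zero a = a"
    and add_inverse: "a \<in> A \<Longrightarrow> \<exists>b\<in>A. add a b = zero"
    and smult_one: "a \<in> A \<Longrightarrow> scal 1 a = a"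
    and smult_smult: "a \<in> A \<Longrightarrow> scal k (scal l a) = scal (k * l) a"
    and smult_add_right: "\<lbrakk>a \<in> A; b \<in> A\<rbrakk> \<Longrightarrow> scal k (add a b) = add (scal k a) (scal k b)"
    and smult_add_left: "a \<in> A \<Longrightarrow> scal (k + l) a = add (scal k a) (scal l a)"
    and mult_assoc: "\<lbrakk>a \<in> A; b \<in> A; c \<in> A\<rbrakk> \<Longrightarrow> mul (mul a b) c = mul a (mul b c)"
    and mult_add_left: "\<lbrakk>a \<in> A; b \<in> A; c \<in> A\<rbrakk> \<Longrightarrow> mul (add a b) c = add (mul a c) (mul b c)"
    and mult_add_right: "\<lbrakk>a \<in> A; b \<in> A; c \<in> A\<rbrakk> \<Longrightarrow> mul a (add b c) = add (mul a b) (mul a c)"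
    and mult_smult_left: "\<lbrakk>a \<in> A; b \<in> A\<rbrakk> \<Longrightarrow> mul (scal k a) b = scal k (mul a b)"
    and mult_smult_right: "\<lbrakk>a \<in> A; b \<in> A\<rbrakk> \<Longrightarrow> mul a (scal k b) = scal k (mul a b)"

definition seminorm_on ::
    "'e set \<Rightarrow> ('e \<Rightarrow> 'e \<Rightarrow> 'e) \<Rightarrow> (complex \<Rightarrow> 'e \<Rightarrow> 'e) \<Rightarrow> ('e \<Rightarrow> real) \<Rightarrow> bool" where
  "seminorm_on A add scal \<sigma> \<longleftrightarrow>
    (\<forall>a\<in>A. 0 \<le> \<sigma> a) \<and>
    (\<forall>a\<in>A. \<forall>b\<in>A. \<sigma> (add a b) \<le> \<sigma> a + \<sigma> b) \<and>
    (\<forall>a\<in>A. \<forall>c. \<sigma> (scal c a) = cmod c * \<sigma> a)"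

definition fiber :: "'e topology \<Rightarrow> ('e \<Rightarrow> 'x) \<Rightarrow> 'x \<Rightarrow> 'e set" where
  "fiber E \<pi> x = {e \<in> topspace E. \<pi> e = x}"

definition fiber_product :: "'e topology \<Rightarrow> ('e \<Rightarrow> 'x) \<Rightarrow> ('e \<times> 'e) topology" where
  "fiber_product E \<pi> = subtopology (prod_topology E E) {(a, b). \<pi> a = \<pi> b}"

text \<open>The operations of all fibers are collected in single functions on the total space;
  \<open>zero x\<close> is the zero vector of the fiber over \<open>x\<close>.\<close>

locale lc_algebra_bundle =
  fixes E :: "'e topology" and X :: "'x topology" and \<pi> :: "'e \<Rightarrow> 'x"
    and add :: "'e \<Rightarrow> 'e \<Rightarrow> 'e" and zero :: "'x \<Rightarrow> 'e"
    and scal :: "complex \<Rightarrow> 'e \<Rightarrow> 'e" and mul :: "'e \<Rightarrow> 'e \<Rightarrow> 'e"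
    and N :: "('e \<Rightarrow> real) set"
  assumes proj_continuous: "continuous_map E X \<pi>"
    and proj_open: "open_map E X \<pi>"
    and proj_surj: "\<pi> ` topspace E = topspace X"
    and fiber_algebra: "x \<in> topspace X \<Longrightarrow> complex_algebra_on (fiber E \<pi> x) add (zero x) scal mul"
    and fiber_seminorm: "\<lbrakk>\<sigma> \<in> N; x \<in> topspace X\<rbrakk> \<Longrightarrow> seminorm_on (fiber E \<pi> x) add scal \<sigma>"
    and directed: "\<lbrakk>\<sigma>\<^sub>1 \<in> N; \<sigma>\<^sub>2 \<in> N\<rbrakk> \<Longrightarrow>
      \<exists>\<sigma>\<in>N. \<exists>C>0. \<forall>e\<in>topspace E. \<sigma>\<^sub>1 e \<le> C * \<sigma> e \<and> \<sigma>\<^sub>2 e \<le> C * \<sigma> e"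
    and A1: "continuous_map (fiber_product E \<pi>) E (\<lambda>(a, b). add a b)"
    and A2: "continuous_map (prod_topology E euclidean) E (\<lambda>(e, c). scal c e)"
    and A3: "continuous_map (fiber_product E \<pi>) E (\<lambda>(a, b). mul a b)"
    and A4_nhd: "\<lbrakk>x \<in> topspace X; openin X U; x \<in> U; \<sigma> \<in> N; 0 < \<epsilon>\<rbrakk> \<Longrightarrow>
      openin E {e \<in> topspace E. \<pi> e \<in> U \<and> \<sigma> e < \<epsilon>} \<and>
      zero x \<in> {e \<in> topspace E. \<pi> e \<in> U \<and> \<sigma> e < \<epsilon>}"
    and A4_base: "\<lbrakk>x \<in> topspace X; openin E W; zero x \<in> W\<rbrakk> \<Longrightarrow>
      \<exists>U \<sigma> \<epsilon>. openin X U \<and> x \<in> U \<and> \<sigma> \<in> N \<and> 0 < \<epsilon> \<and>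
        {e \<in> topspace E. \<pi> e \<in> U \<and> \<sigma> e < \<epsilon>} \<subseteq> W"
    and A5: "\<sigma> \<in> N \<Longrightarrow> continuous_map E euclideanreal \<sigma>"

text \<open>Isomorphisms of topological algebras; the underlying sets are the topological spaces.\<close>

definition lc_algebra_iso ::
    "'a topology \<Rightarrow> ('a \<Rightarrow> 'a \<Rightarrow> 'a) \<Rightarrow> (complex \<Rightarrow> 'a \<Rightarrow> 'a) \<Rightarrow> ('a \<Rightarrow> 'a \<Rightarrow> 'a) \<Rightarrow>
     'b topology \<Rightarrow> ('b \<Rightarrow> 'b \<Rightarrow> 'b) \<Rightarrow> (complex \<Rightarrow> 'b \<Rightarrow> 'b) \<Rightarrow> ('b \<Rightarrow> 'b \<Rightarrow> 'b) \<Rightarrow>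
     ('a \<Rightarrow> 'b) \<Rightarrow> bool" where
  "lc_algebra_iso S addS smultS multS T addT smultT multT \<theta> \<longleftrightarrow>
    homeomorphic_map S T \<theta> \<and>
    (\<forall>a\<in>topspace S. \<forall>b\<in>topspace S. \<theta> (addS a b) = addT (\<theta> a) (\<theta> b)) \<and>
    (\<forall>c. \<forall>a\<in>topspace S. \<theta> (smultS c a) = smultT c (\<theta> a)) \<and>
    (\<forall>a\<in>topspace S. \<forall>b\<in>topspace S. \<theta> (multS a b) = multT (\<theta> a) (\<theta> b))"

end

theory Submission
  imports Defs
begin

text \<open>A point \<open>x\<close> of \<open>X\<close> enters through the subspace \<open>L\<^sub>x = Ev(I\<^sub>x)\<close> of the Fock space, and the
  projection \<open>P\<^sub>x = p\<^bsub>I\<^sub>x\<^esub>\<close> onto its complement can be read off from the quotient seminorm.  If \<open>F\<close> is a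
  homogeneous polynomial of degree \<open>k\<close>, with coefficient vector \<open>f\<close>, then
  \<open>\<parallel>F + closure I\<^sub>x\<parallel>\<^sub>r = r\<^sup>k \<parallel>P\<^sub>x f\<parallel>\<close> (\<open>quot_seminorm_homogeneous\<close>).  Two estimates give this
  formula.  The von Neumann inequality bounds \<open>\<parallel>G\<parallel>\<^sub>r\<close> from above by \<open>r\<^sup>k \<parallel>g\<parallel>\<close> when \<open>G\<close> is homogeneous of
  degree \<open>k\<close> with coefficient vector \<open>g\<close> (\<open>norm_hom_part_le\<close>).  Evaluating an arbitrary \<open>G\<close> at a scaled
  copy of the creation operators inside \<open>H\<close>, and applying the result to the vacuum vector, bounds
  \<open>\<parallel>G\<parallel>\<^sub>r\<close> from below by \<open>r\<^sup>k\<close> times the norm of the degree \<open>k\<close> coefficients of \<open>G\<close>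
  (\<open>hcomp_le_free_norm\<close>).  So both the infimum over the coset and \<open>\<parallel>P\<^sub>x f\<parallel>\<close> compute the distance from
  \<open>f\<close> to the degree \<open>k\<close> part of \<open>L\<^sub>x\<close>.

  The classes of the variables form continuous sections, hence so do the classes of all homogeneous
  polynomials of degree \<open>k \<ge> 1\<close>, because the fiberwise operations are continuous; this uses that the
  closure of the ideal is again an ideal, so that the product of the classes of two words is the
  class of their concatenation (\<open>quot_mult_coset\<close>).  Composition with the continuous seminorm shows that
  \<open>x \<mapsto> \<parallel>P\<^sub>x f\<parallel>\<close> is continuous (\<open>continuous_norm_ideal_proj\<close>).

  For projections this is enough: polarization recovers the real inner product \<open>\<langle>P\<^sub>x f, w\<rangle>\<close>
  from norms, and then
  \<open>\<parallel>P\<^sub>x f - P\<^sub>y f\<parallel>\<^sup>2 = \<parallel>P\<^sub>x f\<parallel>\<^sup>2 - 2 \<langle>P\<^sub>x f, w\<rangle> + \<parallel>w\<parallel>\<^sup>2\<close> with \<open>w = P\<^sub>y f\<close> tends to \<open>0\<close> as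
  \<open>x\<close> tends to \<open>y\<close> (\<open>continuous_map_projections\<close>).  In degree \<open>0\<close> every \<open>P\<^sub>x\<close> is the identity, because
  a graded ideal contains no constants.  The vectors of finite degree are dense and the \<open>P\<^sub>x\<close> are
  contractions, so \<open>x \<mapsto> P\<^sub>x f\<close> is continuous for every \<open>f\<close>, which is continuity for the strong operator
  topology.

  Closures and products are handled with the weighted norm \<open>\<Sum>\<^sub>k \<rho>\<^sup>k \<parallel>F\<^sub>k\<parallel>\<close> of the coefficients
  (\<open>wnorm\<close>), which is submultiplicative and defines the same topology as the operator norms.\<close>

section \<open>Projections and adjoints in Hilbert spaces\<close>

text \<open>A minimizing sequence for the distance to \<open>M\<close> is Cauchy by the parallelogram law.\<close>

lemma closed_subspace_foot:
  fixes M :: "'a::{real_inner, banach} set"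
  assumes M: "subspace M" "closed M"
  obtains p where "p \<in> M" "\<And>m. m \<in> M \<Longrightarrow> inner m (v - p) = 0"
proof -
  define D where "D = (INF m\<in>M. (norm (v - m))\<^sup>2)"
  have bdd: "bdd_below ((\<lambda>m. (norm (v - m))\<^sup>2) ` M)"
    by (rule bdd_belowI [where m = 0]) auto
  have ne: "(\<lambda>m. (norm (v - m))\<^sup>2) ` M \<noteq> {}"
    using subspace_0 [OF M(1)] by auto
  have D_le: "D \<le> (norm (v - m))\<^sup>2" if "m \<in> M" for m
    unfolding D_def using that bdd by (rule cINF_lower [rotated])
  have "\<exists>m\<in>M. (norm (v - m))\<^sup>2 < D + 1 / Suc n" for n
  proof -
    have "Inf ((\<lambda>m. (norm (v - m))\<^sup>2) ` M) < D + 1 / Suc n"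
      by (simp add: D_def)
    from cInf_lessD [OF ne this] show ?thesis by auto
  qed
  then obtain m where m: "\<And>n. m n \<in> M" "\<And>n. (norm (v - m n))\<^sup>2 < D + 1 / Suc n"
    by metis
  have close: "(norm (m i - m j))\<^sup>2 \<le> 2 / Suc i + 2 / Suc j" for i j
  proof -
    have "(1/2) *\<^sub>R (m i + m j) \<in> M"
      by (intro subspace_scale subspace_add M(1) m(1))
    from D_le [OF this]
    have "4 * D \<le> 4 * (norm (v - (1/2) *\<^sub>R (m i + m j)))\<^sup>2" by simp
    moreover have "(norm (m i - m j))\<^sup>2 + 4 * (norm (v - (1/2) *\<^sub>R (m i + m j)))\<^sup>2
        = 2 * (norm (v - m i))\<^sup>2 + 2 * (norm (v - m j))\<^sup>2"
      unfolding power2_norm_eq_inner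
      by (simp add: inner_diff inner_add algebra_simps inner_commute)
    ultimately show ?thesis using m(2) [of i] m(2) [of j] by simp
  qed
  have "Cauchy m"
  proof (rule CauchyI)
    fix e :: real assume e: "0 < e"
    obtain n where n: "4 / e\<^sup>2 < Suc n"
      using reals_Archimedean2 [of "4 / e\<^sup>2"] by (metis less_trans lessI of_nat_less_iff)
    then have n': "4 / Suc n < e\<^sup>2" using e by (simp add: field_simps)
    have "norm (m i - m j) < e" if "i \<ge> n" "j \<ge> n" for i j
    proof -
      have "(2::real) / Suc i \<le> 2 / Suc n" "(2::real) / Suc j \<le> 2 / Suc n"
        using that by (auto intro!: divide_left_mono)
      with close [of i j] n' have "(norm (m i - m j))\<^sup>2 < e\<^sup>2" by simp
      then show ?thesis using e by (meson less_imp_le power_less_imp_less_base)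
    qed
    then show "\<exists>N. \<forall>i\<ge>N. \<forall>j\<ge>N. norm (m i - m j) < e" by blast
  qed
  then obtain p where p: "m \<longlonglongrightarrow> p" by (auto simp: Cauchy_convergent_iff convergent_def)
  have "p \<in> M" using M(2) m(1) p closed_sequentially by blast
  have "(norm (v - p))\<^sup>2 \<le> D"
  proof (rule LIMSEQ_le)
    show "(\<lambda>n. (norm (v - m n))\<^sup>2) \<longlonglongrightarrow> (norm (v - p))\<^sup>2"
      by (intro tendsto_intros p)
    have "(\<lambda>n. D + 1 / Suc n) \<longlonglongrightarrow> D + 0"
      using LIMSEQ_inverse_real_of_nat by (intro tendsto_intros) (simp add: field_simps)
    then show "(\<lambda>n. D + 1 / Suc n) \<longlonglongrightarrow> D" by simp
    show "\<exists>N. \<forall>n\<ge>N. (norm (v - m n))\<^sup>2 \<le> D + 1 / Suc n"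
      using m(2) less_imp_le by blast
  qed
  then have min: "(norm (v - p))\<^sup>2 \<le> (norm (v - q))\<^sup>2" if "q \<in> M" for q
    using D_le [OF that] by linarith
  have "inner q (v - p) = 0" if q: "q \<in> M" for q
  proof (rule ccontr)
    define c where "c = inner q (v - p)"
    assume "inner q (v - p) \<noteq> 0"
    then have c: "c \<noteq> 0" and qq: "inner q q > 0" by (auto simp: c_def)
    \<comment> \<open>the step that minimizes the quadratic function \<open>t \<mapsto> \<parallel>v - p - t q\<parallel>\<^sup>2\<close>\<close>
    define t where "t = c / inner q q"
    have "p + t *\<^sub>R q \<in> M" using \<open>p \<in> M\<close> q by (intro subspace_add subspace_scale M(1))
    from min [OF this] have "0 \<le> t\<^sup>2 * inner q q - 2 * t * c"
      unfolding power2_norm_eq_inner c_def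
      by (simp add: inner_diff inner_add algebra_simps inner_commute power2_eq_square)
    also have "\<dots> = - (c\<^sup>2 / inner q q)"
      using qq by (simp add: t_def field_simps power2_eq_square)
    also have "\<dots> < 0" using c qq by simp
    finally show False by simp
  qed
  with \<open>p \<in> M\<close> show thesis by (rule that)
qed

text \<open>The orthogonal complement of the kernel is spanned by the representing vector.\<close>

lemma Riesz_representation:
  fixes f :: "'a::{real_inner, banach} \<Rightarrow> real"
  assumes f: "bounded_linear f"
  obtains z where "\<And>x. f x = inner x z"
proof (cases "\<forall>x. f x = 0")
  case True
  then show thesis by (intro that [of 0]) simp
next
  case False
  then obtain v where v: "f v \<noteq> 0" by blast
  interpret f: bounded_linear f by (rule f)
  define M where "M = {x. f x = 0}"
  have "subspace M" by (auto simp: M_def subspace_def f.add f.scaleR f.zero)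
  moreover have "closed M" unfolding M_def
    by (intro closed_Collect_eq continuous_intros f.continuous_on)
  ultimately obtain p where p: "p \<in> M" "\<And>m. m \<in> M \<Longrightarrow> inner m (v - p) = 0"
    by (rule closed_subspace_foot [of M v]) blast
  define w where "w = v - p"
  have fw: "f w \<noteq> 0" using v p(1) by (simp add: w_def M_def f.diff)
  then have "inner w w \<noteq> 0" by (auto simp: f.zero)
  have "f x = inner x ((f w / inner w w) *\<^sub>R w)" for x
  proof -
    have "x - (f x / f w) *\<^sub>R w \<in> M" using fw by (simp add: M_def f.diff f.scaleR)
    from p(2) [OF this] have "inner x w = (f x / f w) * inner w w"
      by (simp add: w_def [symmetric] inner_diff_left)
    then show ?thesis using fw \<open>inner w w \<noteq> 0\<close> by simp
  qed
  then show thesis by (rule that)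
qed

text \<open>Only the real inner product enters here; the adjoint of a complex linear operator for the complex
  inner product is the same map.\<close>

lemma real_adjoint_exists:
  fixes A :: "'a::{real_inner, banach} \<Rightarrow>\<^sub>L 'b::real_inner"
  obtains B :: "'b \<Rightarrow>\<^sub>L 'a" where "\<And>x y. inner (A x) y = inner x (B y)"
proof -
  have "\<exists>z. \<forall>x. inner (A x) y = inner x z" for y
  proof -
    have "bounded_linear (\<lambda>x. inner (A x) y)"
      by (intro bounded_linear_intros)
    then obtain z where "\<And>x. inner (A x) y = inner x z" by (rule Riesz_representation) blast
    then show ?thesis by blast
  qed
  then obtain B where B: "\<And>x y. inner (A x) y = inner x (B y)" by metis
  have eqI: "a = b" if "\<And>x. inner x a = inner x b" for a b :: 'a
    using that vector_eq_ldot by blast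
  have "bounded_linear B"
  proof (rule bounded_linear_intro [where K = "norm A"])
    show "B (y + z) = B y + B z" for y z
      by (rule eqI) (simp add: inner_add_right B [symmetric])
    show "B (c *\<^sub>R y) = c *\<^sub>R B y" for c y
      by (rule eqI) (simp add: B [symmetric])
    show "norm (B y) \<le> norm y * norm A" for y
    proof (cases "B y = 0")
      case False
      have "norm (B y) * norm (B y) = inner (A (B y)) y"
        by (simp add: B power2_norm_eq_inner [symmetric] power2_eq_square)
      also have "\<dots> \<le> norm (A (B y)) * norm y" by (rule norm_cauchy_schwarz)
      also have "\<dots> \<le> (norm A * norm (B y)) * norm y"
        by (intro mult_right_mono norm_blinfun) simp
      finally have "norm (B y) * norm (B y) \<le> norm (B y) * (norm y * norm A)"
        by (simp add: ac_simps)
      then show ?thesis using False by simp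
    qed simp
  qed
  then have "blinfun_apply (Blinfun B) = B" by (simp add: bounded_linear_Blinfun_apply)
  with B show thesis by (intro that [of "Blinfun B"]) simp
qed

text \<open>The imaginary part of \<open>cinner a b\<close> is the real inner product of \<open>\<i> a\<close> and \<open>b\<close>.\<close>

lemma cinner_eqI:
  fixes a b c d :: "'h::complex_hilbert"
  assumes "inner a b = inner c d" "inner (\<i> *\<^sub>C a) b = inner (\<i> *\<^sub>C c) d"
  shows "cinner a b = cinner c d"
proof -
  have "cinner (\<i> *\<^sub>C x) y = - \<i> * cinner x y" for x y :: 'h
    by (subst (1 2) cinner_commute) (simp add: cinner_scaleC_right)
  then show ?thesis using assms by (simp add: inner_eq_Re_cinner complex_eq_iff)
qed

lemma cinner_scaleC_left: "cinner (c *\<^sub>C x) y = cnj c * cinner x (y::'h::complex_hilbert)"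
  by (subst (1 2) cinner_commute) (simp add: cinner_scaleC_right)

lemma inner_scaleC_left: "inner (c *\<^sub>C x) y = inner x (cnj c *\<^sub>C (y::'h::complex_hilbert))"
  by (simp add: inner_eq_Re_cinner cinner_scaleC_left cinner_scaleC_right)

lemma hilbert_adjoint_inner:
  fixes T :: "'h::complex_hilbert \<Rightarrow>\<^sub>L 'h"
  assumes T: "complex_linear T"
  shows "inner (T x) y = inner x (hilbert_adjoint T y)"
proof -
  obtain S :: "'h \<Rightarrow>\<^sub>L 'h" where S: "\<And>x y. inner (T x) y = inner x (S y)"
    by (rule real_adjoint_exists [of T]) blast
  have "cinner (T x) y = cinner x (S y)" for x y
  proof (rule cinner_eqI)
    have "\<i> *\<^sub>C T x = T (\<i> *\<^sub>C x)" using T by (simp add: complex_linear_def)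
    then show "inner (\<i> *\<^sub>C T x) y = inner (\<i> *\<^sub>C x) (S y)" by (simp only: S)
  qed (rule S)
  moreover have "R = S" if R: "\<forall>x y. cinner (T x) y = cinner x (R y)" for R :: "'h \<Rightarrow>\<^sub>L 'h"
  proof (rule blinfun_eqI)
    fix y
    have "inner x (R y) = inner x (S y)" for x
      using R S [of x y] by (simp add: inner_eq_Re_cinner)
    then show "R y = S y" using vector_eq_ldot by blast
  qed
  ultimately have "hilbert_adjoint T = S"
    unfolding hilbert_adjoint_def by (intro the_equality) auto
  then show ?thesis by (simp add: S)
qed

section \<open>Row operators and homogeneous components\<close>

text \<open>The row \<open>(T\<^sub>1, \<dots>, T\<^sub>d)\<close>, as an operator on a \<open>d\<close>-fold direct sum, has norm at most \<open>x\<close>.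
  This form of the condition \<open>\<parallel>T\<^sub>1 T\<^sub>1\<^sup>* + \<dots> + T\<^sub>d T\<^sub>d\<^sup>*\<parallel> \<le> x\<^sup>2\<close> avoids adjoints and passes to words.\<close>

definition row_bound :: "real \<Rightarrow> ('d::finite \<Rightarrow> 'h::real_normed_vector \<Rightarrow>\<^sub>L 'h) \<Rightarrow> bool" where
  "row_bound x T \<longleftrightarrow> (\<forall>h. norm (\<Sum>i\<in>UNIV. T i (h i)) \<le> x * L2_set (\<lambda>i. norm (h i)) UNIV)"

text \<open>The homogeneous component of degree \<open>k\<close>, as a vector of the Fock space, so that its norm is the
  \<open>\<ell>\<^sup>2\<close> norm of the coefficients.  The degree \<open>k\<close> part of a vector \<open>f\<close> is \<open>hcomp k (l2_apply f)\<close>.\<close>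

definition hcomp :: "nat \<Rightarrow> 'd::finite free_series \<Rightarrow> 'd fock" where
  "hcomp k F = (\<Sum>\<alpha> | length \<alpha> = k. F \<alpha> *\<^sub>C l2_basis \<alpha>)"

lemma finite_words: "finite {\<alpha> :: 'd::finite list. length \<alpha> = k}"
  using finite_lists_length_eq [of "UNIV :: 'd set" k] by simp

lemma sum_words_Suc:
  "(\<Sum>\<alpha> | length (\<alpha> :: 'd::finite list) = Suc k. f \<alpha>) = (\<Sum>i\<in>UNIV. \<Sum>\<beta> | length \<beta> = k. f (i # \<beta>))"
proof -
  have "{\<alpha> :: 'd list. length \<alpha> = Suc k} = (\<lambda>(i, \<beta>). i # \<beta>) ` (UNIV \<times> {\<beta>. length \<beta> = k})"
    by (auto simp: length_Suc_conv image_iff)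
  then show ?thesis
    by (simp add: sum.reindex inj_on_def split_def sum.cartesian_product)
qed

lemma op_word_Nil [simp]: "op_word T [] h = h"
  and op_word_Cons [simp]: "op_word T (i # \<alpha>) h = T i (op_word T \<alpha> h)"
  by (simp_all add: op_word_def)

text \<open>By induction on the length: a word is its first letter followed by a shorter word, and the row bound
  applies to the sum over first letters.\<close>

lemma row_bound_words:
  assumes T: "row_bound x T" and x: "0 \<le> x"
  shows "norm (\<Sum>\<alpha> | length \<alpha> = k. op_word T \<alpha> (h \<alpha>))
    \<le> x ^ k * L2_set (\<lambda>\<alpha>. norm (h \<alpha>)) {\<alpha>. length \<alpha> = k}"
proof (induction k arbitrary: h)
  case 0
  then show ?case by simp
next
  case (Suc k)
  define g where "g i = (\<Sum>\<beta> | length \<beta> = k. op_word T \<beta> (h (i # \<beta>)))" for i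
  define n where "n i = L2_set (\<lambda>\<beta>. norm (h (i # \<beta>))) {\<beta>. length \<beta> = k}" for i
  have "(\<Sum>\<alpha> | length \<alpha> = Suc k. op_word T \<alpha> (h \<alpha>)) = (\<Sum>i\<in>UNIV. T i (g i))"
    by (simp add: sum_words_Suc g_def blinfun.sum_right)
  also have "norm \<dots> \<le> x * L2_set (\<lambda>i. norm (g i)) UNIV"
    using T by (simp add: row_bound_def)
  also have "\<dots> \<le> x * L2_set (\<lambda>i. x ^ k * n i) UNIV"
    unfolding g_def n_def by (intro mult_left_mono L2_set_mono Suc.IH x) auto
  also have "\<dots> = x ^ Suc k * L2_set n UNIV"
    using x by (simp flip: L2_set_right_distrib)
  also have "L2_set n UNIV = L2_set (\<lambda>\<alpha>. norm (h \<alpha>)) {\<alpha>. length \<alpha> = Suc k}"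
    by (simp add: L2_set_def n_def sum_words_Suc sum_nonneg)
  finally show ?case .
qed

lemma sum_inner_le_L2_set:
  fixes f g :: "'i \<Rightarrow> 'a::real_inner"
  shows "(\<Sum>i\<in>A. inner (f i) (g i)) \<le> L2_set (\<lambda>i. norm (f i)) A * L2_set (\<lambda>i. norm (g i)) A"
proof -
  have "(\<Sum>i\<in>A. inner (f i) (g i)) \<le> (\<Sum>i\<in>A. norm (f i) * norm (g i))"
    by (intro sum_mono norm_cauchy_schwarz)
  also have "\<dots> \<le> L2_set (\<lambda>i. norm (f i)) A * L2_set (\<lambda>i. norm (g i)) A"
    using L2_set_mult_ineq [of "\<lambda>i. norm (f i)" "\<lambda>i. norm (g i)" A] by simp
  finally show ?thesis .
qed

lemma L2_set_power2: "(L2_set f A)\<^sup>2 = (\<Sum>i\<in>A. (f i)\<^sup>2)"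
  by (simp add: L2_set_def sum_nonneg)

text \<open>The row operator and its adjoint, the column \<open>(T\<^sub>1\<^sup>*, \<dots>, T\<^sub>d\<^sup>*)\<close>, have the same norm, and
  \<open>T\<^sub>1 T\<^sub>1\<^sup>* + \<dots> + T\<^sub>d T\<^sub>d\<^sup>*\<close> is their product.\<close>

lemma row_bound_iff_norm_row_square:
  fixes T :: "'d::finite \<Rightarrow> 'h::complex_hilbert \<Rightarrow>\<^sub>L 'h"
  assumes T: "\<And>i. complex_linear (T i)" and x: "0 \<le> x"
  shows "row_bound x T \<longleftrightarrow> norm (\<Sum>i\<in>UNIV. T i o\<^sub>L hilbert_adjoint (T i)) \<le> x\<^sup>2"
proof -
  define A where "A = (\<Sum>i\<in>UNIV. T i o\<^sub>L hilbert_adjoint (T i))"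
  define c where "c h = L2_set (\<lambda>i. norm (hilbert_adjoint (T i) h)) UNIV" for h
  have A: "A h = (\<Sum>i\<in>UNIV. T i (hilbert_adjoint (T i) h))" for h
    by (simp add: A_def blinfun.sum_left)
  have c: "(c h)\<^sup>2 = inner (A h) h" for h
    by (simp add: A c_def L2_set_power2 inner_sum_left hilbert_adjoint_inner T power2_norm_eq_inner)
  show ?thesis unfolding A_def [symmetric]
  proof
    assume R: "row_bound x T"
    show "norm A \<le> x\<^sup>2"
    proof (rule norm_blinfun_bound)
      fix h
      have "norm (A h) \<le> x * c h"
        using R by (simp add: row_bound_def A c_def)
      then have "(norm (A h))\<^sup>2 \<le> (x * c h)\<^sup>2" by (intro power_mono) auto
      also have "\<dots> = x\<^sup>2 * inner (A h) h" by (simp add: power_mult_distrib c)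
      also have "\<dots> \<le> x\<^sup>2 * (norm (A h) * norm h)"
        by (intro mult_left_mono norm_cauchy_schwarz) simp
      finally have "norm (A h) * norm (A h) \<le> norm (A h) * (x\<^sup>2 * norm h)"
        by (simp add: power2_eq_square ac_simps)
      then show "norm (A h) \<le> x\<^sup>2 * norm h" by (cases "A h = 0") auto
    qed simp
  next
    assume n: "norm A \<le> x\<^sup>2"
    have c_le: "c h \<le> x * norm h" for h
    proof (rule power2_le_imp_le)
      have "(c h)\<^sup>2 \<le> norm (A h) * norm h" unfolding c by (rule norm_cauchy_schwarz)
      also have "\<dots> \<le> (x\<^sup>2 * norm h) * norm h"
        by (intro mult_right_mono order_trans [OF norm_blinfun] n) simp_all
      finally show "(c h)\<^sup>2 \<le> (x * norm h)\<^sup>2" by (simp add: power2_eq_square ac_simps)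
    qed (use x in simp)
    show "row_bound x T" unfolding row_bound_def
    proof
      fix h
      define s where "s = (\<Sum>i\<in>UNIV. T i (h i))"
      define l where "l = L2_set (\<lambda>i. norm (h i)) UNIV"
      have "norm s * norm s = inner s s"
        by (metis power2_norm_eq_inner power2_eq_square)
      also have "\<dots> = (\<Sum>i\<in>UNIV. inner (T i (h i)) s)"
        by (subst s_def) (rule inner_sum_left)
      also have "\<dots> = (\<Sum>i\<in>UNIV. inner (hilbert_adjoint (T i) s) (h i))"
        by (intro sum.cong refl) (metis hilbert_adjoint_inner [OF T] inner_commute)
      also have "\<dots> \<le> c s * l"
        unfolding c_def l_def by (rule sum_inner_le_L2_set)
      also have "\<dots> \<le> (x * norm s) * l"
        by (intro mult_right_mono c_le) (simp add: l_def)
      finally have "norm s * norm s \<le> norm s * (x * l)" by (simp add: ac_simps)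
      then show "norm s \<le> x * l"
        using x by (cases "s = 0") (auto simp: l_def)
    qed
  qed
qed

lemma row_ball_row_bound: "T \<in> row_ball x \<Longrightarrow> 0 \<le> x \<Longrightarrow> row_bound x T"
  by (subst row_bound_iff_norm_row_square) (auto simp: row_ball_def)

lemma l2_eqI: "(\<And>i. l2_apply f i = l2_apply g i) \<Longrightarrow> f = g"
  by (simp add: l2_apply_inject [symmetric] fun_eq_iff)

lemma l2_apply_hcomp: "l2_apply (hcomp k F) \<alpha> = (if length \<alpha> = k then F \<alpha> else 0)"
proof -
  have "l2_apply (hcomp k F) \<alpha> = (\<Sum>\<beta> | length \<beta> = k. if \<beta> = \<alpha> then F \<beta> else 0)"
    unfolding hcomp_def l2_apply_sum
    by (intro sum.cong) (auto simp: scaleC_l2.rep_eq l2_basis.rep_eq)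
  then show ?thesis by (simp add: finite_words)
qed

lemma norm_hcomp: "norm (hcomp k F) = L2_set (\<lambda>\<alpha>. cmod (F \<alpha>)) {\<alpha>. length \<alpha> = k}"
proof (rule power2_eq_imp_eq)
  have "(norm (hcomp k F))\<^sup>2 = (\<Sum>\<^sub>\<infinity>\<alpha>\<in>{\<alpha>. length \<alpha> = k}. (cmod (F \<alpha>))\<^sup>2)"
    unfolding norm_l2_squared by (rule infsum_cong_neutral) (auto simp: l2_apply_hcomp)
  then show "(norm (hcomp k F))\<^sup>2 = (L2_set (\<lambda>\<alpha>. cmod (F \<alpha>)) {\<alpha>. length \<alpha> = k})\<^sup>2"
    by (simp add: L2_set_power2 finite_words)
qed simp_all

lemma hcomp_add: "hcomp k (series_add F G) = hcomp k F + hcomp k G"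
  and hcomp_diff: "hcomp k (series_diff F G) = hcomp k F - hcomp k G"
  and hcomp_smult: "hcomp k (series_smult c F) = c *\<^sub>C hcomp k F"
  by (rule l2_eqI; simp add: l2_apply_hcomp plus_l2.rep_eq minus_l2.rep_eq scaleC_l2.rep_eq
      series_add_def series_diff_def series_smult_def)+

lemma complex_linear_op_word:
  assumes "\<And>i. complex_linear (T i)"
  shows "op_word T \<alpha> (c *\<^sub>C h) = c *\<^sub>C op_word T \<alpha> h"
  using assms by (induction \<alpha>) (simp_all add: complex_linear_def)

lemma hom_part_apply: "hom_part k F T h = (\<Sum>\<alpha> | length \<alpha> = k. F \<alpha> *\<^sub>C op_word T \<alpha> h)"
  by (simp add: hom_part_def blinfun.sum_left scaleC_blinfun.rep_eq)

text \<open>The homogeneous case of the von Neumann inequality for row contractions.\<close>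

lemma norm_hom_part_le:
  assumes T: "row_bound x T" "\<And>i. complex_linear (T i)" and x: "0 \<le> x"
  shows "norm (hom_part k F T) \<le> x ^ k * norm (hcomp k F)"
proof (rule norm_blinfun_bound)
  fix h
  have "norm (hom_part k F T h) = norm (\<Sum>\<alpha> | length \<alpha> = k. op_word T \<alpha> (F \<alpha> *\<^sub>C h))"
    by (simp add: hom_part_apply complex_linear_op_word T)
  also have "\<dots> \<le> x ^ k * L2_set (\<lambda>\<alpha>. norm (F \<alpha> *\<^sub>C h)) {\<alpha>. length \<alpha> = k}"
    by (rule row_bound_words [OF T(1) x])
  also have "\<dots> = x ^ k * norm (hcomp k F) * norm h"
    by (simp add: norm_scaleC norm_hcomp L2_set_left_distrib)
  finally show "norm (hom_part k F T h) \<le> x ^ k * norm (hcomp k F) * norm h" .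
qed (use x in simp)

lemma complex_linear_creation: "complex_linear (creation j)"
  unfolding complex_linear_def creation.rep_eq
  by (intro allI l2_eqI) (simp add: create.rep_eq scaleC_l2.rep_eq split: list.split)

text \<open>The creation operators are isometries with mutually orthogonal ranges.\<close>

lemma row_bound_creation: "row_bound 1 creation"
  unfolding row_bound_def
proof
  fix h :: "'a \<Rightarrow> 'a fock"
  have orth: "inner (creation i f) (creation j g) = 0" if "i \<noteq> j" for i j :: 'a and f g
  proof -
    have "cnj (l2_apply (creation i f) \<alpha>) * l2_apply (creation j g) \<alpha> = 0" for \<alpha>
      using that by (cases \<alpha>) (simp_all add: creation.rep_eq create.rep_eq)
    then have *: "(\<lambda>\<alpha>. cnj (l2_apply (creation i f) \<alpha>) * l2_apply (creation j g) \<alpha>) = (\<lambda>_. 0)"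
      by blast
    have "l2_cinner (creation i f) (creation j g) = 0" unfolding l2_cinner_def * by simp
    then show ?thesis by (simp add: inner_l2_def)
  qed
  have "(norm (\<Sum>i\<in>UNIV. creation i (h i)))\<^sup>2 = (\<Sum>i\<in>UNIV. (norm (creation i (h i)))\<^sup>2)"
    by (rule norm_sum_Pythagorean) (auto simp: pairwise_def orthogonal_def orth)
  also have "\<dots> = (L2_set (\<lambda>i. norm (h i)) UNIV)\<^sup>2"
    by (simp add: L2_set_power2 creation.rep_eq norm_create)
  finally show "norm (\<Sum>i\<in>UNIV. creation i (h i)) \<le> 1 * L2_set (\<lambda>i. norm (h i)) UNIV"
    by (simp add: power2_le_imp_le)
qed

section \<open>A copy of the Fock space\<close>

lemma
  fixes x y z :: "'h::complex_hilbert"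
  shows cinner_zero_right: "cinner x 0 = 0"
    and cinner_diff_right: "cinner x (y - z) = cinner x y - cinner x z"
    and cinner_scaleR_right: "cinner x (r *\<^sub>R y) = of_real r * cinner x y"
proof -
  show s: "cinner x (r *\<^sub>R y) = of_real r * cinner x y" for r and y :: 'h
    by (simp add: cinner_scaleC_right flip: scaleC_of_real)
  show "cinner x 0 = 0" using s [of 0 0] by simp
  show "cinner x (y - z) = cinner x y - cinner x z"
    using cinner_add_right [of x y "(-1) *\<^sub>R z"] s [of "-1" z] by simp
qed

lemma cinner_sum_right: "cinner x (\<Sum>i\<in>A. f i) = (\<Sum>i\<in>A. cinner x (f i :: 'h::complex_hilbert))"
  by (induction A rule: infinite_finite_induct) (simp_all add: cinner_zero_right cinner_add_right)

text \<open>One step of the Gram-Schmidt process.\<close>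

lemma orthonormal_extension:
  fixes A :: "'h::complex_hilbert set"
  assumes H: "infinite_dimensional TYPE('h)" and A: "finite A"
    and ortho: "\<And>a b. \<lbrakk>a \<in> A; b \<in> A\<rbrakk> \<Longrightarrow> cinner a b = (if a = b then 1 else 0)"
  shows "\<exists>v. cinner v v = 1 \<and> (\<forall>a\<in>A. cinner a v = 0)"
proof -
  obtain v where v: "v \<notin> cspan A"
    using H A unfolding infinite_dimensional_def by blast
  define s where "s = (\<Sum>a\<in>A. cinner a v *\<^sub>C a)"
  define w where "w = v - s"
  have "s \<in> cspan A" unfolding s_def
    by (intro complex_vector.span_sum complex_vector.span_scale complex_vector.span_base)
  with v have "w \<noteq> 0" by (auto simp: w_def)
  have perp: "cinner b w = 0" if b: "b \<in> A" for b
  proof -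
    have "cinner b s = (\<Sum>a\<in>A. if a = b then cinner b v else 0)"
      unfolding s_def cinner_sum_right
      by (rule sum.cong) (use b in \<open>auto simp: cinner_scaleC_right ortho\<close>)
    then show ?thesis using A b by (simp add: w_def cinner_diff_right)
  qed
  have ww: "cinner w w = of_real (norm w * norm w)"
  proof (rule complex_eqI)
    show "Re (cinner w w) = Re (of_real (norm w * norm w))"
      by (simp add: inner_eq_Re_cinner [symmetric] power2_norm_eq_inner [symmetric] power2_eq_square)
    show "Im (cinner w w) = Im (of_real (norm w * norm w))"
      using arg_cong [OF cinner_commute [of w w], of Im] by simp
  qed
  define u where "u = (1 / norm w) *\<^sub>R w"
  have "cinner u u = cinner (of_real (1 / norm w) *\<^sub>C w) (of_real (1 / norm w) *\<^sub>C w)"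
    by (simp only: scaleC_of_real u_def)
  also have "\<dots> = cnj (of_real (1 / norm w)) * (of_real (1 / norm w) * cinner w w)"
    by (simp only: cinner_scaleC_left cinner_scaleC_right mult.left_commute)
  also have "\<dots> = 1" using \<open>w \<noteq> 0\<close> by (simp add: ww)
  finally have "cinner u u = 1" .
  moreover have "cinner a u = 0" if "a \<in> A" for a
    using perp [OF that] by (simp add: u_def cinner_scaleR_right)
  ultimately show ?thesis by blast
qed

lemma orthonormal_family:
  assumes H: "infinite_dimensional TYPE('h::complex_hilbert)"
  obtains u :: "'i::countable \<Rightarrow> 'h::complex_hilbert" where "\<And>i j. cinner (u i) (u j) = (if i = j then 1 else 0)"
proof -
  define P where "P f n v \<longleftrightarrow> cinner v v = 1 \<and> (\<forall>m<n. cinner (f m) v = 0)"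
    for f :: "nat \<Rightarrow> 'h" and n v
  have ortho: "cinner (f i) (f j) = (if i = j then 1 else 0)"
    if f: "\<And>m. m < n \<Longrightarrow> P f m (f m)" and ij: "i < n" "j < n" for f n i j
    using f [OF ij(1)] f [OF ij(2)] cinner_commute [of "f i" "f j"]
    by (cases i j rule: linorder_cases) (auto simp: P_def)
  have "\<exists>f. \<forall>n. P f n (f n)"
  proof (rule dependent_wellorder_choice)
    show "P f n v = P g n v" if "\<And>m. m < n \<Longrightarrow> f m = g m" for f g n v
      using that by (simp add: P_def)
  next
    fix n and f :: "nat \<Rightarrow> 'h"
    assume f: "\<And>m. m < n \<Longrightarrow> P f m (f m)"
    have "cinner a b = (if a = b then 1 else 0)" if ab: "a \<in> f ` {..<n}" "b \<in> f ` {..<n}" for a b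
    proof -
      obtain i j where "i < n" "j < n" "a = f i" "b = f j" using ab by auto
      with ortho [OF f, of n i j] ortho [OF f, of n j j] show ?thesis by (auto split: if_splits)
    qed
    then have "\<exists>v. cinner v v = 1 \<and> (\<forall>a\<in>f ` {..<n}. cinner a v = 0)"
      by (intro orthonormal_extension [OF H]) auto
    then show "\<exists>v. P f n v" unfolding P_def by blast
  qed
  then obtain f where f: "\<And>n. P f n (f n)" by blast
  have "cinner (f i) (f j) = (if i = j then 1 else 0)" for i j
    by (rule ortho [of "Suc (max i j)"]) (auto simp: f)
  then show thesis by (intro that [of "\<lambda>i. f (to_nat i)"]) simp
qed

lemma cinner_l2_basis: "cinner f (l2_basis i) = cnj (l2_apply f i)"
proof -
  have "cinner f (l2_basis i) = (\<Sum>\<^sub>\<infinity>j\<in>{i}. cnj (l2_apply f i))"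
    unfolding cinner_l2_def l2_cinner_def
    by (rule infsum_cong_neutral) (auto simp: l2_basis.rep_eq)
  then show ?thesis by simp
qed

text \<open>The isometry \<open>V\<close> is the adjoint of the map \<open>W\<close> that takes coefficients with respect to an
  orthonormal family; this replaces convergence of orthogonal series in \<open>H\<close> by the inequality of
  Bessel.\<close>

lemma isometric_copy_of_l2:
  assumes H: "infinite_dimensional TYPE('h::complex_hilbert)"
  obtains V :: "'i::countable l2 \<Rightarrow>\<^sub>L 'h::complex_hilbert" and W :: "'h \<Rightarrow>\<^sub>L 'i l2"
  where "\<And>c f. V (c *\<^sub>C f) = c *\<^sub>C V f" "\<And>c h. W (c *\<^sub>C h) = c *\<^sub>C W h"
    "\<And>f. norm (V f) \<le> norm f" "\<And>h. norm (W h) \<le> norm h" "\<And>i. W (V (l2_basis i)) = l2_basis i"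
proof -
  obtain u :: "'i \<Rightarrow> 'h" where u: "\<And>i j. cinner (u i) (u j) = (if i = j then 1 else 0)"
    using orthonormal_family [OF H] by metis
  have Bessel: "(\<Sum>i\<in>A. (cmod (cinner (u i) h))\<^sup>2) \<le> (norm h)\<^sup>2" if A: "finite A" for A h
  proof -
    define s where "s = (\<Sum>i\<in>A. cinner (u i) h *\<^sub>C u i)"
    define b where "b = (\<Sum>i\<in>A. (cmod (cinner (u i) h))\<^sup>2)"
    have us: "cinner (u i) s = cinner (u i) h" if i: "i \<in> A" for i
    proof -
      have "cinner (u i) s = (\<Sum>j\<in>A. if j = i then cinner (u i) h else 0)"
        unfolding s_def cinner_sum_right by (rule sum.cong) (auto simp: cinner_scaleC_right u)
      then show ?thesis using A i by simp
    qed
    have *: "inner (cinner (u i) h *\<^sub>C u i) y = (cmod (cinner (u i) h))\<^sup>2"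
      if "cinner (u i) y = cinner (u i) h" for i y
      by (simp add: inner_eq_Re_cinner cinner_scaleC_left that cmod_power2) (simp add: power2_eq_square)
    have "inner s h = b" "inner s s = b"
      unfolding b_def by (subst s_def, simp add: inner_sum_left * us)+
    then have "inner (h - s) (h - s) = (norm h)\<^sup>2 - b"
      by (simp add: inner_diff inner_commute power2_norm_eq_inner)
    then show ?thesis using inner_ge_zero [of "h - s"] by (simp add: b_def)
  qed
  define w :: "'h \<Rightarrow> 'i l2" where "w h = Abs_l2 (\<lambda>i. cinner (u i) h)" for h
  have w: "l2_apply (w h) i = cinner (u i) h" for h i
  proof -
    have "(\<lambda>i. (cmod (cinner (u i) h))\<^sup>2) summable_on UNIV"
      by (rule nonneg_bdd_above_summable_on)
        (auto intro!: bdd_aboveI [where M = "(norm h)\<^sup>2"] Bessel)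
    then show ?thesis by (simp add: w_def Abs_l2_inverse)
  qed
  have norm_w: "norm (w h) \<le> norm h" for h
    by (rule norm_l2_le) (auto simp: w Bessel)
  have w_scale: "w (c *\<^sub>C h) = c *\<^sub>C w h" for c h
    by (rule l2_eqI) (simp add: w scaleC_l2.rep_eq cinner_scaleC_right)
  have "bounded_linear w"
  proof (rule bounded_linear_intro [where K = 1])
    show "w (h + h') = w h + w h'" for h h'
      by (rule l2_eqI) (simp add: w plus_l2.rep_eq cinner_add_right)
    show "w (r *\<^sub>R h) = r *\<^sub>R w h" for r h
      by (simp add: w_scale flip: scaleC_of_real)
  qed (simp add: norm_w)
  then have W: "blinfun_apply (Blinfun w) = w" by (simp add: bounded_linear_Blinfun_apply)
  obtain V :: "'i l2 \<Rightarrow>\<^sub>L 'h" where V: "\<And>x y. inner (w x) y = inner x (V y)"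
    by (rule real_adjoint_exists [of "Blinfun w"]) (simp add: W)
  have V_scale: "V (c *\<^sub>C f) = c *\<^sub>C V f" for c f
  proof -
    have "inner x (V (c *\<^sub>C f)) = inner x (c *\<^sub>C V f)" for x
    proof -
      have "inner x (V (c *\<^sub>C f)) = inner (cnj c *\<^sub>C w x) f"
        by (simp add: V [symmetric] inner_scaleC_left)
      also have "\<dots> = inner x (c *\<^sub>C V f)"
        by (simp add: w_scale [symmetric] V inner_scaleC_left)
      finally show ?thesis .
    qed
    then show ?thesis using vector_eq_ldot by blast
  qed
  have norm_V: "norm (V f) \<le> norm f" for f
  proof -
    have "norm (V f) * norm (V f) = inner (w (V f)) f"
      by (simp add: V power2_norm_eq_inner [symmetric] power2_eq_square)
    also have "\<dots> \<le> norm (w (V f)) * norm f" by (rule norm_cauchy_schwarz)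
    also have "\<dots> \<le> norm (V f) * norm f" by (intro mult_right_mono norm_w) simp
    finally show ?thesis by (cases "V f = 0") auto
  qed
  have V_basis: "V (l2_basis i) = u i" for i
  proof -
    have "inner x (V (l2_basis i)) = inner x (u i)" for x
    proof -
      have "inner x (V (l2_basis i)) = Re (cnj (cinner (u i) x))"
        by (simp only: V [symmetric] inner_eq_Re_cinner [of "w x"] cinner_l2_basis w)
      also have "\<dots> = inner x (u i)"
        by (simp only: inner_eq_Re_cinner cinner_commute [of x "u i"])
      finally show ?thesis .
    qed
    then show ?thesis using vector_eq_ldot by blast
  qed
  have "w (V (l2_basis i)) = l2_basis i" for i
    by (rule l2_eqI) (auto simp: w V_basis u l2_basis.rep_eq)
  then show thesis
    by (intro that [of V "Blinfun w"]) (simp_all add: W V_scale w_scale norm_V norm_w)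
qed

text \<open>The Fock space embeds into \<open>H\<close>.  The creation operators of this copy, scaled by \<open>\<rho>\<close>
  and extended by zero, are a row on which every homogeneous component is as large as its
  coefficients allow.\<close>

lemma scaled_creation_model:
  assumes H: "infinite_dimensional TYPE('h::complex_hilbert)" and \<rho>: "0 \<le> \<rho>" "\<rho> < x"
  obtains T :: "'d::finite \<Rightarrow> 'h::complex_hilbert \<Rightarrow>\<^sub>L 'h" and W :: "'h \<Rightarrow>\<^sub>L 'd fock" and e :: 'h
  where "T \<in> row_ball x" "\<And>h. norm (W h) \<le> norm h" "norm e \<le> 1"
    "\<And>k F. W (hom_part k F T e) = \<rho> ^ k *\<^sub>R hcomp k F"
proof -
  obtain V :: "'d fock \<Rightarrow>\<^sub>L 'h" and W :: "'h \<Rightarrow>\<^sub>L 'd fock"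
    where VC: "\<And>c f. V (c *\<^sub>C f) = c *\<^sub>C V f" and WC: "\<And>c h. W (c *\<^sub>C h) = c *\<^sub>C W h"
      and nV: "\<And>f. norm (V f) \<le> norm f" and nW: "\<And>h. norm (W h) \<le> norm h"
      and WV: "\<And>\<alpha>. W (V (l2_basis \<alpha>)) = l2_basis \<alpha>"
    using isometric_copy_of_l2 [OF H] by metis
  define T where "T i = \<rho> *\<^sub>R (V o\<^sub>L creation i o\<^sub>L W)" for i
  have T: "T i h = \<rho> *\<^sub>R V (creation i (W h))" for i h
    by (simp add: T_def blinfun.scaleR_left)
  have T_lin: "complex_linear (T i)" for i
    using complex_linear_creation [of i]
    by (simp add: complex_linear_def T VC WC complex_vector.scale_left_commute flip: scaleC_of_real)
  have "row_bound \<rho> T" unfolding row_bound_def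
  proof
    fix h
    have "(\<Sum>i\<in>UNIV. T i (h i)) = \<rho> *\<^sub>R V (\<Sum>i\<in>UNIV. creation i (W (h i)))"
      by (simp add: T blinfun.sum_right scaleR_sum_right)
    also have "norm \<dots> \<le> \<rho> * norm (\<Sum>i\<in>UNIV. creation i (W (h i)))"
      using \<rho> nV by (simp add: mult_left_mono)
    also have "\<dots> \<le> \<rho> * L2_set (\<lambda>i. norm (W (h i))) UNIV"
    proof (rule mult_left_mono)
      show "norm (\<Sum>i\<in>UNIV. creation i (W (h i))) \<le> L2_set (\<lambda>i. norm (W (h i))) UNIV"
        using row_bound_creation unfolding row_bound_def
        by (drule_tac x = "\<lambda>i. W (h i)" in spec) simp
    qed (rule \<rho>)
    also have "\<dots> \<le> \<rho> * L2_set (\<lambda>i. norm (h i)) UNIV"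
      using \<rho> nW by (intro mult_left_mono L2_set_mono) auto
    finally show "norm (\<Sum>i\<in>UNIV. T i (h i)) \<le> \<rho> * L2_set (\<lambda>i. norm (h i)) UNIV" .
  qed
  then have "norm (\<Sum>i\<in>UNIV. T i o\<^sub>L hilbert_adjoint (T i)) \<le> \<rho>\<^sup>2"
    using row_bound_iff_norm_row_square T_lin \<rho>(1) by blast
  also have "\<rho>\<^sup>2 < x\<^sup>2" using \<rho> by (intro power_strict_mono) auto
  finally have "T \<in> row_ball x" by (simp add: row_ball_def T_lin)
  moreover have word: "op_word T \<alpha> (V (l2_basis [])) = \<rho> ^ length \<alpha> *\<^sub>R V (l2_basis \<alpha>)" for \<alpha>
    by (induction \<alpha>) (simp_all add: T WV creation_basis blinfun.scaleR_right)
  have "W (hom_part k F T (V (l2_basis []))) = \<rho> ^ k *\<^sub>R hcomp k F" for k F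
  proof -
    have "W (hom_part k F T (V (l2_basis [])))
        = (\<Sum>\<alpha> | length \<alpha> = k. F \<alpha> *\<^sub>C \<rho> ^ length \<alpha> *\<^sub>R l2_basis \<alpha>)"
      by (simp add: hom_part_apply blinfun.sum_right blinfun.scaleR_right word WC WV)
    also have "\<dots> = (\<Sum>\<alpha> | length \<alpha> = k. \<rho> ^ k *\<^sub>R F \<alpha> *\<^sub>C l2_basis \<alpha>)"
      by (rule sum.cong) (simp_all add: complex_vector.scale_left_commute flip: scaleC_of_real)
    finally show ?thesis by (simp add: hcomp_def scaleR_sum_right)
  qed
  moreover have "norm (V (l2_basis [])) \<le> 1"
  proof -
    have "inner (l2_basis []) (l2_basis [] :: 'd fock) = 1"
      by (simp add: inner_eq_Re_cinner cinner_l2_basis l2_basis.rep_eq)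
    then have "norm (l2_basis [] :: 'd fock) = 1" by (simp add: norm_eq_sqrt_inner)
    then show ?thesis using nV [of "l2_basis []"] by simp
  qed
  ultimately show thesis using nW by (intro that [of T W "V (l2_basis [])"])
qed

section \<open>Norms on free holomorphic functions\<close>

lemma norm_hcomp_le: "norm (hcomp k (l2_apply f)) \<le> norm f"
proof (rule power2_le_imp_le)
  show "(norm (hcomp k (l2_apply f)))\<^sup>2 \<le> (norm f)\<^sup>2"
    unfolding norm_hcomp L2_set_power2 by (rule l2_finite_sum_le) (rule finite_words)
qed simp

lemma bounded_linear_hcomp: "bounded_linear (\<lambda>f. hcomp k (l2_apply f))"
  by (rule bounded_linear_intro [where K = 1])
    (auto intro!: l2_eqI simp: norm_hcomp_le l2_apply_hcomp plus_l2.rep_eq scaleR_l2.rep_eq)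

lemma hcomp_hcomp: "hcomp j (l2_apply (hcomp k F)) = (if j = k then hcomp k F else 0)"
  by (rule l2_eqI) (auto simp: l2_apply_hcomp zero_l2.rep_eq)

text \<open>A norm equivalent to the \<^const>\<open>free_norm\<close> family, up to a change of radius, that involves only the
  coefficients.  It makes products and approximation by polynomials elementary.\<close>

definition wnorm :: "real \<Rightarrow> 'd::finite free_series \<Rightarrow> real" where
  "wnorm \<rho> F = (\<Sum>k. \<rho> ^ k * norm (hcomp k F))"

context
  fixes H :: "'h::complex_hilbert itself"
  assumes H: "infinite_dimensional H"
begin

lemma infinite_dimensional_TYPE: "infinite_dimensional TYPE('h)"
  using H by (simp add: infinite_dimensional_def)

text \<open>Convergence at the scaled copy of the creation operators forces summability of the coefficient
  norms.  Conversely a point of the open row ball has norm less than some \<open>\<rho> < 1\<close>, and the von Neumann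
  inequality applies with this \<open>\<rho>\<close>.\<close>

lemma free_hol_iff:
  "F \<in> free_hol H \<longleftrightarrow> (\<forall>\<rho>. 0 < \<rho> \<longrightarrow> \<rho> < 1 \<longrightarrow> summable (\<lambda>k. \<rho> ^ k * norm (hcomp k F)))"
proof (intro iffI allI impI)
  fix \<rho> :: real assume F: "F \<in> free_hol H" and \<rho>: "0 < \<rho>" "\<rho> < 1"
  obtain T :: "'a \<Rightarrow> 'h \<Rightarrow>\<^sub>L 'h" and W :: "'h \<Rightarrow>\<^sub>L 'a fock" and e
    where T: "T \<in> row_ball 1" and W: "\<And>h. norm (W h) \<le> norm h" and e: "norm e \<le> 1"
      and WF: "\<And>k F. W (hom_part k F T e) = \<rho> ^ k *\<^sub>R hcomp k F"
    using scaled_creation_model [OF infinite_dimensional_TYPE, of \<rho> 1] \<rho> by (metis less_imp_le)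
  show "summable (\<lambda>k. \<rho> ^ k * norm (hcomp k F))"
  proof (rule summable_comparison_test')
    show "summable (\<lambda>k. norm (hom_part k F T))" using F T by (simp add: free_hol_def)
    fix k
    have "\<rho> ^ k * norm (hcomp k F) = norm (W (hom_part k F T e))"
      using \<rho> by (simp add: WF)
    also have "\<dots> \<le> norm (hom_part k F T) * norm e"
      using W norm_blinfun order_trans by blast
    also have "\<dots> \<le> norm (hom_part k F T)"
      using e by (intro mult_left_le) auto
    finally show "norm (\<rho> ^ k * norm (hcomp k F)) \<le> norm (hom_part k F T)"
      using \<rho> by simp
  qed
next
  assume R: "\<forall>\<rho>. 0 < \<rho> \<longrightarrow> \<rho> < 1 \<longrightarrow> summable (\<lambda>k. \<rho> ^ k * norm (hcomp k F))"
  show "F \<in> free_hol H" unfolding free_hol_def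
  proof (intro CollectI ballI)
    fix T :: "'a \<Rightarrow> 'h \<Rightarrow>\<^sub>L 'h" assume T: "T \<in> row_ball 1"
    define n where "n = norm (\<Sum>i\<in>UNIV. T i o\<^sub>L hilbert_adjoint (T i))"
    have "sqrt n < 1" "0 \<le> n" using T by (auto simp: row_ball_def n_def)
    then obtain \<rho> where \<rho>: "sqrt n < \<rho>" "\<rho> < 1" using dense by blast
    have "0 < \<rho>" using \<rho>(1) \<open>0 \<le> n\<close> by (meson le_less_trans real_sqrt_ge_zero)
    have "n \<le> \<rho>\<^sup>2" using \<rho>(1) by (meson less_imp_le real_le_lsqrt real_sqrt_le_iff sqrt_le_D)
    then have "row_bound \<rho> T"
      using T \<open>0 < \<rho>\<close> by (subst row_bound_iff_norm_row_square) (auto simp: row_ball_def n_def)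
    then have "norm (norm (hom_part k F T)) \<le> \<rho> ^ k * norm (hcomp k F)" for k
      using T \<open>0 < \<rho>\<close> by (simp add: row_ball_def norm_hom_part_le)
    with R [rule_format, OF \<open>0 < \<rho>\<close> \<rho>(2)] show "summable (\<lambda>k. norm (hom_part k F T))"
      by (rule summable_comparison_test')
  qed
qed

lemma summable_wnorm:
  "F \<in> free_hol H \<Longrightarrow> 0 < \<rho> \<Longrightarrow> \<rho> < 1 \<Longrightarrow> summable (\<lambda>k. \<rho> ^ k * norm (hcomp k F))"
  by (simp add: free_hol_iff)

lemma norm_series_le_wnorm:
  assumes F: "F \<in> free_hol H" and x: "0 < x" "x < 1" and T: "T \<in> row_ball x"
  shows "norm (\<Sum>k. hom_part k F (T :: 'd::finite \<Rightarrow> 'h \<Rightarrow>\<^sub>L 'h)) \<le> wnorm x F"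
  unfolding wnorm_def using T x
  by (intro norm_suminf_le summable_wnorm F norm_hom_part_le row_ball_row_bound)
    (auto simp: row_ball_def)

lemma summable_hom_part:
  assumes F: "F \<in> free_hol H" and x: "0 < x" "x < 1" and T: "T \<in> row_ball x"
  shows "summable (\<lambda>k. hom_part k F (T :: 'd::finite \<Rightarrow> 'h \<Rightarrow>\<^sub>L 'h))"
proof (rule summable_comparison_test')
  show "summable (\<lambda>k. x ^ k * norm (hcomp k F))" by (rule summable_wnorm [OF F x])
  show "norm (hom_part k F T) \<le> x ^ k * norm (hcomp k F)" for k
    using T x by (intro norm_hom_part_le row_ball_row_bound) (auto simp: row_ball_def)
qed

lemma row_ball_nonempty: "0 < x \<Longrightarrow> (row_ball x :: ('d::finite \<Rightarrow> 'h \<Rightarrow>\<^sub>L 'h) set) \<noteq> {}"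
  using scaled_creation_model [OF infinite_dimensional_TYPE, of 0 x] by (metis empty_iff order_refl)

lemma bdd_above_free_norm:
  assumes "F \<in> free_hol H" "0 < x" "x < 1"
  shows "bdd_above ((\<lambda>T. norm (\<Sum>k. hom_part k F T)) `
    (row_ball x :: ('d::finite \<Rightarrow> 'h \<Rightarrow>\<^sub>L 'h) set))"
  using norm_series_le_wnorm assms by (intro bdd_aboveI2)

lemma norm_series_le_free_norm:
  assumes "F \<in> free_hol H" "0 < x" "x < 1" "(T :: 'd::finite \<Rightarrow> 'h \<Rightarrow>\<^sub>L 'h) \<in> row_ball x"
  shows "norm (\<Sum>k. hom_part k F T) \<le> free_norm H x F"
  unfolding free_norm_def using assms by (intro cSUP_upper bdd_above_free_norm)

lemma free_norm_le_wnorm: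
  assumes "F \<in> free_hol H" "0 < x" "x < 1"
  shows "free_norm H x F \<le> wnorm x F"
  unfolding free_norm_def using assms by (intro cSUP_least row_ball_nonempty norm_series_le_wnorm)

lemma free_norm_nonneg:
  assumes "F \<in> free_hol H" "0 < x" "x < 1"
  shows "0 \<le> free_norm H x F"
proof -
  obtain T :: "'a \<Rightarrow> 'h \<Rightarrow>\<^sub>L 'h" where "T \<in> row_ball x"
    using row_ball_nonempty [OF assms(2)] by blast
  from norm_ge_zero norm_series_le_free_norm [OF assms this] show ?thesis by (rule order_trans)
qed

text \<open>Applied to the image of the vacuum vector in a copy of the Fock space, \<open>F\<close> returns all of its
  homogeneous components at once, and they are mutually orthogonal.\<close>

lemma hcomp_le_free_norm:
  fixes F :: "'d::finite free_series"
  assumes F: "F \<in> free_hol H" and x: "0 < x" "x < 1"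
  shows "x ^ k * norm (hcomp k F) \<le> free_norm H x F"
proof (rule tendsto_upperbound)
  \<comment> \<open>the scaled copies of the creation operators lie in the open row ball of radius \<open>x\<close> only for \<open>\<rho> < x\<close>\<close>
  show "((\<lambda>\<rho>. \<rho> ^ k * norm (hcomp k F)) \<longlongrightarrow> x ^ k * norm (hcomp k F)) (at_left x)"
    by (intro tendsto_intros)
  have "\<rho> ^ k * norm (hcomp k F) \<le> free_norm H x F" if \<rho>: "\<rho> \<in> {0<..<x}" for \<rho>
  proof -
    have \<rho>': "0 \<le> \<rho>" "\<rho> < x" using \<rho> by auto
    obtain T :: "'d \<Rightarrow> 'h \<Rightarrow>\<^sub>L 'h" and W :: "'h \<Rightarrow>\<^sub>L 'd fock" and e
      where T: "T \<in> row_ball x" and W: "\<And>h. norm (W h) \<le> norm h" and e: "norm e \<le> 1"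
        and WF: "\<And>k F. W (hom_part k F T e) = \<rho> ^ k *\<^sub>R hcomp k F"
      using scaled_creation_model [OF infinite_dimensional_TYPE \<rho>'] by metis
    define L where "L A = hcomp k (l2_apply (W (blinfun_apply A e)))" for A :: "'h \<Rightarrow>\<^sub>L 'h"
    define S where "S = (\<Sum>j. hom_part j F T)"
    have L: "bounded_linear L" unfolding L_def
      by (rule bounded_linear_compose [OF bounded_linear_hcomp]) (intro bounded_linear_intros)
    have norm_L: "norm (L A) \<le> norm A" for A
    proof -
      have "norm (L A) \<le> norm (W (A e))" unfolding L_def by (rule norm_hcomp_le)
      also have "\<dots> \<le> norm (A e)" by (rule W)
      also have "\<dots> \<le> norm A * norm e" by (rule norm_blinfun)
      also have "\<dots> \<le> norm A" using e by (intro mult_left_le) auto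
      finally show ?thesis .
    qed
    have "L S = (\<Sum>j. L (hom_part j F T))"
      unfolding S_def using F x T by (intro bounded_linear.suminf [OF L] summable_hom_part)
    also have "(\<lambda>j. L (hom_part j F T)) = (\<lambda>j. if j = k then \<rho> ^ k *\<^sub>R hcomp k F else 0)"
    proof
      fix j
      have "L (hom_part j F T) = \<rho> ^ j *\<^sub>R hcomp k (l2_apply (hcomp j F))"
        unfolding L_def WF by (rule linear_cmul [OF bounded_linear.linear [OF bounded_linear_hcomp]])
      then show "L (hom_part j F T) = (if j = k then \<rho> ^ k *\<^sub>R hcomp k F else 0)"
        by (simp add: hcomp_hcomp)
    qed
    also have "suminf \<dots> = \<rho> ^ k *\<^sub>R hcomp k F"
      using sums_single [of k "\<lambda>_. \<rho> ^ k *\<^sub>R hcomp k F"] by (simp add: sums_iff)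
    finally have "\<rho> ^ k * norm (hcomp k F) = norm (L S)" using \<rho>' by simp
    also have "\<dots> \<le> norm S" by (rule norm_L)
    also have "\<dots> \<le> free_norm H x F"
      unfolding S_def using F x T by (rule norm_series_le_free_norm)
    finally show ?thesis .
  qed
  then show "\<forall>\<^sub>F \<rho> in at_left x. \<rho> ^ k * norm (hcomp k F) \<le> free_norm H x F"
    using eventually_at_left_real [OF x(1)] by (rule eventually_mono [rotated])
qed simp

end

section \<open>Products of series\<close>

lemma series_mult_eq:
  "series_mult F G \<gamma> = (\<Sum>i\<le>length \<gamma>. F (take i \<gamma>) * G (drop i \<gamma>))"
  unfolding series_mult_def
  by (rule sum.reindex_bij_witness [where i = "\<lambda>i. (take i \<gamma>, drop i \<gamma>)" and j = "\<lambda>(\<beta>, \<delta>). length \<beta>"])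
    auto

lemma l2_apply_op_word_creation:
  "l2_apply (op_word creation \<beta> f) \<gamma> =
    (if take (length \<beta>) \<gamma> = \<beta> then l2_apply f (drop (length \<beta>) \<gamma>) else 0)"
proof (induction \<beta> arbitrary: \<gamma>)
  case (Cons b \<beta>)
  then show ?case by (cases \<gamma>) (auto simp: creation.rep_eq create.rep_eq)
qed simp

lemma l2_apply_hom_part_creation:
  "l2_apply (hom_part i F creation (hcomp j G)) \<gamma> =
    (if length \<gamma> = i + j then F (take i \<gamma>) * G (drop i \<gamma>) else 0)"
proof -
  have "l2_apply (hom_part i F creation (hcomp j G)) \<gamma>
      = (\<Sum>\<beta> | length \<beta> = i. if \<beta> = take i \<gamma>
          then F \<beta> * (if length (drop i \<gamma>) = j then G (drop i \<gamma>) else 0) else 0)"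
    unfolding hom_part_apply l2_apply_sum
  proof (rule sum.cong)
    fix \<beta> :: "'a list" assume "\<beta> \<in> {\<beta>. length \<beta> = i}"
    then have i: "length \<beta> = i" by simp
    show "l2_apply (F \<beta> *\<^sub>C op_word creation \<beta> (hcomp j G)) \<gamma> = (if \<beta> = take i \<gamma>
        then F \<beta> * (if length (drop i \<gamma>) = j then G (drop i \<gamma>) else 0) else 0)"
      unfolding scaleC_l2.rep_eq l2_apply_op_word_creation l2_apply_hcomp i by auto
  qed simp
  also have "\<dots> = (if length \<gamma> = i + j then F (take i \<gamma>) * G (drop i \<gamma>) else 0)"
    by (auto simp: finite_words)
  finally show ?thesis .
qed

text \<open>Left multiplication by a homogeneous polynomial of degree \<open>i\<close> acts on coefficient vectors as that
  polynomial in the creation operators.\<close>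

lemma hcomp_mult:
  "hcomp k (series_mult F G) = (\<Sum>i\<le>k. hom_part i F creation (hcomp (k - i) G))"
proof (rule l2_eqI)
  fix \<gamma> :: "'a list"
  show "l2_apply (hcomp k (series_mult F G)) \<gamma> =
      l2_apply (\<Sum>i\<le>k. hom_part i F creation (hcomp (k - i) G)) \<gamma>"
    by (auto simp: l2_apply_hcomp l2_apply_sum l2_apply_hom_part_creation series_mult_eq)
qed

lemma norm_hcomp_mult_le:
  "norm (hcomp k (series_mult F G)) \<le> (\<Sum>i\<le>k. norm (hcomp i F) * norm (hcomp (k - i) G))"
proof -
  have "norm (hom_part i F creation (hcomp j G)) \<le> norm (hcomp i F) * norm (hcomp j G)" for i j
  proof -
    have "norm (hom_part i F creation (hcomp j G)) \<le> norm (hom_part i F creation) * norm (hcomp j G)"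
      by (rule norm_blinfun)
    also have "\<dots> \<le> norm (hcomp i F) * norm (hcomp j G)"
      using norm_hom_part_le [OF row_bound_creation complex_linear_creation, of i F]
      by (simp add: mult_right_mono)
    finally show ?thesis .
  qed
  then show ?thesis unfolding hcomp_mult by (rule sum_norm_le)
qed

lemma weighted_norm_hcomp_mult_le:
  fixes \<rho> :: real
  assumes \<rho>: "0 \<le> \<rho>"
  shows "\<rho> ^ k * norm (hcomp k (series_mult F G)) \<le>
    (\<Sum>i\<le>k. (\<rho> ^ i * norm (hcomp i F)) * (\<rho> ^ (k - i) * norm (hcomp (k - i) G)))"
proof -
  have "\<rho> ^ k * norm (hcomp k (series_mult F G)) \<le>
      \<rho> ^ k * (\<Sum>i\<le>k. norm (hcomp i F) * norm (hcomp (k - i) G))"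
    using \<rho> by (intro mult_left_mono norm_hcomp_mult_le) simp
  also have "\<dots> = (\<Sum>i\<le>k. (\<rho> ^ i * norm (hcomp i F)) * (\<rho> ^ (k - i) * norm (hcomp (k - i) G)))"
    unfolding sum_distrib_left
  proof (rule sum.cong)
    fix i assume "i \<in> {..k}"
    then have "\<rho> ^ k = \<rho> ^ i * \<rho> ^ (k - i)" by (simp flip: power_add)
    then show "\<rho> ^ k * (norm (hcomp i F) * norm (hcomp (k - i) G)) =
        (\<rho> ^ i * norm (hcomp i F)) * (\<rho> ^ (k - i) * norm (hcomp (k - i) G))"
      by simp
  qed simp
  finally show ?thesis .
qed

lemma series_mult_add_left: "series_mult (series_add F F') G = series_add (series_mult F G) (series_mult F' G)"
  and series_mult_add_right: "series_mult F (series_add G G') = series_add (series_mult F G) (series_mult F G')"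
  and series_mult_smult_left: "series_mult (series_smult c F) G = series_smult c (series_mult F G)"
  by (simp_all add: fun_eq_iff series_mult_eq series_add_def series_smult_def distrib_left
      distrib_right mult.assoc sum.distrib sum_distrib_left)

lemma wnorm_diff_self: "wnorm \<rho> (series_diff F F) = 0"
  by (simp add: wnorm_def hcomp_diff)

lemma hom_part_add: "hom_part k (series_add F G) T = hom_part k F T + hom_part k G T"
  by (simp add: hom_part_def series_add_def complex_vector.scale_left_distrib sum.distrib)

context
  fixes H :: "'h::complex_hilbert itself"
  assumes H: "infinite_dimensional H"
begin

lemma free_hol_comparison:
  assumes le: "\<And>\<rho> k. \<lbrakk>0 < \<rho>; \<rho> < 1\<rbrakk> \<Longrightarrow> \<rho> ^ k * norm (hcomp k F) \<le> g \<rho> k"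
    and sum: "\<And>\<rho>. \<lbrakk>0 < \<rho>; \<rho> < 1\<rbrakk> \<Longrightarrow> summable (g \<rho>)"
  shows "F \<in> free_hol H"
  unfolding free_hol_iff [OF H]
proof (intro allI impI)
  fix \<rho> :: real assume \<rho>: "0 < \<rho>" "\<rho> < 1"
  have "norm (\<rho> ^ k * norm (hcomp k F)) \<le> g \<rho> k" for k
    using le [OF \<rho>, of k] \<rho> by simp
  then show "summable (\<lambda>k. \<rho> ^ k * norm (hcomp k F))"
    by (rule summable_comparison_test' [OF sum [OF \<rho>]])
qed

lemma free_hol_closed:
  assumes F: "F \<in> free_hol H" and G: "G \<in> free_hol H"
  shows free_hol_add: "series_add F G \<in> free_hol H"
    and free_hol_diff: "series_diff F G \<in> free_hol H"
    and free_hol_mult: "series_mult F G \<in> free_hol H"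
proof -
  note sum = summable_wnorm [OF H F] summable_wnorm [OF H G]
  show "series_add F G \<in> free_hol H"
    by (rule free_hol_comparison [where g = "\<lambda>\<rho> k. \<rho> ^ k * norm (hcomp k F) + \<rho> ^ k * norm (hcomp k G)"],
      simp add: hcomp_add distrib_left [symmetric] mult_left_mono norm_triangle_ineq, simp add: summable_add sum)
  show "series_diff F G \<in> free_hol H"
    by (rule free_hol_comparison [where g = "\<lambda>\<rho> k. \<rho> ^ k * norm (hcomp k F) + \<rho> ^ k * norm (hcomp k G)"],
      simp add: hcomp_diff distrib_left [symmetric] mult_left_mono norm_triangle_ineq4, simp add: summable_add sum)
  show "series_mult F G \<in> free_hol H"
  proof (rule free_hol_comparison)
    fix \<rho> :: real and k assume \<rho>: "0 < \<rho>" "\<rho> < 1"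
    from \<rho>(1) show "\<rho> ^ k * norm (hcomp k (series_mult F G)) \<le>
        (\<Sum>i\<le>k. (\<rho> ^ i * norm (hcomp i F)) * (\<rho> ^ (k - i) * norm (hcomp (k - i) G)))"
      by (intro weighted_norm_hcomp_mult_le less_imp_le)
  next
    fix \<rho> :: real assume \<rho>: "0 < \<rho>" "\<rho> < 1"
    then show "summable (\<lambda>k. \<Sum>i\<le>k. (\<rho> ^ i * norm (hcomp i F)) * (\<rho> ^ (k - i) * norm (hcomp (k - i) G)))"
      by (intro summable_Cauchy_product) (simp_all add: sum abs_mult)
  qed
qed

lemma free_hol_smult: "F \<in> free_hol H \<Longrightarrow> series_smult c F \<in> free_hol H"
  by (rule free_hol_comparison [where g = "\<lambda>\<rho> k. cmod c * (\<rho> ^ k * norm (hcomp k F))"])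
    (simp_all add: hcomp_smult norm_scaleC mult.left_commute summable_mult summable_wnorm [OF H])

lemma wnorm_nonneg: "\<lbrakk>F \<in> free_hol H; 0 < \<rho>; \<rho> < 1\<rbrakk> \<Longrightarrow> 0 \<le> wnorm \<rho> F"
  unfolding wnorm_def by (intro suminf_nonneg summable_wnorm [OF H]) auto

lemma wnorm_add_le:
  assumes F: "F \<in> free_hol H" and G: "G \<in> free_hol H" and \<rho>: "0 < \<rho>" "\<rho> < 1"
  shows "wnorm \<rho> (series_add F G) \<le> wnorm \<rho> F + wnorm \<rho> G"
  unfolding wnorm_def suminf_add [OF summable_wnorm [OF H F \<rho>] summable_wnorm [OF H G \<rho>]]
proof (rule suminf_le)
  show "\<rho> ^ k * norm (hcomp k (series_add F G)) \<le>
      \<rho> ^ k * norm (hcomp k F) + \<rho> ^ k * norm (hcomp k G)" for k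
    using \<rho> by (simp add: hcomp_add distrib_left [symmetric] mult_left_mono norm_triangle_ineq)
qed (intro summable_wnorm [OF H] summable_add free_hol_add F G \<rho>)+

lemma wnorm_smult:
  assumes F: "F \<in> free_hol H" and \<rho>: "0 < \<rho>" "\<rho> < 1"
  shows "wnorm \<rho> (series_smult c F) = cmod c * wnorm \<rho> F"
  using suminf_mult [OF summable_wnorm [OF H F \<rho>], of "cmod c"]
  by (simp add: wnorm_def hcomp_smult norm_scaleC mult.left_commute)

lemma wnorm_mult_le:
  assumes F: "F \<in> free_hol H" and G: "G \<in> free_hol H" and \<rho>: "0 < \<rho>" "\<rho> < 1"
  shows "wnorm \<rho> (series_mult F G) \<le> wnorm \<rho> F * wnorm \<rho> G"
proof -
  define a where "a k = \<rho> ^ k * norm (hcomp k F)" for k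
  define b where "b k = \<rho> ^ k * norm (hcomp k G)" for k
  have a: "summable (\<lambda>k. norm (a k))" and b: "summable (\<lambda>k. norm (b k))"
    using summable_wnorm [OF H F \<rho>] summable_wnorm [OF H G \<rho>] \<rho> by (simp_all add: a_def b_def)
  have "wnorm \<rho> (series_mult F G) \<le> (\<Sum>k. \<Sum>i\<le>k. a i * b (k - i))"
    unfolding wnorm_def
  proof (rule suminf_le)
    show "\<rho> ^ k * norm (hcomp k (series_mult F G)) \<le> (\<Sum>i\<le>k. a i * b (k - i))" for k
      unfolding a_def b_def using \<rho>(1) by (intro weighted_norm_hcomp_mult_le less_imp_le)
  qed (intro summable_wnorm [OF H] free_hol_mult F G \<rho> summable_Cauchy_product a b)+
  also have "\<dots> = wnorm \<rho> F * wnorm \<rho> G"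
    unfolding wnorm_def a_def [symmetric] b_def [symmetric] by (rule Cauchy_product [OF a b, symmetric])
  finally show ?thesis .
qed

lemma wnorm_mono:
  assumes F: "F \<in> free_hol H" and \<rho>: "0 < \<rho>" "\<rho> \<le> x" "x < 1"
  shows "wnorm \<rho> F \<le> wnorm x F"
  unfolding wnorm_def using assms
  by (intro suminf_le summable_wnorm [OF H] mult_right_mono power_mono) auto

text \<open>The terms of \<open>wnorm \<rho> F\<close> are at most \<open>(\<rho> / x)\<^sup>k\<close> times \<open>free_norm H x F\<close>; hence the geometric factor.\<close>

lemma wnorm_le_free_norm:
  assumes F: "F \<in> free_hol H" and \<rho>: "0 < \<rho>" "\<rho> < x" "x < 1"
  shows "wnorm \<rho> F \<le> x / (x - \<rho>) * free_norm H x F"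
proof -
  have x: "0 < x" and q: "norm (\<rho> / x) < 1" using \<rho> by auto
  have "wnorm \<rho> F \<le> (\<Sum>k. (\<rho> / x) ^ k * free_norm H x F)"
    unfolding wnorm_def
  proof (rule suminf_le)
    fix k
    have "\<rho> ^ k * norm (hcomp k F) = (\<rho> / x) ^ k * (x ^ k * norm (hcomp k F))"
      using x by (simp add: power_divide)
    also have "\<dots> \<le> (\<rho> / x) ^ k * free_norm H x F"
      using \<rho> x by (intro mult_left_mono hcomp_le_free_norm H F) auto
    finally show "\<rho> ^ k * norm (hcomp k F) \<le> (\<rho> / x) ^ k * free_norm H x F" .
  next
    show "summable (\<lambda>k. \<rho> ^ k * norm (hcomp k F))" using \<rho> by (intro summable_wnorm [OF H] F) auto
    show "summable (\<lambda>k. (\<rho> / x) ^ k * free_norm H x F)"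
      using q by (intro summable_mult2 summable_geometric)
  qed
  also have "\<dots> = (1 / (1 - \<rho> / x)) * free_norm H x F"
    using suminf_mult2 [OF summable_geometric [OF q], of "free_norm H x F"] suminf_geometric [OF q]
    by simp
  also have "1 / (1 - \<rho> / x) = x / (x - \<rho>)" using \<rho> x by (simp add: field_simps)
  finally show ?thesis .
qed

lemma free_norm_perturb:
  fixes F :: "'d::finite free_series"
  assumes F: "F \<in> free_hol H" and G: "G \<in> free_hol H" and x: "0 < x" "x < 1"
  shows "free_norm H x (series_add F G) \<le> free_norm H x F + wnorm x G"
  unfolding free_norm_def [of H x "series_add F G"]
proof (rule cSUP_least)
  show "(row_ball x :: ('d \<Rightarrow> 'h \<Rightarrow>\<^sub>L 'h) set) \<noteq> {}" by (rule row_ball_nonempty [OF H x(1)])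
  fix T :: "'d \<Rightarrow> 'h \<Rightarrow>\<^sub>L 'h" assume T: "T \<in> row_ball x"
  have "(\<Sum>k. hom_part k (series_add F G) T) = (\<Sum>k. hom_part k F T) + (\<Sum>k. hom_part k G T)"
    unfolding hom_part_add by (rule suminf_add [OF summable_hom_part [OF H F x T] summable_hom_part [OF H G x T], symmetric])
  also have "norm \<dots> \<le> norm (\<Sum>k. hom_part k F T) + norm (\<Sum>k. hom_part k G T)"
    by (rule norm_triangle_ineq)
  also have "\<dots> \<le> free_norm H x F + wnorm x G"
    by (rule add_mono [OF norm_series_le_free_norm [OF H F x T] norm_series_le_wnorm [OF H G x T]])
  finally show "norm (\<Sum>k. hom_part k (series_add F G) T) \<le> free_norm H x F + wnorm x G" .
qed

section \<open>Closures of sets of series\<close>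

text \<open>Approximability in every weighted norm.  It agrees with the closure in the topology of free
  holomorphic functions (\<open>closure_of_eq_wclosure\<close>) and turns statements about closures of ideals into
  estimates.\<close>

definition wclosure :: "'d::finite free_series set \<Rightarrow> 'd free_series set" where
  "wclosure S = {G \<in> free_hol H. \<forall>\<rho> \<epsilon>. 0 < \<rho> \<longrightarrow> \<rho> < 1 \<longrightarrow> 0 < \<epsilon> \<longrightarrow>
    (\<exists>p\<in>S. wnorm \<rho> (series_diff G p) < \<epsilon>)}"

lemma topspace_free_hol: "topspace (free_hol_topology H) = (free_hol H :: 'd::finite free_series set)"
proof -
  have "F \<in> {G \<in> free_hol H. free_norm H (1/2) (series_diff G F) < 1}"
    if F: "F \<in> free_hol H" for F :: "'d free_series"
    using free_norm_le_wnorm [OF H free_hol_diff [OF F F], of "1/2"] F by (simp add: wnorm_diff_self)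
  moreover have "(0::real) < 1/2" "(1/2::real) < 1" "(0::real) < 1" by simp_all
  ultimately show ?thesis
    unfolding free_hol_topology_def topology_generated_by_topspace by blast
qed

text \<open>The generating sets of the topology are balls with arbitrary centers and form only a subbasis; finite
  intersections are handled by monotonicity of the weighted norm in the radius.\<close>

lemma open_contains_wball:
  fixes U :: "'d::finite free_series set"
  assumes "openin (free_hol_topology H) U" "G \<in> U"
  shows "\<exists>\<rho> \<epsilon>. 0 < \<rho> \<and> \<rho> < 1 \<and> 0 < \<epsilon> \<and>
    (\<forall>G'\<in>free_hol H. wnorm \<rho> (series_diff G G') < \<epsilon> \<longrightarrow> G' \<in> U)"
  using assms unfolding free_hol_topology_def openin_topology_generated_by_iff
proof (induction arbitrary: G rule: generate_topology_on.induct)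
  case Empty
  then show ?case by simp
next
  case (Int a b)
  then have G: "G \<in> a" "G \<in> b" by auto
  have "openin (free_hol_topology H) a"
    unfolding free_hol_topology_def openin_topology_generated_by_iff by (rule Int.hyps(1))
  then have "G \<in> free_hol H" using openin_subset G(1) topspace_free_hol by blast
  obtain r1 e1 where 1: "0 < r1" "r1 < 1" "0 < e1"
      "\<And>G'. \<lbrakk>G' \<in> free_hol H; wnorm r1 (series_diff G G') < e1\<rbrakk> \<Longrightarrow> G' \<in> a"
    using Int.IH(1) [OF G(1)] by blast
  obtain r2 e2 where 2: "0 < r2" "r2 < 1" "0 < e2"
      "\<And>G'. \<lbrakk>G' \<in> free_hol H; wnorm r2 (series_diff G G') < e2\<rbrakk> \<Longrightarrow> G' \<in> b"
    using Int.IH(2) [OF G(2)] by blast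
  have "G' \<in> a \<inter> b"
    if G': "G' \<in> free_hol H" "wnorm (max r1 r2) (series_diff G G') < min e1 e2" for G'
  proof -
    have "wnorm r1 (series_diff G G') \<le> wnorm (max r1 r2) (series_diff G G')"
      "wnorm r2 (series_diff G G') \<le> wnorm (max r1 r2) (series_diff G G')"
      using 1 2 by (simp_all add: wnorm_mono free_hol_diff \<open>G \<in> free_hol H\<close> G')
    then show ?thesis using 1(4) [OF G'(1)] 2(4) [OF G'(1)] G'(2) by auto
  qed
  moreover have "0 < max r1 r2" "max r1 r2 < 1" "0 < min e1 e2" using 1 2 by auto
  ultimately show ?case by blast
next
  case (UN K)
  then obtain k where "k \<in> K" "G \<in> k" by blast
  with UN.IH [of k G] show ?case by blast
next
  case (Basis s)
  then obtain F x \<delta> where s: "s = {G \<in> free_hol H. free_norm H x (series_diff G F) < \<delta>}"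
    and F: "F \<in> free_hol H" and x: "0 < x" "x < 1" by blast
  with Basis.prems have G: "G \<in> free_hol H" by auto
  define \<epsilon> where "\<epsilon> = \<delta> - free_norm H x (series_diff G F)"
  have "0 < \<epsilon>" using Basis.prems by (simp add: s \<epsilon>_def)
  moreover have "G' \<in> s" if G': "G' \<in> free_hol H" "wnorm x (series_diff G G') < \<epsilon>" for G'
  proof -
    have "series_diff G' F = series_add (series_diff G F) (series_smult (-1) (series_diff G G'))"
      by (simp add: series_add_def series_diff_def series_smult_def)
    then have "free_norm H x (series_diff G' F)
        \<le> free_norm H x (series_diff G F) + wnorm x (series_smult (-1) (series_diff G G'))"
      using free_norm_perturb [OF free_hol_diff [OF G F]
        free_hol_smult [OF free_hol_diff [OF G G'(1)]] x] by simp
    also have "\<dots> < \<delta>"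
      using G'(2) by (simp add: \<epsilon>_def wnorm_smult free_hol_diff G G'(1) x)
    finally show ?thesis using G'(1) by (simp add: s)
  qed
  ultimately show ?case using x by blast
qed

lemma closure_of_eq_wclosure:
  fixes S :: "'d::finite free_series set"
  assumes S: "S \<subseteq> free_hol H"
  shows "free_hol_topology H closure_of S = wclosure S"
proof (intro set_eqI iffI)
  fix G assume G: "G \<in> free_hol_topology H closure_of S"
  then have G1: "G \<in> free_hol H" by (auto simp: in_closure_of topspace_free_hol)
  have "\<exists>p\<in>S. wnorm \<rho> (series_diff G p) < \<epsilon>" if \<rho>: "0 < \<rho>" "\<rho> < 1" and \<epsilon>: "0 < \<epsilon>" for \<rho> \<epsilon> :: real
  proof -
    obtain x where x: "\<rho> < x" "x < 1" using dense [OF \<rho>(2)] by blast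
    define \<delta> where "\<delta> = \<epsilon> * (x - \<rho>) / x"
    have \<delta>: "0 < \<delta>" using x \<rho> \<epsilon> by (simp add: \<delta>_def)
    define U where "U = {P \<in> free_hol H. free_norm H x (series_diff P G) < \<delta>}"
    have "openin (free_hol_topology H) U"
      unfolding free_hol_topology_def U_def
      by (rule topology_generated_by_Basis) (use G1 x \<rho> \<delta> in \<open>blast intro: less_trans\<close>)
    moreover have "G \<in> U"
      using free_norm_le_wnorm [OF H free_hol_diff [OF G1 G1], of x] G1 x \<rho> \<delta>
      by (simp add: U_def wnorm_diff_self)
    ultimately obtain p where p: "p \<in> S" "p \<in> U" using G by (auto simp: in_closure_of)
    then have pH: "p \<in> free_hol H" using S by blast
    have "series_diff G p = series_smult (-1) (series_diff p G)"
      by (simp add: series_diff_def series_smult_def)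
    then have "wnorm \<rho> (series_diff G p) = wnorm \<rho> (series_diff p G)"
      using \<rho> by (simp add: wnorm_smult free_hol_diff pH G1)
    also have "\<dots> \<le> x / (x - \<rho>) * free_norm H x (series_diff p G)"
      using \<rho> x by (intro wnorm_le_free_norm free_hol_diff pH G1)
    also have "\<dots> < x / (x - \<rho>) * \<delta>"
      using p(2) x \<rho> by (intro mult_strict_left_mono) (auto simp: U_def)
    also have "\<dots> = \<epsilon>" using x \<rho> by (simp add: \<delta>_def)
    finally show ?thesis using p(1) by blast
  qed
  with G1 show "G \<in> wclosure S" by (simp add: wclosure_def)
next
  fix G assume G: "G \<in> wclosure S"
  have "\<exists>p\<in>S. p \<in> U" if U: "openin (free_hol_topology H) U" "G \<in> U" for U
  proof -
    obtain \<rho> \<epsilon> where "0 < \<rho>" "\<rho> < 1" "0 < \<epsilon>"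
      "\<And>G'. \<lbrakk>G' \<in> free_hol H; wnorm \<rho> (series_diff G G') < \<epsilon>\<rbrakk> \<Longrightarrow> G' \<in> U"
      using open_contains_wball [OF U] by blast
    then show ?thesis using G S unfolding wclosure_def by blast
  qed
  moreover have "G \<in> free_hol H" using G by (simp add: wclosure_def)
  ultimately show "G \<in> free_hol_topology H closure_of S"
    unfolding in_closure_of topspace_free_hol by blast
qed

lemma wclosure_add:
  assumes F: "F \<in> wclosure A" and G: "G \<in> wclosure B"
    and AB: "A \<subseteq> free_hol H" "B \<subseteq> free_hol H"
    and C: "\<And>a b. \<lbrakk>a \<in> A; b \<in> B\<rbrakk> \<Longrightarrow> series_add a b \<in> C"
  shows "series_add F G \<in> wclosure C"
  unfolding wclosure_def
proof (intro CollectI conjI allI impI)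
  have FH: "F \<in> free_hol H" and GH: "G \<in> free_hol H" using F G by (auto simp: wclosure_def)
  then show "series_add F G \<in> free_hol H" by (rule free_hol_add)
  fix \<rho> \<epsilon> :: real assume \<rho>: "0 < \<rho>" "\<rho> < 1" and \<epsilon>: "0 < \<epsilon>"
  then have "0 < \<epsilon> / 2" by simp
  obtain a where a: "a \<in> A" "wnorm \<rho> (series_diff F a) < \<epsilon> / 2"
    using F \<rho> \<open>0 < \<epsilon> / 2\<close> unfolding wclosure_def by blast
  obtain b where b: "b \<in> B" "wnorm \<rho> (series_diff G b) < \<epsilon> / 2"
    using G \<rho> \<open>0 < \<epsilon> / 2\<close> unfolding wclosure_def by blast
  have "series_diff (series_add F G) (series_add a b) = series_add (series_diff F a) (series_diff G b)"
    by (simp add: fun_eq_iff series_add_def series_diff_def)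
  then have "wnorm \<rho> (series_diff (series_add F G) (series_add a b))
      \<le> wnorm \<rho> (series_diff F a) + wnorm \<rho> (series_diff G b)"
    using wnorm_add_le [OF free_hol_diff free_hol_diff, of F a G b \<rho>] FH GH a(1) b(1) AB \<rho> by auto
  also have "\<dots> < \<epsilon>" using a(2) b(2) by simp
  finally show "\<exists>p\<in>C. wnorm \<rho> (series_diff (series_add F G) p) < \<epsilon>" using C a(1) b(1) by blast
qed

lemma wclosure_smult:
  assumes F: "F \<in> wclosure A" and A: "A \<subseteq> free_hol H"
    and C: "\<And>a. a \<in> A \<Longrightarrow> series_smult c a \<in> C"
  shows "series_smult c F \<in> wclosure C"
  unfolding wclosure_def
proof (intro CollectI conjI allI impI)
  have FH: "F \<in> free_hol H" using F by (auto simp: wclosure_def)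
  then show "series_smult c F \<in> free_hol H" by (rule free_hol_smult)
  fix \<rho> \<epsilon> :: real assume \<rho>: "0 < \<rho>" "\<rho> < 1" and \<epsilon>: "0 < \<epsilon>"
  then have "0 < \<epsilon> / (cmod c + 1)" by (simp add: add_nonneg_pos)
  then obtain a where a: "a \<in> A" "wnorm \<rho> (series_diff F a) < \<epsilon> / (cmod c + 1)"
    using F \<rho> unfolding wclosure_def by blast
  have aH: "a \<in> free_hol H" using a A by blast
  have "series_diff (series_smult c F) (series_smult c a) = series_smult c (series_diff F a)"
    by (simp add: series_smult_def series_diff_def algebra_simps)
  then have "wnorm \<rho> (series_diff (series_smult c F) (series_smult c a)) = cmod c * wnorm \<rho> (series_diff F a)"
    by (simp add: wnorm_smult free_hol_diff FH aH \<rho>)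
  also have "\<dots> \<le> (cmod c + 1) * wnorm \<rho> (series_diff F a)"
    by (intro mult_right_mono wnorm_nonneg free_hol_diff FH aH \<rho>) simp
  also have "\<dots> < \<epsilon>"
    using a(2) by (subst (asm) pos_less_divide_eq) (simp_all add: add_nonneg_pos mult.commute)
  finally show "\<exists>p\<in>C. wnorm \<rho> (series_diff (series_smult c F) p) < \<epsilon>" using C a(1) by blast
qed

lemma wclosure_mult:
  assumes F: "F \<in> wclosure A" and G: "G \<in> wclosure B"
    and AB: "A \<subseteq> free_hol H" "B \<subseteq> free_hol H"
    and C: "\<And>a b. \<lbrakk>a \<in> A; b \<in> B\<rbrakk> \<Longrightarrow> series_mult a b \<in> C"
  shows "series_mult F G \<in> wclosure C"
  unfolding wclosure_def
proof (intro CollectI conjI allI impI)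
  have FH: "F \<in> free_hol H" and GH: "G \<in> free_hol H" using F G by (auto simp: wclosure_def)
  then show "series_mult F G \<in> free_hol H" by (rule free_hol_mult)
  fix \<rho> \<epsilon> :: real assume \<rho>: "0 < \<rho>" "\<rho> < 1" and \<epsilon>: "0 < \<epsilon>"
  \<comment> \<open>\<open>a\<close> is chosen first, so that the precision required of \<open>b\<close> may depend on it\<close>
  have g: "0 \<le> wnorm \<rho> G" by (intro wnorm_nonneg GH \<rho>)
  then have "0 < \<epsilon> / 2 / (wnorm \<rho> G + 1)" using \<epsilon> by simp
  then obtain a where a: "a \<in> A" "wnorm \<rho> (series_diff F a) < \<epsilon> / 2 / (wnorm \<rho> G + 1)"
    using F \<rho> unfolding wclosure_def by blast
  have aH: "a \<in> free_hol H" using a AB by blast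
  have wa: "0 \<le> wnorm \<rho> a" by (intro wnorm_nonneg aH \<rho>)
  then have "0 < \<epsilon> / 2 / (wnorm \<rho> a + 1)" using \<epsilon> by simp
  then obtain b where b: "b \<in> B" "wnorm \<rho> (series_diff G b) < \<epsilon> / 2 / (wnorm \<rho> a + 1)"
    using G \<rho> unfolding wclosure_def by blast
  have bH: "b \<in> free_hol H" using b AB by blast
  note dH = free_hol_diff [OF FH aH] free_hol_diff [OF GH bH]
  have "series_diff (series_mult F G) (series_mult a b)
      = series_add (series_mult (series_diff F a) G) (series_mult a (series_diff G b))"
    by (simp add: fun_eq_iff series_mult_eq series_add_def series_diff_def algebra_simps
        sum.distrib sum_subtractf)
  then have "wnorm \<rho> (series_diff (series_mult F G) (series_mult a b))
      \<le> wnorm \<rho> (series_mult (series_diff F a) G) + wnorm \<rho> (series_mult a (series_diff G b))"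
    by (simp add: wnorm_add_le free_hol_mult dH GH aH \<rho>)
  also have "\<dots> \<le> wnorm \<rho> (series_diff F a) * wnorm \<rho> G + wnorm \<rho> a * wnorm \<rho> (series_diff G b)"
    by (intro add_mono wnorm_mult_le dH GH aH \<rho>)
  also have "\<dots> \<le> wnorm \<rho> (series_diff F a) * (wnorm \<rho> G + 1)
      + (wnorm \<rho> a + 1) * wnorm \<rho> (series_diff G b)"
    by (intro add_mono mult_left_mono mult_right_mono wnorm_nonneg dH \<rho>) simp_all
  also have "\<dots> < \<epsilon> / 2 + \<epsilon> / 2"
    using a(2) b(2) g wa by (intro add_strict_mono) (simp_all add: field_simps)
  finally show "\<exists>p\<in>C. wnorm \<rho> (series_diff (series_mult F G) p) < \<epsilon>" using C a(1) b(1) by auto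
qed

end

section \<open>Cosets of closed ideals\<close>

definition series_subspace :: "'d free_series set \<Rightarrow> bool" where
  "series_subspace K \<longleftrightarrow> (\<lambda>_. 0) \<in> K \<and> (\<forall>F\<in>K. \<forall>G\<in>K. series_add F G \<in> K) \<and>
    (\<forall>c. \<forall>F\<in>K. series_smult c F \<in> K)"

lemma series_coset_iff: "X \<in> series_coset J F \<longleftrightarrow> series_diff X F \<in> J"
proof
  assume "series_diff X F \<in> J"
  moreover have "X = series_add F (series_diff X F)"
    by (simp add: fun_eq_iff series_add_def series_diff_def)
  ultimately show "X \<in> series_coset J F" unfolding series_coset_def by blast
next
  assume "X \<in> series_coset J F"
  then obtain j where "j \<in> J" "X = series_add F j" by (auto simp: series_coset_def)
  moreover have "series_diff (series_add F j) F = j"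
    by (simp add: fun_eq_iff series_add_def series_diff_def)
  ultimately show "series_diff X F \<in> J" by simp
qed

context
  fixes J :: "'d free_series set"
  assumes J: "series_subspace J"
begin

lemma series_subspace_add: "F \<in> J \<Longrightarrow> G \<in> J \<Longrightarrow> series_add F G \<in> J"
  and series_subspace_smult: "F \<in> J \<Longrightarrow> series_smult c F \<in> J"
  and series_subspace_zero: "(\<lambda>_. 0) \<in> J"
  using J by (auto simp: series_subspace_def)

lemma series_subspace_diff:
  assumes "F \<in> J" "G \<in> J" shows "series_diff F G \<in> J"
proof -
  have "series_diff F G = series_add F (series_smult (-1) G)"
    by (simp add: fun_eq_iff series_add_def series_diff_def series_smult_def)
  then show ?thesis using assms by (simp add: series_subspace_add series_subspace_smult)
qed

lemma series_coset_self: "F \<in> series_coset J F"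
  using series_subspace_zero by (simp add: series_coset_iff series_diff_def)

lemma series_coset_eq:
  assumes X: "X \<in> series_coset J F"
  shows "series_coset J X = series_coset J F"
proof (rule set_eqI)
  fix Y
  have d: "series_diff X F \<in> J" using X by (simp add: series_coset_iff)
  have "series_diff Y F = series_add (series_diff Y X) (series_diff X F)"
    "series_diff Y X = series_diff (series_diff Y F) (series_diff X F)"
    by (simp_all add: fun_eq_iff series_add_def series_diff_def)
  then show "Y \<in> series_coset J X \<longleftrightarrow> Y \<in> series_coset J F"
    unfolding series_coset_iff using d by (metis series_subspace_add series_subspace_diff)
qed

lemma quot_add_coset:
  "quot_add J (series_coset J F) (series_coset J G) = series_coset J (series_add F G)"
proof -
  have "series_coset J (series_add X Y) = series_coset J (series_add F G)"
    if XY: "X \<in> series_coset J F" "Y \<in> series_coset J G" for X Y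
  proof (rule series_coset_eq)
    have "series_diff (series_add X Y) (series_add F G) = series_add (series_diff X F) (series_diff Y G)"
      by (simp add: fun_eq_iff series_add_def series_diff_def)
    then show "series_add X Y \<in> series_coset J (series_add F G)"
      using XY by (simp add: series_coset_iff series_subspace_add)
  qed
  then show ?thesis
    unfolding quot_add_def using series_coset_self [of F] series_coset_self [of G] by blast
qed

lemma quot_smult_coset: "quot_smult J c (series_coset J F) = series_coset J (series_smult c F)"
proof -
  have "series_coset J (series_smult c X) = series_coset J (series_smult c F)"
    if X: "X \<in> series_coset J F" for X
  proof (rule series_coset_eq)
    have "series_diff (series_smult c X) (series_smult c F) = series_smult c (series_diff X F)"
      by (simp add: fun_eq_iff series_smult_def series_diff_def algebra_simps)
    then show "series_smult c X \<in> series_coset J (series_smult c F)"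
      using X by (simp add: series_coset_iff series_subspace_smult)
  qed
  then show ?thesis
    unfolding quot_smult_def using series_coset_self [of F] by blast
qed

end

context
  fixes H :: "'h::complex_hilbert itself"
  assumes H: "infinite_dimensional H"
begin

lemma wclosure_superset: "S \<subseteq> free_hol H \<Longrightarrow> S \<subseteq> wclosure H S"
  using closure_of_subset [of S "free_hol_topology H"]
  by (simp add: closure_of_eq_wclosure [OF H] topspace_free_hol [OF H])

text \<open>Translations are homeomorphisms.  Hence a coset of the closed ideal is the closure of a coset
  of polynomials, and products of such cosets reduce to products of polynomials.\<close>

lemma series_coset_wclosure:
  assumes K: "K \<subseteq> free_hol H" and F: "F \<in> free_hol H"
  shows "series_coset (wclosure H K) F = wclosure H (series_coset K F)"
proof (rule set_eqI)
  fix X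
  have "X = series_add (series_diff X F) F"
    by (simp add: fun_eq_iff series_add_def series_diff_def)
  then have 1: "series_diff X F \<in> free_hol H \<longleftrightarrow> X \<in> free_hol H"
    using free_hol_add [OF H _ F] free_hol_diff [OF H _ F] by metis
  have 2: "series_diff X (series_add F p) = series_diff (series_diff X F) p" for p
    by (simp add: fun_eq_iff series_add_def series_diff_def)
  show "X \<in> series_coset (wclosure H K) F \<longleftrightarrow> X \<in> wclosure H (series_coset K F)"
    unfolding series_coset_iff wclosure_def [OF H]
    by (simp add: 1 series_coset_def 2)
qed

lemma series_subspace_wclosure:
  assumes K: "K \<subseteq> free_hol H" "series_subspace K"
  shows "series_subspace (wclosure H K)"
  unfolding series_subspace_def
proof (intro conjI ballI allI)
  show "(\<lambda>_. 0) \<in> wclosure H K"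
    using wclosure_superset [OF K(1)] series_subspace_zero [OF K(2)] by blast
  show "series_add F G \<in> wclosure H K" if "F \<in> wclosure H K" "G \<in> wclosure H K" for F G
    using that by (rule wclosure_add [OF H _ _ K(1) K(1)]) (rule series_subspace_add [OF K(2)])
  show "series_smult c F \<in> wclosure H K" if "F \<in> wclosure H K" for c F
    using that by (rule wclosure_smult [OF H _ K(1)]) (rule series_subspace_smult [OF K(2)])
qed

lemma quot_mult_coset:
  assumes K: "K \<subseteq> free_hol H" "series_subspace K"
    and F: "F \<in> free_hol H" and G: "G \<in> free_hol H"
    and FK: "\<And>p. p \<in> K \<Longrightarrow> series_mult F p \<in> K" and KG: "\<And>p. p \<in> K \<Longrightarrow> series_mult p G \<in> K"
    and KK: "\<And>p q. p \<in> K \<Longrightarrow> q \<in> K \<Longrightarrow> series_mult p q \<in> K"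
  shows "quot_mult (wclosure H K) (series_coset (wclosure H K) F) (series_coset (wclosure H K) G)
    = series_coset (wclosure H K) (series_mult F G)"
proof -
  note J = series_subspace_wclosure [OF K]
  have sub: "series_coset K A \<subseteq> free_hol H" if "A \<in> free_hol H" for A
    using K(1) free_hol_add [OF H that] by (auto simp: series_coset_def)
  have "series_coset (wclosure H K) (series_mult X Y) = series_coset (wclosure H K) (series_mult F G)"
    if XY: "X \<in> series_coset (wclosure H K) F" "Y \<in> series_coset (wclosure H K) G" for X Y
  proof (rule series_coset_eq [OF J])
    have "series_mult X Y \<in> wclosure H (series_coset K (series_mult F G))"
    proof (rule wclosure_mult [OF H])
      show "X \<in> wclosure H (series_coset K F)" "Y \<in> wclosure H (series_coset K G)"
        using XY by (simp_all add: series_coset_wclosure K F G)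
      fix a b assume "a \<in> series_coset K F" "b \<in> series_coset K G"
      then obtain p q where pq: "p \<in> K" "q \<in> K" and ab: "a = series_add F p" "b = series_add G q"
        by (auto simp: series_coset_def)
      have "series_mult a b = series_add (series_mult F G)
          (series_add (series_mult F q) (series_add (series_mult p G) (series_mult p q)))"
        by (simp add: ab series_mult_add_left series_mult_add_right)
          (simp add: fun_eq_iff series_add_def)
      moreover have "series_add (series_mult F q) (series_add (series_mult p G) (series_mult p q)) \<in> K"
        using pq by (intro series_subspace_add [OF K(2)] FK KG KK)
      ultimately show "series_mult a b \<in> series_coset K (series_mult F G)"
        by (simp add: series_coset_def)
    qed (simp_all add: sub F G)
    then show "series_mult X Y \<in> series_coset (wclosure H K) (series_mult F G)"
      by (simp add: series_coset_wclosure K free_hol_mult [OF H] F G)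
  qed
  then show ?thesis
    unfolding quot_mult_def using series_coset_self [OF J, of F] series_coset_self [OF J, of G] by blast
qed

lemma finite_support_free_hol:
  assumes "finite {\<alpha>. F \<alpha> \<noteq> 0}"
  shows "F \<in> free_hol H"
  unfolding free_hol_iff [OF H]
proof (intro allI impI)
  fix \<rho> :: real
  have "hcomp k F = 0" if "k \<notin> length ` {\<alpha>. F \<alpha> \<noteq> 0}" for k
    by (rule l2_eqI) (use that in \<open>auto simp: l2_apply_hcomp zero_l2.rep_eq\<close>)
  then show "summable (\<lambda>k. \<rho> ^ k * norm (hcomp k F))"
    using assms by (intro summable_finite [of "length ` {\<alpha>. F \<alpha> \<noteq> 0}"]) auto
qed

end

section \<open>Polynomials and graded ideals\<close>

lemma finite_support_to_series: "finite {\<alpha>. to_series A \<alpha> \<noteq> 0}"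
proof -
  have "{\<alpha>. to_series A \<alpha> \<noteq> 0}
      = op_word creation -` {B. crepresentation (range (op_word creation)) A B \<noteq> 0}"
    by (auto simp: to_series_def)
  then show ?thesis
    by (simp only: finite_vimageI [OF complex_vector.finite_representation inj_op_word_creation])
qed

lemma l2_apply_Ev: "l2_apply (Ev A) = to_series A"
proof
  fix \<beta>
  have "l2_apply (Ev A) \<beta> = (\<Sum>\<alpha> | to_series A \<alpha> \<noteq> 0. if \<alpha> = \<beta> then to_series A \<alpha> else 0)"
    unfolding Ev_def l2_apply_sum
    by (intro sum.cong) (auto simp: scaleC_l2.rep_eq l2_basis.rep_eq)
  then show "l2_apply (Ev A) \<beta> = to_series A \<beta>"
    by (simp add: finite_support_to_series)
qed

lemma poly_alg_eq_span: "poly_alg = cspan (range (op_word creation))"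
proof
  let ?S = "cspan (range (op_word creation)) :: ('a fock \<Rightarrow>\<^sub>L 'a fock) set"
  have word: "op_word creation \<alpha> \<in> ?S" for \<alpha>
    by (intro complex_vector.span_base rangeI)
  have words: "op_word creation \<alpha> o\<^sub>L op_word creation \<beta> = op_word creation (\<alpha> @ \<beta>)" for \<alpha> \<beta> :: "'a list"
    by (rule blinfun_eqI) (induction \<alpha>, simp_all)
  have 1: "op_word creation \<alpha> o\<^sub>L b \<in> ?S" if "b \<in> ?S" for \<alpha> b
    using that
  proof (induction rule: complex_vector.span_induct_alt)
    case base
    then show ?case by (simp add: complex_vector.span_zero)
  next
    case (step c x y)
    then obtain \<beta> where "x = op_word creation \<beta>" by blast
    moreover have "op_word creation \<alpha> o\<^sub>L (c *\<^sub>C x + y)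
        = c *\<^sub>C (op_word creation \<alpha> o\<^sub>L x) + (op_word creation \<alpha> o\<^sub>L y)"
      by (rule blinfun_eqI)
        (simp add: blinfun.add_left blinfun.add_right scaleC_blinfun.rep_eq
          complex_linear_op_word complex_linear_creation)
    ultimately show ?case
      using step by (simp add: words word complex_vector.span_add complex_vector.span_scale)
  qed
  have "a o\<^sub>L b \<in> ?S" if "a \<in> ?S" "b \<in> ?S" for a b
    using that(1)
  proof (induction rule: complex_vector.span_induct_alt)
    case base
    then show ?case by (simp add: complex_vector.span_zero)
  next
    case (step c x y)
    moreover have "(c *\<^sub>C x + y) o\<^sub>L b = c *\<^sub>C (x o\<^sub>L b) + (y o\<^sub>L b)"
      by (rule blinfun_eqI) (simp add: blinfun.add_left scaleC_blinfun.rep_eq)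
    ultimately show ?case
      using 1 [OF that(2)] by (auto intro: complex_vector.span_add complex_vector.span_scale)
  qed
  moreover have "id_blinfun \<in> ?S" using word [of "[]"] by (simp add: op_word_def)
  ultimately have "unital_subalgebra ?S"
    by (simp add: unital_subalgebra_def complex_vector.subspace_span)
  moreover have "creation i \<in> ?S" for i
  proof -
    have "op_word creation [i] = creation i" by (rule blinfun_eqI) simp
    with word [of "[i]"] show ?thesis by simp
  qed
  ultimately show "poly_alg \<subseteq> ?S"
    unfolding poly_alg_def by (intro hull_minimal) auto
  have "op_word creation \<alpha> \<in> t" if "unital_subalgebra t" "range creation \<subseteq> t" for \<alpha> and t :: "('a fock \<Rightarrow>\<^sub>L 'a fock) set"
    using that by (induction \<alpha>) (auto simp: op_word_def unital_subalgebra_def)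
  moreover have "csubspace t" if "unital_subalgebra t" for t :: "('a fock \<Rightarrow>\<^sub>L 'a fock) set"
    using that by (simp add: unital_subalgebra_def)
  ultimately show "?S \<subseteq> poly_alg"
    unfolding poly_alg_def hull_def by (intro Inter_greatest complex_vector.span_minimal) auto
qed

lemma blinfun_apply_lincomb:
  "blinfun_apply (c *\<^sub>C A + B) f = c *\<^sub>C blinfun_apply A f + blinfun_apply B f"
  by (simp add: blinfun.add_left scaleC_blinfun.rep_eq)

text \<open>A word in the creation operators moves the vacuum vector to the basis vector of that word, so
  \<^const>\<open>Ev\<close> is evaluation at the vacuum.\<close>

lemma Ev_eq_vacuum:
  assumes "A \<in> poly_alg"
  shows "Ev A = A (l2_basis [])"
proof -
  have "A \<in> cspan (range (op_word creation)) \<and> l2_apply (A (l2_basis [])) = to_series A"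
    using assms unfolding poly_alg_eq_span
  proof (induction rule: complex_vector.span_induct_alt)
    case base
    show ?case
      by (simp add: fun_eq_iff to_series_def zero_l2.rep_eq complex_vector.span_zero
          complex_vector.representation_zero)
  next
    case (step c x y)
    then obtain \<beta> where x: "x = op_word creation \<beta>" by blast
    have xy: "x \<in> cspan (range (op_word creation))" "y \<in> cspan (range (op_word creation))"
      using step by (auto intro: complex_vector.span_base)
    then have "to_series (c *\<^sub>C x + y) \<alpha> = c * to_series x \<alpha> + to_series y \<alpha>" for \<alpha>
      unfolding to_series_def
      by (simp add: complex_vector.representation_add [OF independent_op_word_creation]
          complex_vector.representation_scale [OF independent_op_word_creation]
          complex_vector.span_scale)
    with step xy show ?case
      by (simp add: complex_vector.span_add complex_vector.span_scale
          fun_eq_iff blinfun_apply_lincomb plus_l2.rep_eq scaleC_l2.rep_eq x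
          op_word_creation_basis to_series_word l2_basis.rep_eq)
  qed
  then show ?thesis by (simp add: l2_apply_inject [symmetric] l2_apply_Ev)
qed

lemma series_mult_word:
  "series_mult (\<lambda>\<beta>. if \<beta> = \<alpha> then 1 else 0) G \<gamma> =
    (if take (length \<alpha>) \<gamma> = \<alpha> then G (drop (length \<alpha>) \<gamma>) else 0)"
proof -
  have "(\<Sum>i\<le>length \<gamma>. (if take i \<gamma> = \<alpha> then 1 else 0) * G (drop i \<gamma>))
      = (\<Sum>i\<le>length \<gamma>. if i = length \<alpha> then (if take i \<gamma> = \<alpha> then G (drop i \<gamma>) else 0) else 0)"
    by (rule sum.cong) auto
  also have "\<dots> = (if take (length \<alpha>) \<gamma> = \<alpha> then G (drop (length \<alpha>) \<gamma>) else 0)"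
    by auto
  finally show ?thesis by (simp add: series_mult_eq)
qed

lemma to_series_mult:
  assumes A: "A \<in> poly_alg" and B: "B \<in> poly_alg" and AB: "A o\<^sub>L B \<in> poly_alg"
  shows "to_series (A o\<^sub>L B) = series_mult (to_series A) (to_series B)"
proof -
  define f where "f = B (l2_basis [])"
  have "l2_apply (A f) = series_mult (l2_apply (A (l2_basis []))) (l2_apply f)"
    using A unfolding poly_alg_eq_span
  proof (induction rule: complex_vector.span_induct_alt)
    case base
    show ?case by (simp add: fun_eq_iff zero_l2.rep_eq series_mult_eq)
  next
    case (step c x y)
    then obtain \<beta> where x: "x = op_word creation \<beta>" by blast
    have "l2_apply (x f) = series_mult (l2_apply (x (l2_basis []))) (l2_apply f)"
      by (simp add: fun_eq_iff x op_word_creation_basis l2_basis.rep_eq series_mult_word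
          l2_apply_op_word_creation)
    moreover have "l2_apply (c *\<^sub>C g + h) = series_add (series_smult c (l2_apply g)) (l2_apply h)"
      for g h :: "'a fock"
      by (simp add: fun_eq_iff plus_l2.rep_eq scaleC_l2.rep_eq series_add_def series_smult_def)
    ultimately show ?case
      using step by (simp add: blinfun_apply_lincomb series_mult_add_left series_mult_smult_left)
  qed
  then show ?thesis
    by (simp add: f_def l2_apply_Ev [symmetric] Ev_eq_vacuum A B AB)
qed


lemma hcomp_poly_deg:
  fixes A :: "'d::finite fock \<Rightarrow>\<^sub>L 'd fock"
  assumes A: "A \<in> poly_deg k"
  shows "hcomp j (to_series A) = (if j = k then Ev A else 0)"
proof -
  have "poly_deg k \<subseteq> (poly_alg :: ('d fock \<Rightarrow>\<^sub>L 'd fock) set)"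
    unfolding poly_deg_def poly_alg_eq_span by (intro complex_vector.span_mono) auto
  then have AP: "A \<in> poly_alg" using A by blast
  have "l2_apply (A (l2_basis [])) \<gamma> = 0" if "length \<gamma> \<noteq> k" for \<gamma>
    using A unfolding poly_deg_def
  proof (induction rule: complex_vector.span_induct_alt)
    case base
    show ?case by (simp add: zero_l2.rep_eq)
  next
    case (step c x y)
    then show ?case using that
      by (auto simp: blinfun_apply_lincomb plus_l2.rep_eq scaleC_l2.rep_eq op_word_creation_basis
          l2_basis.rep_eq split: if_splits)
  qed
  then show ?thesis
    by (intro l2_eqI) (auto simp: l2_apply_hcomp l2_apply_Ev [symmetric] Ev_eq_vacuum AP zero_l2.rep_eq)
qed

context
  fixes I :: "('d::finite fock \<Rightarrow>\<^sub>L 'd fock) set"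
  assumes I: "graded_ideal I"
begin

lemma graded_ideal_poly: "A \<in> I \<Longrightarrow> A \<in> poly_alg"
  using I by (auto simp: graded_ideal_def two_sided_ideal_def)

lemma graded_ideal_subspace: "csubspace I"
  using I by (auto simp: graded_ideal_def two_sided_ideal_def)

lemma to_series_graded_ideal_mult:
  assumes A: "A \<in> poly_alg" and B: "B \<in> I"
  shows "series_mult (to_series A) (to_series B) \<in> to_series ` I"
    and "series_mult (to_series B) (to_series A) \<in> to_series ` I"
proof -
  have AB: "A o\<^sub>L B \<in> I" "B o\<^sub>L A \<in> I"
    using I A B by (auto simp: graded_ideal_def two_sided_ideal_def)
  then have "A o\<^sub>L B \<in> poly_alg" "B o\<^sub>L A \<in> poly_alg" by (simp_all add: graded_ideal_poly)
  then show "series_mult (to_series A) (to_series B) \<in> to_series ` I"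
    "series_mult (to_series B) (to_series A) \<in> to_series ` I"
    using AB to_series_mult A graded_ideal_poly [OF B] by (metis imageI)+
qed

lemma csubspace_Ev: "csubspace (Ev ` I)"
proof -
  have Ev: "Ev (c *\<^sub>C A + B) = c *\<^sub>C Ev A + Ev B" if "A \<in> I" "B \<in> I" for c A B
  proof -
    have "c *\<^sub>C A + B \<in> I"
      using that graded_ideal_subspace complex_vector.subspace_add complex_vector.subspace_scale by blast
    then show ?thesis
      using that by (simp add: Ev_eq_vacuum graded_ideal_poly blinfun_apply_lincomb)
  qed
  have "0 \<in> I" using graded_ideal_subspace by (rule complex_vector.subspace_0)
  have "c *\<^sub>C A + B \<in> I" if "A \<in> I" "B \<in> I" for c A B
    using that graded_ideal_subspace complex_vector.subspace_add complex_vector.subspace_scale by blast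
  then have lin: "c *\<^sub>C f + g \<in> Ev ` I" if fg: "f \<in> Ev ` I" "g \<in> Ev ` I" for c f g
  proof -
    obtain A B where AB: "A \<in> I" "f = Ev A" "B \<in> I" "g = Ev B" using fg by blast
    then have "c *\<^sub>C f + g = Ev (c *\<^sub>C A + B)" by (simp add: Ev)
    with \<open>\<And>c A B. \<lbrakk>A \<in> I; B \<in> I\<rbrakk> \<Longrightarrow> c *\<^sub>C A + B \<in> I\<close> [OF AB(1,3)] show ?thesis by blast
  qed
  have 0: "0 \<in> Ev ` I"
    using \<open>0 \<in> I\<close> Ev_eq_vacuum [OF graded_ideal_poly [OF \<open>0 \<in> I\<close>]] by (metis blinfun.zero_left imageI)
  show ?thesis
    unfolding complex_vector.subspace_def
  proof (intro conjI ballI allI)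
    show "f + g \<in> Ev ` I" if "f \<in> Ev ` I" "g \<in> Ev ` I" for f g
      using lin [OF that, of 1] by simp
    show "c *\<^sub>C f \<in> Ev ` I" if "f \<in> Ev ` I" for c f
      using lin [OF that 0, of c] by simp
  qed (rule 0)
qed

lemma to_series_graded_ideal: "to_series ` I = l2_apply ` Ev ` I"
  by (simp add: image_image l2_apply_Ev)

lemma series_subspace_to_series: "series_subspace (to_series ` I)"
  unfolding series_subspace_def to_series_graded_ideal
proof (intro conjI ballI allI)
  have "l2_apply 0 \<in> l2_apply ` Ev ` I"
    using csubspace_Ev complex_vector.subspace_0 by blast
  then show "(\<lambda>_. 0) \<in> l2_apply ` Ev ` I" by (simp add: zero_l2.rep_eq)
  show "series_add F G \<in> l2_apply ` Ev ` I"
    if FG: "F \<in> l2_apply ` Ev ` I" "G \<in> l2_apply ` Ev ` I" for F G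
  proof -
    obtain f g where fg: "f \<in> Ev ` I" "F = l2_apply f" "g \<in> Ev ` I" "G = l2_apply g"
      using FG by blast
    then have "f + g \<in> Ev ` I" using csubspace_Ev complex_vector.subspace_add by blast
    moreover have "series_add F G = l2_apply (f + g)"
      by (simp add: fg series_add_def plus_l2.rep_eq)
    ultimately show ?thesis by blast
  qed
  show "series_smult c F \<in> l2_apply ` Ev ` I" if F: "F \<in> l2_apply ` Ev ` I" for c F
  proof -
    obtain f where f: "f \<in> Ev ` I" "F = l2_apply f" using F by blast
    then have "c *\<^sub>C f \<in> Ev ` I" using csubspace_Ev complex_vector.subspace_scale by blast
    moreover have "series_smult c F = l2_apply (c *\<^sub>C f)"
      by (simp add: f series_smult_def scaleC_l2.rep_eq)
    ultimately show ?thesis by blast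
  qed
qed

text \<open>The components in the grading of \<open>I\<close> have their coefficients on words of different lengths, so the degree
  projections map \<open>Ev(I)\<close> to itself.  The grading starts in degree \<open>1\<close>, which excludes
  constants.\<close>

lemma hcomp_graded_ideal:
  assumes f: "f \<in> Ev ` I"
  shows "hcomp k (l2_apply f) \<in> Ev ` I" and "hcomp 0 (l2_apply f) = 0"
proof -
  obtain J where J: "\<And>k. k \<ge> 1 \<Longrightarrow> csubspace (J k) \<and> J k \<subseteq> poly_deg k"
    and IJ: "I = {\<Sum>k=1..n. a k |n a. \<forall>k\<in>{1..n}. a k \<in> J k}"
    using I unfolding graded_ideal_def by auto
  have J_sub: "B \<in> I" if k: "k \<ge> 1" and B: "B \<in> J k" for k B
  proof -
    have "(if m = k then B else 0) \<in> J m" if "m \<in> {1..k}" for m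
      using that B J [of m] complex_vector.subspace_0 by auto
    then have "(\<Sum>m=1..k. if m = k then B else 0) \<in> I" unfolding IJ by blast
    moreover have "(\<Sum>m=1..k. if m = k then B else 0) = B" using k by simp
    ultimately show ?thesis by simp
  qed
  obtain A where A: "A \<in> I" "f = Ev A" using f by blast
  from A(1) have "A \<in> {\<Sum>k=1..n. a k |n a. \<forall>k\<in>{1..n}. a k \<in> J k}" by (simp only: IJ)
  then obtain n a where a: "\<forall>k\<in>{1..n}. a k \<in> J k" and sum: "A = (\<Sum>k=1..n. a k)"
    by blast
  have aI: "a k \<in> I" if "k \<in> {1..n}" for k using J_sub a that by auto
  have "f = (\<Sum>m=1..n. Ev (a m))"
    using A aI by (simp add: Ev_eq_vacuum graded_ideal_poly)
      (simp add: sum blinfun.sum_left)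
  then have "hcomp j (l2_apply f) = (\<Sum>m=1..n. hcomp j (l2_apply (Ev (a m))))" for j
    by (simp add: linear_sum [OF bounded_linear.linear [OF bounded_linear_hcomp]])
  also have "(\<Sum>m=1..n. hcomp j (l2_apply (Ev (a m)))) = (\<Sum>m=1..n. if m = j then Ev (a j) else 0)" for j
  proof (rule sum.cong)
    fix m assume m: "m \<in> {1..n}"
    then have "a m \<in> poly_deg m" using a J [of m] by auto
    then show "hcomp j (l2_apply (Ev (a m))) = (if m = j then Ev (a j) else 0)"
      by (simp add: l2_apply_Ev hcomp_poly_deg)
  qed simp
  finally have h: "hcomp j (l2_apply f) = (if j \<in> {1..n} then Ev (a j) else 0)" for j
    by simp
  show "hcomp k (l2_apply f) \<in> Ev ` I"
    using aI complex_vector.subspace_0 [OF csubspace_Ev] by (simp add: h)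
  show "hcomp 0 (l2_apply f) = 0" by (simp add: h)
qed

end

section \<open>The projection onto the complement of an ideal\<close>

lemma csubspace_orthogonal_compl: "csubspace (orthogonal_compl (L :: 'h::complex_hilbert set))"
  by (simp add: complex_vector.subspace_def orthogonal_compl_def cinner_zero_right cinner_add_right
      cinner_scaleC_right)

lemma orthogonal_compl_closure:
  assumes v: "v \<in> orthogonal_compl L" and m: "m \<in> closure L"
  shows "inner m (v :: 'h::complex_hilbert) = 0"
proof -
  have "closure L \<subseteq> {m. inner m v = 0}"
  proof (rule closure_minimal)
    show "L \<subseteq> {m. inner m v = 0}" using v by (auto simp: orthogonal_compl_def inner_eq_Re_cinner)
    show "closed {m. inner m v = 0}" by (intro closed_Collect_eq continuous_intros)
  qed
  with m show ?thesis by blast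
qed

context
  fixes L :: "'h::complex_hilbert set"
  assumes L: "csubspace L"
begin

lemma real_subspace_closure:
  shows "subspace (closure L)"
proof -
  have sub: "subspace L"
    using L by (auto simp: subspace_def complex_vector.subspace_def simp flip: scaleC_of_real)
  show ?thesis unfolding subspace_def
  proof (intro conjI ballI allI)
    show "0 \<in> closure L" using subspace_0 [OF sub] closure_subset by blast
    show "x + y \<in> closure L" if xy: "x \<in> closure L" "y \<in> closure L" for x y
    proof -
      obtain u v where "\<And>n. u n \<in> L" "u \<longlonglongrightarrow> x" "\<And>n. v n \<in> L" "v \<longlonglongrightarrow> y"
        using xy unfolding closure_sequential by blast
      then have "\<forall>n. u n + v n \<in> L" "(\<lambda>n. u n + v n) \<longlonglongrightarrow> x + y"
        by (auto intro: subspace_add [OF sub] tendsto_add)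
      then show ?thesis
        unfolding closure_sequential by (intro exI [of _ "\<lambda>n. u n + v n"] conjI)
    qed
    show "c *\<^sub>R x \<in> closure L" if "x \<in> closure L" for c x
      using closure_bounded_linear_image_subset [OF bounded_linear_scaleR_right [of c], of L] that
        closure_mono [of "(*\<^sub>R) c ` L" L] subspace_scale [OF sub] by blast
  qed
qed

lemma orthogonal_decomposition_unique:
  assumes "a \<in> orthogonal_compl L" "f - a \<in> closure L" "b \<in> orthogonal_compl L" "f - b \<in> closure L"
  shows "a = b"
proof -
  have "a - b \<in> orthogonal_compl L"
    by (intro complex_vector.subspace_diff csubspace_orthogonal_compl assms)
  moreover have "(f - b) - (f - a) \<in> closure L"
    by (intro subspace_diff real_subspace_closure assms)
  ultimately have "inner ((f - b) - (f - a)) (a - b) = 0" by (rule orthogonal_compl_closure)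
  then show ?thesis by simp
qed

text \<open>The foot of the perpendicular on \<open>closure L\<close> splits \<open>f\<close>.  Uniqueness of the splitting makes it linear
  in \<open>f\<close>, and identifies it with the projection that \<^const>\<open>orthogonal_proj\<close> denotes.\<close>

lemma orthogonal_proj_compl:
  shows orthogonal_proj_in: "orthogonal_proj (orthogonal_compl L) f \<in> orthogonal_compl L"
    and orthogonal_proj_diff: "f - orthogonal_proj (orthogonal_compl L) f \<in> closure L"
proof -
  define V where "V = orthogonal_compl L"
  have "\<exists>q. q \<in> V \<and> f - q \<in> closure L" for f
  proof -
    obtain p where p: "p \<in> closure L" "\<And>m. m \<in> closure L \<Longrightarrow> inner m (f - p) = 0"
      by (rule closed_subspace_foot [OF real_subspace_closure closed_closure, of f]) blast
    have "cinner y (f - p) = 0" if y: "y \<in> L" for y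
    proof -
      have "\<i> *\<^sub>C y \<in> L" using L y by (rule complex_vector.subspace_scale)
      then have "cinner y (f - p) = cinner y 0"
        using p(2) closure_subset y by (intro cinner_eqI) auto
      then show ?thesis by (simp add: cinner_zero_right)
    qed
    then have "f - p \<in> V" by (simp add: V_def orthogonal_compl_def)
    then show ?thesis using p(1) by (intro exI [of _ "f - p"]) simp
  qed
  then obtain q where q: "\<And>f. q f \<in> V" "\<And>f. f - q f \<in> closure L" by metis
  have unique: "q f = a" if "a \<in> V" "f - a \<in> closure L" for f a
    using orthogonal_decomposition_unique [of "q f" f a] q [of f] that by (simp add: V_def)
  have "bounded_linear q"
  proof (rule bounded_linear_intro [where K = 1])
    have V: "subspace V"
      using csubspace_orthogonal_compl [of L]
      by (auto simp: V_def subspace_def complex_vector.subspace_def simp flip: scaleC_of_real)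
    show "q (f + g) = q f + q g" for f g
    proof (rule unique)
      show "q f + q g \<in> V" by (intro subspace_add V q)
      have "(f - q f) + (g - q g) \<in> closure L" by (intro subspace_add real_subspace_closure q)
      then show "f + g - (q f + q g) \<in> closure L" by (simp add: algebra_simps)
    qed
    show "q (c *\<^sub>R f) = c *\<^sub>R q f" for c f
    proof (rule unique)
      show "c *\<^sub>R q f \<in> V" by (intro subspace_scale V q)
      have "c *\<^sub>R (f - q f) \<in> closure L" by (intro subspace_scale real_subspace_closure q)
      then show "c *\<^sub>R f - c *\<^sub>R q f \<in> closure L" by (simp add: scaleR_diff_right)
    qed
    show "norm (q f) \<le> norm f * 1" for f
    proof -
      have "inner (f - q f) (q f) = 0"
        using q [of f] orthogonal_compl_closure [of "q f" L "f - q f"] by (simp add: V_def)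
      then have "norm (q f) * norm (q f) = inner f (q f)"
        by (simp add: inner_diff_left power2_norm_eq_inner [symmetric] power2_eq_square)
      also have "\<dots> \<le> norm f * norm (q f)" by (rule norm_cauchy_schwarz)
      finally show ?thesis by (cases "q f = 0") auto
    qed
  qed
  then have Bq: "blinfun_apply (Blinfun q) = q" by (simp add: bounded_linear_Blinfun_apply)
  have compl: "f - q f \<in> orthogonal_compl V" for f
  proof -
    have "cinner y (f - q f) = 0" if y: "y \<in> V" for y
    proof -
      have "\<i> *\<^sub>C y \<in> V"
        using csubspace_orthogonal_compl y unfolding V_def by (rule complex_vector.subspace_scale)
      then have "cinner y (f - q f) = cinner y 0"
        using orthogonal_compl_closure [of _ L "f - q f"] q(2) [of f] y
        by (intro cinner_eqI) (simp_all add: V_def inner_commute)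
      then show ?thesis by (simp add: cinner_zero_right)
    qed
    then show ?thesis by (simp add: orthogonal_compl_def)
  qed
  have "orthogonal_proj V = Blinfun q"
    unfolding orthogonal_proj_def
  proof (rule the_equality)
    show "\<forall>x. Blinfun q x \<in> V \<and> x - Blinfun q x \<in> orthogonal_compl V"
      by (simp add: Bq q compl)
    fix R :: "'h \<Rightarrow>\<^sub>L 'h" assume R: "\<forall>x. R x \<in> V \<and> x - R x \<in> orthogonal_compl V"
    show "R = Blinfun q"
    proof (rule blinfun_eqI)
      fix f
      define d where "d = R f - q f"
      have "d \<in> V" unfolding d_def V_def
        using R q by (intro complex_vector.subspace_diff csubspace_orthogonal_compl) (auto simp: V_def)
      moreover have "d = (f - q f) - (f - R f)" by (simp add: d_def)
      then have "d \<in> orthogonal_compl V"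
        using R compl complex_vector.subspace_diff [OF csubspace_orthogonal_compl] by metis
      ultimately have "inner d d = 0" by (simp add: orthogonal_compl_def inner_eq_Re_cinner)
      then show "R f = Blinfun q f" by (simp add: Bq d_def)
    qed
  qed
  then show "orthogonal_proj (orthogonal_compl L) f \<in> orthogonal_compl L"
    "f - orthogonal_proj (orthogonal_compl L) f \<in> closure L"
    using q by (simp_all add: Bq V_def [symmetric])
qed

lemma orthogonal_proj_unique:
  "a \<in> orthogonal_compl L \<Longrightarrow> f - a \<in> closure L \<Longrightarrow> orthogonal_proj (orthogonal_compl L) f = a"
  using orthogonal_decomposition_unique [OF orthogonal_proj_in orthogonal_proj_diff] .

lemma inner_orthogonal_proj:
  "inner (orthogonal_proj (orthogonal_compl L) f) g =
    inner (orthogonal_proj (orthogonal_compl L) f) (orthogonal_proj (orthogonal_compl L) g)"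
proof -
  let ?p = "orthogonal_proj (orthogonal_compl L)"
  have "inner (g - ?p g) (?p f) = 0"
    by (rule orthogonal_compl_closure [OF orthogonal_proj_in orthogonal_proj_diff])
  then show ?thesis
    by (simp only: inner_commute [of "g - ?p g" "?p f"] inner_diff_right right_minus_eq)
qed

lemma norm_orthogonal_proj_le: "norm (orthogonal_proj (orthogonal_compl L) f) \<le> norm f"
proof -
  let ?p = "orthogonal_proj (orthogonal_compl L) f"
  have "norm ?p * norm ?p = inner ?p f"
    by (subst inner_orthogonal_proj) (simp add: power2_norm_eq_inner [symmetric] power2_eq_square)
  also have "\<dots> \<le> norm ?p * norm f" by (rule norm_cauchy_schwarz)
  finally show ?thesis by (cases "?p = 0") auto
qed

lemma norm_orthogonal_proj_le_dist:
  assumes "g \<in> closure L"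
  shows "norm (orthogonal_proj (orthogonal_compl L) f) \<le> norm (f - g)"
proof -
  let ?p = "orthogonal_proj (orthogonal_compl L) f"
  have "(f - ?p) - g \<in> closure L"
    by (intro subspace_diff real_subspace_closure orthogonal_proj_diff assms)
  then have "f - g - ?p \<in> closure L" by (simp add: algebra_simps)
  then have "orthogonal_proj (orthogonal_compl L) (f - g) = ?p"
    by (intro orthogonal_proj_unique orthogonal_proj_in)
  then show ?thesis using norm_orthogonal_proj_le [of "f - g"] by simp
qed

end

section \<open>The quotient seminorm of homogeneous polynomials\<close>

text \<open>The degree projections are self-adjoint.\<close>

lemma cinner_hcomp:
  "cinner f (hcomp k (l2_apply g)) = cinner (hcomp k (l2_apply f)) (g :: 'd::finite fock)"
  unfolding cinner_l2_def l2_cinner_def by (intro infsum_cong) (simp add: l2_apply_hcomp)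

lemma cinner_zero_left: "cinner 0 (x :: 'h::complex_hilbert) = 0"
  by (subst cinner_commute) (simp add: cinner_zero_right)

context
  fixes I :: "('d::finite fock \<Rightarrow>\<^sub>L 'd fock) set"
  assumes I: "graded_ideal I"
begin

text \<open>The degree projection preserves both \<open>Ev(I)\<close> and its complement, so it maps the orthogonal splitting of
  \<open>f\<close> to the orthogonal splitting of its degree \<open>k\<close> part.\<close>

lemma hcomp_ideal_proj:
  assumes f: "hcomp k (l2_apply f) = f"
  shows "hcomp k (l2_apply (ideal_proj I f)) = ideal_proj I f"
proof -
  let ?L = "Ev ` I" and ?Q = "\<lambda>f. hcomp k (l2_apply f)"
  note L = csubspace_Ev [OF I]
  have P: "ideal_proj I f \<in> orthogonal_compl ?L"
    unfolding ideal_proj_def by (rule orthogonal_proj_in [OF L])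
  have "cinner y (?Q (ideal_proj I f)) = 0" if "y \<in> ?L" for y
    using P hcomp_graded_ideal(1) [OF I that] unfolding cinner_hcomp orthogonal_compl_def by blast
  then have "?Q (ideal_proj I f) \<in> orthogonal_compl ?L" by (simp add: orthogonal_compl_def)
  moreover have "?Q ` closure ?L \<subseteq> closure ?L"
    using closure_bounded_linear_image_subset [OF bounded_linear_hcomp [of k], of ?L]
      closure_mono [of "?Q ` ?L" ?L] hcomp_graded_ideal(1) [OF I] by blast
  then have "?Q (f - ideal_proj I f) \<in> closure ?L"
    using orthogonal_proj_diff [OF L, of f] unfolding ideal_proj_def by blast
  then have "f - ?Q (ideal_proj I f) \<in> closure ?L"
    by (simp add: linear_diff [OF bounded_linear.linear [OF bounded_linear_hcomp]] f)
  ultimately have "orthogonal_proj (orthogonal_compl ?L) f = ?Q (ideal_proj I f)"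
    by (rule orthogonal_proj_unique [OF L])
  then show ?thesis by (simp only: ideal_proj_def)
qed

text \<open>Graded ideals contain no constants, so vectors of degree \<open>0\<close> are orthogonal to \<open>Ev(I)\<close>.\<close>

lemma ideal_proj_vacuum:
  assumes f: "hcomp 0 (l2_apply f) = f"
  shows "ideal_proj I f = f"
  unfolding ideal_proj_def
proof (rule orthogonal_proj_unique [OF csubspace_Ev [OF I]])
  have "cinner y f = 0" if "y \<in> Ev ` I" for y
    using cinner_hcomp [of y 0 f] hcomp_graded_ideal(2) [OF I that] by (simp add: f cinner_zero_left)
  then show "f \<in> orthogonal_compl (Ev ` I)" by (simp add: orthogonal_compl_def)
  show "f - f \<in> closure (Ev ` I)"
    using subsetD [OF closure_subset complex_vector.subspace_0 [OF csubspace_Ev [OF I]]] by simp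
qed

end

context
  fixes H :: "'h::complex_hilbert itself"
  assumes H: "infinite_dimensional H"
begin

lemma to_series_free_hol: "to_series A \<in> free_hol H"
  by (rule finite_support_free_hol [OF H finite_support_to_series])

lemma ideal_closure_eq: "ideal_closure H I = wclosure H (to_series ` I)"
  unfolding ideal_closure_def by (rule closure_of_eq_wclosure [OF H]) (auto simp: to_series_free_hol)

lemma hcomp_le_wnorm:
  assumes "F \<in> free_hol H" "0 < \<rho>" "\<rho> < 1"
  shows "\<rho> ^ k * norm (hcomp k F) \<le> wnorm \<rho> F"
  using sum_le_suminf [OF summable_wnorm [OF H assms], of "{k}"] assms(2) by (simp add: wnorm_def)

lemma hcomp_wclosure:
  assumes I: "graded_ideal I" and D: "D \<in> wclosure H (to_series ` I)"
  shows "hcomp k D \<in> closure (Ev ` I)"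
  unfolding closure_approachable
proof (intro allI impI)
  fix e :: real assume "0 < e"
  then have "0 < e * (1/2) ^ k" by simp
  moreover have "(0::real) < 1/2" "(1/2::real) < 1" by simp_all
  ultimately obtain p where p: "p \<in> to_series ` I" "wnorm (1/2) (series_diff D p) < e * (1/2) ^ k"
    using D unfolding wclosure_def [OF H] by blast
  have DH: "D \<in> free_hol H" using D by (simp add: wclosure_def [OF H])
  obtain A where A: "A \<in> I" "p = to_series A" using p by blast
  then have "(1/2) ^ k * norm (hcomp k D - hcomp k p) \<le> wnorm (1/2) (series_diff D p)"
    using hcomp_le_wnorm [OF free_hol_diff [OF H DH], of p "1/2" k] A
    by (simp add: hcomp_diff to_series_free_hol)
  also have "\<dots> < (1/2) ^ k * e" using p(2) by (simp only: mult.commute)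
  finally have "norm (hcomp k D - hcomp k p) < e" by (rule mult_left_less_imp_less) simp
  moreover have "hcomp k p \<in> Ev ` I"
    using hcomp_graded_ideal(1) [OF I, of "Ev A" k] A by (simp add: l2_apply_Ev)
  ultimately show "\<exists>y\<in>Ev ` I. dist y (hcomp k D) < e"
    by (auto simp: dist_norm norm_minus_commute)
qed

text \<open>Both sides measure the distance from \<open>f\<close> to the degree \<open>k\<close> part of \<open>Ev(I)\<close>.  For the upper bound,
  near-optimal vectors of \<open>Ev(I)\<close> may be taken of degree \<open>k\<close>, and \<open>\<parallel>_\<parallel>\<^sub>r\<close> of a homogeneous series is
  at most \<open>r\<^sup>k\<close> times its coefficient norm.  For the lower bound, the degree \<open>k\<close> component of any
  representative differs from \<open>f\<close> by an element of the closure of \<open>Ev(I)\<close>.\<close>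

lemma quot_seminorm_homogeneous:
  assumes I: "graded_ideal I" and r: "0 < r" "r < 1" and f: "hcomp k (l2_apply f) = f"
  shows "quot_seminorm H (ideal_closure H I) r (series_coset (ideal_closure H I) (l2_apply f))
    = r ^ k * norm (ideal_proj I f)"
proof -
  define J where "J = wclosure H (to_series ` I)"
  define S where "S = {F \<in> free_hol H. series_coset J F = series_coset J (l2_apply f)}"
  let ?L = "Ev ` I"
  note L = csubspace_Ev [OF I]
  have K: "to_series ` I \<subseteq> free_hol H" by (auto simp: to_series_free_hol)
  have J: "series_subspace J"
    unfolding J_def by (rule series_subspace_wclosure [OF H K series_subspace_to_series [OF I]])
  have hom: "hcomp j (l2_apply g) = (if j = k then g else 0)" if "hcomp k (l2_apply g) = g" for g j
    using hcomp_hcomp [of j k "l2_apply g"] that by simp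
  have free: "l2_apply g \<in> free_hol H" if "hcomp k (l2_apply g) = g" for g :: "'a fock"
  proof (rule finite_support_free_hol [OF H finite_subset])
    show "{\<alpha>. l2_apply g \<alpha> \<noteq> 0} \<subseteq> {\<alpha>. length \<alpha> = k}"
      using l2_apply_hcomp [of k "l2_apply g"] that by (metis (mono_tags, lifting) Collect_mono)
  qed (rule finite_words)
  have wnorm: "wnorm r (l2_apply g) = r ^ k * norm g" if "hcomp k (l2_apply g) = g" for g :: "'a fock"
  proof -
    have "(\<lambda>j. r ^ j * norm (hcomp j (l2_apply g))) = (\<lambda>j. if j = k then r ^ k * norm g else 0)"
      by (auto simp: hom [OF that])
    then show ?thesis
      using sums_single [of k "\<lambda>_. r ^ k * norm g"] by (simp add: wnorm_def sums_iff)
  qed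
  have "Inf (free_norm H r ` S) = r ^ k * norm (ideal_proj I f)"
  proof (rule antisym)
    have bdd: "bdd_below (free_norm H r ` S)"
      by (rule bdd_belowI2 [where m = 0]) (auto simp: S_def intro: free_norm_nonneg [OF H _ r])
    show "Inf (free_norm H r ` S) \<le> r ^ k * norm (ideal_proj I f)"
    proof (rule field_le_epsilon)
      fix e :: real assume "0 < e"
      then have "0 < e / r ^ k" using r by simp
      then obtain g where g: "g \<in> ?L" "norm (f - ideal_proj I f - g) < e / r ^ k"
        using orthogonal_proj_diff [OF L, of f] unfolding ideal_proj_def closure_approachable
        by (metis dist_commute dist_norm)
      define h where "h = f - hcomp k (l2_apply g)"
      have lin: "linear (\<lambda>f. hcomp k (l2_apply f))" by (rule bounded_linear.linear [OF bounded_linear_hcomp])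
      have h: "hcomp k (l2_apply h) = h"
        by (simp add: h_def linear_diff [OF lin] f hcomp_hcomp)
      have "h - ideal_proj I f = hcomp k (l2_apply (f - ideal_proj I f - g))"
        by (simp add: h_def linear_diff [OF lin] f hcomp_ideal_proj [OF I f])
      then have "norm (h - ideal_proj I f) \<le> e / r ^ k"
        using norm_hcomp_le [of k "f - ideal_proj I f - g"] g(2) by simp
      then have nh: "norm h \<le> norm (ideal_proj I f) + e / r ^ k"
        using norm_triangle_ineq [of "ideal_proj I f" "h - ideal_proj I f"] by simp
      have "series_diff (l2_apply h) (l2_apply f) \<in> J"
      proof -
        have "- hcomp k (l2_apply g) \<in> ?L"
          by (intro complex_vector.subspace_neg L hcomp_graded_ideal(1) [OF I] g)
        moreover have "series_diff (l2_apply h) (l2_apply f) = l2_apply (- hcomp k (l2_apply g))"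
          by (simp add: h_def series_diff_def fun_eq_iff minus_l2.rep_eq uminus_l2.rep_eq)
        ultimately have "series_diff (l2_apply h) (l2_apply f) \<in> to_series ` I"
          by (simp only: to_series_graded_ideal [OF I] imageI)
        then show ?thesis unfolding J_def using wclosure_superset [OF H K] by blast
      qed
      then have "l2_apply h \<in> S"
        using series_coset_eq [OF J] free [OF h] by (simp add: S_def series_coset_iff)
      then have "Inf (free_norm H r ` S) \<le> free_norm H r (l2_apply h)"
        using bdd by (intro cINF_lower)
      also have "\<dots> \<le> r ^ k * norm h"
        using free_norm_le_wnorm [OF H free [OF h] r] by (simp add: wnorm [OF h])
      also have "\<dots> \<le> r ^ k * (norm (ideal_proj I f) + e / r ^ k)"
        using nh r by (intro mult_left_mono) auto
      also have "\<dots> = r ^ k * norm (ideal_proj I f) + e" using r by (simp add: field_simps)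
      finally show "Inf (free_norm H r ` S) \<le> r ^ k * norm (ideal_proj I f) + e" .
    qed
    show "r ^ k * norm (ideal_proj I f) \<le> Inf (free_norm H r ` S)"
    proof (rule cINF_greatest)
      show "S \<noteq> {}" using free [OF f] by (auto simp: S_def)
      fix F assume F: "F \<in> S"
      then have "series_diff F (l2_apply f) \<in> J"
        using series_coset_self [OF J, of F] by (simp add: S_def series_coset_iff)
      then have "hcomp k F - f \<in> closure ?L"
        using hcomp_wclosure [OF I] unfolding J_def by (metis hcomp_diff f)
      then have "f - hcomp k F \<in> closure ?L"
        using subspace_neg [OF real_subspace_closure [OF L]] by (metis minus_diff_eq)
      then have "norm (ideal_proj I f) \<le> norm (hcomp k F)"
        using norm_orthogonal_proj_le_dist [OF L, of "f - hcomp k F" f] by (simp add: ideal_proj_def)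
      then have "r ^ k * norm (ideal_proj I f) \<le> r ^ k * norm (hcomp k F)"
        using r by (intro mult_left_mono) auto
      also have "\<dots> \<le> free_norm H r F"
        using F by (intro hcomp_le_free_norm [OF H _ r]) (simp add: S_def)
      finally show "r ^ k * norm (ideal_proj I f) \<le> free_norm H r F" .
    qed
  qed
  then show ?thesis by (simp add: quot_seminorm_def ideal_closure_eq S_def J_def)
qed

end

section \<open>Continuity\<close>

lemma continuous_map_euclidean_iff:
  fixes g :: "'x \<Rightarrow> 'a::metric_space"
  shows "continuous_map X euclidean g \<longleftrightarrow>
    (\<forall>x\<in>topspace X. \<forall>\<epsilon>>0. \<exists>U. openin X U \<and> x \<in> U \<and> (\<forall>y\<in>U. dist (g y) (g x) < \<epsilon>))"
  using Met_TC.continuous_map_to_metric [of X g] by (simp add: dist_commute)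

text \<open>For projections the polarization identity turns the norms \<open>\<parallel>P\<^sub>y (f \<plusminus> w)\<parallel>\<close> into
  \<open>\<langle>P\<^sub>y f, w\<rangle>\<close>, and with \<open>w = P\<^sub>x f\<close> these determine the distance from \<open>P\<^sub>y f\<close> to \<open>P\<^sub>x f\<close>.\<close>

lemma continuous_map_projections:
  fixes P :: "'x \<Rightarrow> 'a::real_inner \<Rightarrow>\<^sub>L 'a"
  assumes proj: "\<And>x f g. x \<in> topspace X \<Longrightarrow> inner (P x f) g = inner (P x f) (P x g)"
    and M: "subspace M" "\<And>x f. x \<in> topspace X \<Longrightarrow> f \<in> M \<Longrightarrow> P x f \<in> M"
    and cont: "\<And>f. f \<in> M \<Longrightarrow> continuous_map X euclideanreal (\<lambda>x. norm (P x f))"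
    and f: "f \<in> M"
  shows "continuous_map X euclidean (\<lambda>x. P x f)"
  unfolding continuous_map_euclidean_iff
proof (intro ballI allI impI)
  fix x and \<epsilon> :: real assume x: "x \<in> topspace X" and \<epsilon>: "0 < \<epsilon>"
  define w where "w = P x f"
  define D where "D y = (norm (P y f))\<^sup>2 
      - (1/2) * ((norm (P y (f + w)))\<^sup>2 - (norm (P y (f - w)))\<^sup>2) + (norm w)\<^sup>2" for y
  have w: "w \<in> M" unfolding w_def by (rule M(2) [OF x f])
  have D: "D y = (dist (P y f) w)\<^sup>2" if y: "y \<in> topspace X" for y
  proof -
    have "(norm (P y (f + w)))\<^sup>2 - (norm (P y (f - w)))\<^sup>2 = 4 * inner (P y f) (P y w)"
      by (simp add: power2_norm_eq_inner blinfun.add_right blinfun.diff_right inner_add inner_diff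
          inner_commute)
    also have "\<dots> = 4 * inner (P y f) w" by (simp only: proj [OF y, of f w])
    finally show ?thesis
      by (simp add: D_def dist_norm power2_norm_eq_inner inner_diff inner_commute)
  qed
  have "continuous_map X euclideanreal D"
    unfolding D_def using w f M(1)
    by (intro continuous_map_add continuous_map_diff continuous_map_real_mult_left
        continuous_map_real_pow cont) (auto intro: subspace_add subspace_diff)
  moreover have "D x = 0" using D [OF x] by (simp add: w_def)
  ultimately obtain U where U: "openin X U" "x \<in> U" "\<And>y. y \<in> U \<Longrightarrow> dist (D y) 0 < \<epsilon>\<^sup>2"
    unfolding continuous_map_euclidean_iff using x \<epsilon> by (metis zero_less_power)
  have "dist (P y f) (P x f) < \<epsilon>" if y: "y \<in> U" for y
  proof -
    have "y \<in> topspace X" using U(1) y openin_subset by blast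
    with U(3) [OF y] have "(dist (P y f) w)\<^sup>2 < \<epsilon>\<^sup>2" by (simp add: D)
    then show ?thesis
      unfolding w_def using \<epsilon> by (simp add: power_less_imp_less_base)
  qed
  with U show "\<exists>U. openin X U \<and> x \<in> U \<and> (\<forall>y\<in>U. dist (P y f) (P x f) < \<epsilon>)" by blast
qed

lemma continuous_map_contractions_dense:
  fixes P :: "'x \<Rightarrow> 'a::real_normed_vector \<Rightarrow>\<^sub>L 'b::real_normed_vector"
  assumes contr: "\<And>x f. x \<in> topspace X \<Longrightarrow> norm (P x f) \<le> norm f"
    and dense: "\<And>f \<epsilon>. 0 < \<epsilon> \<Longrightarrow>
      \<exists>g. norm (f - g) < \<epsilon> \<and> continuous_map X euclidean (\<lambda>x. P x g)"
  shows "continuous_map X euclidean (\<lambda>x. P x f)"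
  unfolding continuous_map_euclidean_iff
proof (intro ballI allI impI)
  fix x and \<epsilon> :: real assume x: "x \<in> topspace X" and \<epsilon>: "0 < \<epsilon>"
  obtain g where g: "norm (f - g) < \<epsilon> / 3" "continuous_map X euclidean (\<lambda>x. P x g)"
    using dense [of "\<epsilon> / 3" f] \<epsilon> by auto
  have "0 < \<epsilon> / 3" using \<epsilon> by simp
  from g(2) [unfolded continuous_map_euclidean_iff, rule_format, OF x this]
  obtain U where U: "openin X U" "x \<in> U" "\<And>y. y \<in> U \<Longrightarrow> dist (P y g) (P x g) < \<epsilon> / 3"
    by auto
  have near: "dist (P y f) (P y g) < \<epsilon> / 3" if "y \<in> topspace X" for y
    using contr [OF that, of "f - g"] g(1) by (simp add: dist_norm blinfun.diff_right)
  have "dist (P y f) (P x f) < \<epsilon>" if y: "y \<in> U" for y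
  proof -
    have "y \<in> topspace X" using U(1) y openin_subset by blast
    from near [OF this] near [OF x] U(3) [OF y] show ?thesis
      using dist_triangle [of "P y f" "P x f" "P y g"] dist_triangle [of "P y g" "P x f" "P x g"]
        dist_commute [of "P x f" "P x g"] by linarith
  qed
  with U show "\<exists>U. openin X U \<and> x \<in> U \<and> (\<forall>y\<in>U. dist (P y f) (P x f) < \<epsilon>)" by blast
qed

lemma l2_finite_approx:
  fixes f :: "'i l2"
  assumes "0 < \<epsilon>"
  obtains A where "finite A" "norm (f - (\<Sum>i\<in>A. l2_apply f i *\<^sub>C l2_basis i)) < \<epsilon>"
proof -
  let ?q = "\<lambda>i. (cmod (l2_apply f i))\<^sup>2"
  obtain A where A: "finite A" "dist (sum ?q A) (\<Sum>\<^sub>\<infinity>i. ?q i) \<le> \<epsilon>\<^sup>2 / 2"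
    using infsum_finite_approximation [OF l2_summable [of f], of "\<epsilon>\<^sup>2 / 2"] assms by auto
  define g where "g = f - (\<Sum>i\<in>A. l2_apply f i *\<^sub>C l2_basis i)"
  have g: "l2_apply g i = (if i \<in> A then 0 else l2_apply f i)" for i
  proof -
    have "l2_apply (\<Sum>j\<in>A. l2_apply f j *\<^sub>C l2_basis j) i = (\<Sum>j\<in>A. if j = i then l2_apply f j else 0)"
      unfolding l2_apply_sum by (intro sum.cong) (auto simp: scaleC_l2.rep_eq l2_basis.rep_eq)
    then show ?thesis using A(1) by (simp add: g_def minus_l2.rep_eq)
  qed
  have "(norm g)\<^sup>2 = (\<Sum>\<^sub>\<infinity>i\<in>UNIV - A. ?q i)"
    unfolding norm_l2_squared by (rule infsum_cong_neutral) (auto simp: g)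
  also have "\<dots> = (\<Sum>\<^sub>\<infinity>i. ?q i) - sum ?q A"
    using A(1) by (subst infsum_Diff) (auto simp: l2_summable)
  also have "\<dots> \<le> \<epsilon>\<^sup>2 / 2" using A(2) unfolding dist_real_def by linarith
  also have "\<dots> < \<epsilon>\<^sup>2" using assms by simp
  finally have "norm g < \<epsilon>" using assms by (simp add: power_less_imp_less_base)
  with A(1) show thesis unfolding g_def by (rule that)
qed


section \<open>Sections of the bundle\<close>

context
  fixes H :: "'h::complex_hilbert itself"
    and E :: "'e topology" and X :: "'x topology" and \<pi> :: "'e \<Rightarrow> 'x"
    and add :: "'e \<Rightarrow> 'e \<Rightarrow> 'e" and zero :: "'x \<Rightarrow> 'e"
    and scal :: "complex \<Rightarrow> 'e \<Rightarrow> 'e" and mul :: "'e \<Rightarrow> 'e \<Rightarrow> 'e"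
    and N :: "('e \<Rightarrow> real) set"
    and I :: "'x \<Rightarrow> ('d::finite fock \<Rightarrow>\<^sub>L 'd fock) set"
    and \<theta> :: "'x \<Rightarrow> 'd free_series set \<Rightarrow> 'e"
  assumes H: "infinite_dimensional H"
    and is_bundle: "lc_algebra_bundle E X \<pi> add zero scal mul N"
    and graded: "\<And>x. x \<in> topspace X \<Longrightarrow> graded_ideal (I x)"
    and fibers: "\<And>x. x \<in> topspace X \<Longrightarrow>
      lc_algebra_iso
        (free_quot_topology H (ideal_closure H (I x)))
        (quot_add (ideal_closure H (I x)))
        (quot_smult (ideal_closure H (I x)))
        (quot_mult (ideal_closure H (I x)))
        (subtopology E (fiber E \<pi> x)) add scal mul (\<theta> x)"
    and sections: "\<And>i::'d. continuous_map X E
      (\<lambda>x. \<theta> x (series_coset (ideal_closure H (I x)) (to_series (creation i))))"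
begin

interpretation lc_algebra_bundle E X \<pi> add zero scal mul N by (rule is_bundle)

text \<open>The section formed by the classes of a fixed series in all fibers; \<open>S\<^sub>i\<close> is \<open>poly_section z\<^sub>i\<close>.\<close>

definition poly_section :: "'d free_series \<Rightarrow> 'x \<Rightarrow> 'e" where
  "poly_section F x = \<theta> x (series_coset (ideal_closure H (I x)) F)"

lemma topspace_free_quot:
  "topspace (free_quot_topology H J) = series_coset J ` (free_hol H :: 'd free_series set)"
proof (rule antisym)
  let ?T = "free_hol_topology H :: 'd free_series topology"
  show "topspace (free_quot_topology H J) \<subseteq> series_coset J ` free_hol H"
    using iffD1 [OF openin_quotient_topology openin_topspace, of ?T "series_coset J"]
    by (simp add: free_quot_topology_def topspace_free_hol [OF H])
  have "{F \<in> topspace ?T. series_coset J F \<in> series_coset J ` topspace ?T} = topspace ?T" by blast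
  then have "openin (free_quot_topology H J) (series_coset J ` topspace ?T)"
    unfolding free_quot_topology_def openin_quotient_topology by simp
  then show "series_coset J ` free_hol H \<subseteq> topspace (free_quot_topology H J)"
    using openin_subset topspace_free_hol [OF H] by metis
qed

lemma coset_in_topspace:
  "F \<in> free_hol H \<Longrightarrow> series_coset J F \<in> topspace (free_quot_topology H J)"
  for F :: "'d free_series"
  by (simp add: topspace_free_quot)

lemma poly_section_fiber:
  assumes x: "x \<in> topspace X" and F: "F \<in> free_hol H"
  shows "poly_section F x \<in> topspace E" and "\<pi> (poly_section F x) = x"
proof -
  have "\<theta> x ` topspace (free_quot_topology H (ideal_closure H (I x)))
      = topspace (subtopology E (fiber E \<pi> x))"
    using fibers [OF x] homeomorphic_imp_surjective_map unfolding lc_algebra_iso_def by blast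
  then have "poly_section F x \<in> topspace (subtopology E (fiber E \<pi> x))"
    using coset_in_topspace [OF F] unfolding poly_section_def by blast
  then show "poly_section F x \<in> topspace E" "\<pi> (poly_section F x) = x"
    by (auto simp: fiber_def)
qed

lemma ideal_closure_subspace: "x \<in> topspace X \<Longrightarrow> series_subspace (ideal_closure H (I x))"
  unfolding ideal_closure_eq [OF H]
  using to_series_free_hol [OF H]
  by (intro series_subspace_wclosure [OF H] series_subspace_to_series graded) auto

lemma poly_section_add:
  assumes x: "x \<in> topspace X" and F: "F \<in> free_hol H" "G \<in> free_hol H"
  shows "poly_section (series_add F G) x = add (poly_section F x) (poly_section G x)"
  using fibers [OF x] coset_in_topspace F quot_add_coset [OF ideal_closure_subspace [OF x], of F G]
  unfolding lc_algebra_iso_def poly_section_def by metis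

lemma poly_section_smult:
  assumes x: "x \<in> topspace X" and F: "F \<in> free_hol H"
  shows "poly_section (series_smult c F) x = scal c (poly_section F x)"
  using fibers [OF x] coset_in_topspace F quot_smult_coset [OF ideal_closure_subspace [OF x], of c F]
  unfolding lc_algebra_iso_def poly_section_def by metis

lemma poly_section_mult:
  assumes x: "x \<in> topspace X" and A: "A \<in> poly_alg" and B: "B \<in> poly_alg"
  shows "poly_section (series_mult (to_series A) (to_series B)) x
    = mul (poly_section (to_series A) x) (poly_section (to_series B) x)"
proof -
  have "quot_mult (ideal_closure H (I x)) (series_coset (ideal_closure H (I x)) (to_series A))
      (series_coset (ideal_closure H (I x)) (to_series B))
    = series_coset (ideal_closure H (I x)) (series_mult (to_series A) (to_series B))"
    unfolding ideal_closure_eq [OF H]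
  proof (rule quot_mult_coset [OF H])
    note ideal = to_series_graded_ideal_mult [OF graded [OF x]]
    show "series_mult (to_series A) p \<in> to_series ` I x" if "p \<in> to_series ` I x" for p
      using that ideal(1) [OF A] by blast
    show "series_mult p (to_series B) \<in> to_series ` I x" if "p \<in> to_series ` I x" for p
      using that ideal(2) [OF B] by blast
    show "series_mult p q \<in> to_series ` I x" if "p \<in> to_series ` I x" "q \<in> to_series ` I x" for p q
      using that ideal(1) graded_ideal_poly [OF graded [OF x]] by blast
  qed (auto simp: to_series_free_hol [OF H] intro: series_subspace_to_series graded x)
  then show ?thesis
    using fibers [OF x] coset_in_topspace to_series_free_hol [OF H]
    unfolding lc_algebra_iso_def poly_section_def by metis
qed

lemma continuous_map_fiberwise:
  assumes "continuous_map X E s" "continuous_map X E t"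
    and "\<And>x. x \<in> topspace X \<Longrightarrow> \<pi> (s x) = \<pi> (t x)"
    and op: "continuous_map (fiber_product E \<pi>) E (\<lambda>(a, b). op a b)"
  shows "continuous_map X E (\<lambda>x. op (s x) (t x))"
proof -
  have "continuous_map X (fiber_product E \<pi>) (\<lambda>x. (s x, t x))"
    unfolding fiber_product_def using assms(1-3)
    by (auto simp: continuous_map_in_subtopology continuous_map_paired)
  from continuous_map_compose [OF this op] show ?thesis by (simp add: o_def)
qed

lemma continuous_poly_section_smult:
  assumes "continuous_map X E (poly_section F)" "F \<in> free_hol H"
  shows "continuous_map X E (poly_section (series_smult c F))"
proof -
  have "continuous_map X (prod_topology E euclidean) (\<lambda>x. (poly_section F x, c))"
    using assms by (simp add: continuous_map_paired)
  from continuous_map_compose [OF this A2]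
  have "continuous_map X E (\<lambda>x. scal c (poly_section F x))" by (simp add: o_def)
  then show ?thesis
    by (rule continuous_map_eq) (simp add: poly_section_smult assms(2))
qed

lemma continuous_poly_section_add:
  assumes "continuous_map X E (poly_section F)" "F \<in> free_hol H"
    "continuous_map X E (poly_section G)" "G \<in> free_hol H"
  shows "continuous_map X E (poly_section (series_add F G))"
proof -
  have "continuous_map X E (\<lambda>x. add (poly_section F x) (poly_section G x))"
    by (rule continuous_map_fiberwise [OF assms(1,3) _ A1]) (simp add: poly_section_fiber assms)
  then show ?thesis
    by (rule continuous_map_eq) (simp add: poly_section_add assms)
qed

lemma continuous_poly_section_word:
  assumes "\<alpha> \<noteq> []"
  shows "continuous_map X E (poly_section (to_series (op_word creation \<alpha>)))"
  using assms
proof (induction \<alpha> rule: list_nonempty_induct)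
  case (single i)
  have "op_word creation [i] = creation i" by (rule blinfun_eqI) simp
  then show ?case using sections [of i] by (simp add: poly_section_def [abs_def])
next
  case (cons i \<alpha>)
  have word: "op_word creation \<beta> \<in> poly_alg" for \<beta> :: "'d list"
    unfolding poly_alg_eq_span by (intro complex_vector.span_base rangeI)
  have "op_word creation [i] = creation i" by (rule blinfun_eqI) simp
  with word [of "[i]"] have poly: "creation i \<in> poly_alg" by simp
  have i: "continuous_map X E (poly_section (to_series (creation i)))"
    using sections [of i] by (simp add: poly_section_def [abs_def])
  have "continuous_map X E (\<lambda>x. mul (poly_section (to_series (creation i)) x)
      (poly_section (to_series (op_word creation \<alpha>)) x))"
    by (rule continuous_map_fiberwise [OF i cons.IH _ A3])
      (simp add: poly_section_fiber to_series_free_hol [OF H])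
  moreover have "op_word creation (i # \<alpha>) = creation i o\<^sub>L op_word creation \<alpha>"
    by (simp add: op_word_def)
  then have "to_series (op_word creation (i # \<alpha>))
      = series_mult (to_series (creation i)) (to_series (op_word creation \<alpha>))"
    using to_series_mult [OF poly word [of \<alpha>]] word [of "i # \<alpha>"] by simp
  ultimately show ?case
    by (elim continuous_map_eq) (simp add: poly_section_mult poly word)
qed

text \<open>The sections \<open>S\<^sub>i\<close> generate the classes of nonempty words only, which restricts the degree to
  \<open>k \<ge> 1\<close>.  The zero section, the start of the induction, is a multiple of some \<open>S\<^sub>i\<close>.\<close>

lemma continuous_poly_section_homogeneous:
  assumes k: "1 \<le> k"
  shows "continuous_map X E (poly_section (l2_apply (hcomp k F)))"
proof -
  have word: "l2_apply (l2_basis \<alpha>) = to_series (op_word creation \<alpha>)" for \<alpha> :: "'d list"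
    by (simp add: Ev_word [symmetric] l2_apply_Ev)
  have zero: "l2_apply 0 = series_smult 0 (l2_apply (l2_basis \<alpha>))" for \<alpha> :: "'d list"
    by (simp add: fun_eq_iff zero_l2.rep_eq series_smult_def)
  have step: "l2_apply (F \<alpha> *\<^sub>C l2_basis \<alpha> + g)
      = series_add (series_smult (F \<alpha>) (l2_apply (l2_basis \<alpha>))) (l2_apply g)" for \<alpha> g
    by (simp add: fun_eq_iff plus_l2.rep_eq scaleC_l2.rep_eq series_smult_def series_add_def)
  have "l2_apply (\<Sum>\<alpha>\<in>A. F \<alpha> *\<^sub>C l2_basis \<alpha>) \<in> free_hol H \<and>
      continuous_map X E (poly_section (l2_apply (\<Sum>\<alpha>\<in>A. F \<alpha> *\<^sub>C l2_basis \<alpha>)))"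
    if "finite A" "[] \<notin> A" for A
    using that
  proof (induction A)
    case empty
    have "continuous_map X E (poly_section (series_smult 0 (l2_apply (l2_basis [undefined]))))"
      unfolding word
      by (intro continuous_poly_section_smult continuous_poly_section_word to_series_free_hol [OF H]) simp
    then show ?case
      by (simp add: zero [of "[undefined]"] word free_hol_smult [OF H] to_series_free_hol [OF H])
  next
    case (insert \<alpha> A)
    have "continuous_map X E (poly_section (l2_apply (l2_basis \<alpha>)))"
      unfolding word using insert.prems by (intro continuous_poly_section_word) auto
    moreover have "l2_apply (l2_basis \<alpha>) \<in> free_hol H"
      by (simp add: word to_series_free_hol [OF H])
    ultimately show ?case
      using insert
      by (simp add: step continuous_poly_section_add continuous_poly_section_smult
          free_hol_add [OF H] free_hol_smult [OF H])
  qed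
  moreover have "[] \<notin> {\<alpha>. length (\<alpha> :: 'd list) = k}" using k by simp
  ultimately show ?thesis unfolding hcomp_def using finite_words by blast
qed

text \<open>Along the section \<open>poly_section F\<close> the seminorm takes the value \<open>r\<^sup>k \<parallel>P\<^sub>x f\<parallel>\<close>.\<close>

lemma continuous_norm_ideal_proj:
  assumes r: "0 < r" "r < 1" and k: "1 \<le> k" and f: "hcomp k (l2_apply f) = f"
    and seminorm: "continuous_map E euclideanreal
      (\<lambda>e. quot_seminorm H (ideal_closure H (I (\<pi> e))) r
        (inv_into (series_coset (ideal_closure H (I (\<pi> e))) ` free_hol H) (\<theta> (\<pi> e)) e))"
  shows "continuous_map X euclideanreal (\<lambda>x. norm (ideal_proj (I x) f))"
proof -
  define F where "F = l2_apply f"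
  have sec: "continuous_map X E (poly_section F)"
    using continuous_poly_section_homogeneous [OF k, of "l2_apply f"] by (simp add: F_def f)
  have F: "F \<in> free_hol H"
  proof (rule finite_support_free_hol [OF H finite_subset])
    show "{\<alpha>. F \<alpha> \<noteq> 0} \<subseteq> {\<alpha>. length \<alpha> = k}"
      using l2_apply_hcomp [of k "l2_apply f"] f unfolding F_def
      by (metis (mono_tags, lifting) Collect_mono)
  qed (rule finite_words)
  have "continuous_map X euclideanreal (\<lambda>x. r ^ k * norm (ideal_proj (I x) f))"
  proof (rule continuous_map_eq [OF continuous_map_compose [OF sec seminorm]])
    fix x assume x: "x \<in> topspace X"
    let ?J = "ideal_closure H (I x)"
    have "inj_on (\<theta> x) (series_coset ?J ` free_hol H)"
      using fibers [OF x] homeomorphic_imp_injective_map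
      unfolding lc_algebra_iso_def topspace_free_quot [symmetric] by blast
    then have "inv_into (series_coset ?J ` free_hol H) (\<theta> x) (poly_section F x) = series_coset ?J F"
      unfolding poly_section_def using F by (intro inv_into_f_f) auto
    moreover have "quot_seminorm H ?J r (series_coset ?J F) = r ^ k * norm (ideal_proj (I x) f)"
      unfolding F_def by (rule quot_seminorm_homogeneous [OF H graded [OF x] r f])
    ultimately show "((\<lambda>e. quot_seminorm H (ideal_closure H (I (\<pi> e))) r
        (inv_into (series_coset (ideal_closure H (I (\<pi> e))) ` free_hol H) (\<theta> (\<pi> e)) e)) \<circ> poly_section F) x
        = r ^ k * norm (ideal_proj (I x) f)"
      by (simp add: poly_section_fiber(2) [OF x F])
  qed
  then have "continuous_map X euclideanreal (\<lambda>x. (1 / r ^ k) * (r ^ k * norm (ideal_proj (I x) f)))"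
    by (rule continuous_map_real_mult_left)
  then show ?thesis using r by simp
qed

end

theorem theorem8:
  fixes H :: "'h::complex_hilbert itself"
    and E :: "'e topology" and X :: "'x topology" and \<pi> :: "'e \<Rightarrow> 'x"
    and add :: "'e \<Rightarrow> 'e \<Rightarrow> 'e" and zero :: "'x \<Rightarrow> 'e"
    and scal :: "complex \<Rightarrow> 'e \<Rightarrow> 'e" and mul :: "'e \<Rightarrow> 'e \<Rightarrow> 'e"
    and N :: "('e \<Rightarrow> real) set"
    and I :: "'x \<Rightarrow> ('d::finite fock \<Rightarrow>\<^sub>L 'd fock) set"
    and \<theta> :: "'x \<Rightarrow> 'd free_series set \<Rightarrow> 'e"
    and r :: real
  assumes infinite_dim: "infinite_dimensional H"
    and is_bundle: "lc_algebra_bundle E X \<pi> add zero scal mul N"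
    and graded: "\<And>x. x \<in> topspace X \<Longrightarrow> graded_ideal (I x)"
    and fibers: "\<And>x. x \<in> topspace X \<Longrightarrow>
      lc_algebra_iso
        (free_quot_topology H (ideal_closure H (I x)))
        (quot_add (ideal_closure H (I x)))
        (quot_smult (ideal_closure H (I x)))
        (quot_mult (ideal_closure H (I x)))
        (subtopology E (fiber E \<pi> x)) add scal mul (\<theta> x)"
    and sections: "\<And>i::'d. continuous_map X E
      (\<lambda>x. \<theta> x (series_coset (ideal_closure H (I x)) (to_series (creation i))))"
    and "0 < r" and "r < 1"
    and seminorm: "continuous_map E euclideanreal
      (\<lambda>e. quot_seminorm H (ideal_closure H (I (\<pi> e))) r
        (inv_into (series_coset (ideal_closure H (I (\<pi> e))) ` free_hol H) (\<theta> (\<pi> e)) e))"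
  shows "continuous_map X proj_topology (\<lambda>x. ideal_proj (I x))"
proof -
  let ?P = "\<lambda>x. ideal_proj (I x)"
  have lin: "linear (\<lambda>f. hcomp k (l2_apply f) :: 'd fock)" for k
    by (rule bounded_linear.linear [OF bounded_linear_hcomp])
  have homogeneous: "continuous_map X euclidean (\<lambda>x. ?P x f)"
    if f: "hcomp k (l2_apply f) = f" for k f
  proof (cases "k = 0")
    case True
    have "continuous_map X euclidean (\<lambda>x. f)" by simp
    then show ?thesis
      by (rule continuous_map_eq) (use f True in \<open>simp add: ideal_proj_vacuum graded\<close>)
  next
    case False
    show ?thesis
    proof (rule continuous_map_projections [where M = "{f. hcomp k (l2_apply f) = f}"])
      show "inner (?P x f) g = inner (?P x f) (?P x g)" if "x \<in> topspace X" for x f g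
        unfolding ideal_proj_def by (rule inner_orthogonal_proj [OF csubspace_Ev [OF graded [OF that]]])
      show "subspace {f. hcomp k (l2_apply f) = (f :: 'd fock)}"
        by (simp add: subspace_def linear_add [OF lin] linear_cmul [OF lin] linear_0 [OF lin])
      show "?P x f \<in> {f. hcomp k (l2_apply f) = f}"
        if "x \<in> topspace X" "f \<in> {f. hcomp k (l2_apply f) = f}" for x f
        using that by (simp add: hcomp_ideal_proj graded)
      show "continuous_map X euclideanreal (\<lambda>x. norm (?P x f))"
        if "f \<in> {f. hcomp k (l2_apply f) = f}" for f
        using that False
        by (intro continuous_norm_ideal_proj [OF infinite_dim is_bundle graded fibers sections
              \<open>0 < r\<close> \<open>r < 1\<close> _ _ seminorm]) auto
    qed (simp add: f)
  qed
  have "continuous_map X euclidean (\<lambda>x. ?P x f)" for f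
  proof (rule continuous_map_contractions_dense)
    show "norm (?P x f) \<le> norm f" if "x \<in> topspace X" for x f
      unfolding ideal_proj_def by (rule norm_orthogonal_proj_le [OF csubspace_Ev [OF graded [OF that]]])
    fix f :: "'d fock" and \<epsilon> :: real assume "0 < \<epsilon>"
    then obtain A where A: "finite A" "norm (f - (\<Sum>\<alpha>\<in>A. l2_apply f \<alpha> *\<^sub>C l2_basis \<alpha>)) < \<epsilon>"
      by (rule l2_finite_approx)
    have "hcomp (length \<alpha>) (l2_apply (c *\<^sub>C l2_basis \<alpha>)) = c *\<^sub>C l2_basis \<alpha>" for c and \<alpha> :: "'d list"
      by (rule l2_eqI) (simp add: l2_apply_hcomp scaleC_l2.rep_eq l2_basis.rep_eq)
    then have "continuous_map X euclidean (\<lambda>x. \<Sum>\<alpha>\<in>A. ?P x (l2_apply f \<alpha> *\<^sub>C l2_basis \<alpha>))"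
      by (intro continuous_map_sum A homogeneous)
    then have "continuous_map X euclidean (\<lambda>x. ?P x (\<Sum>\<alpha>\<in>A. l2_apply f \<alpha> *\<^sub>C l2_basis \<alpha>))"
      by (simp add: blinfun.sum_right)
    with A(2) show "\<exists>g. norm (f - g) < \<epsilon> \<and> continuous_map X euclidean (\<lambda>x. ?P x g)" by blast
  qed
  then have "continuous_map X strong_operator_topology ?P"
    by (simp add: continuous_on_strong_operator_topo_iff_coordinatewise)
  then show ?thesis
    unfolding proj_topology_def proj_space_def
    by (auto simp: continuous_map_in_subtopology intro: graded)
qed

end
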